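(* In the spherical deconvolution model with known exploration density $f^{\star}$ described in the context, assume that $\mathbb{Q}^{\star}$ has finite second moment and is centered, and that $R^{\star}\in(R_{\min},R_{\max})$. Then $\sqrt n(\widetilde R-R^{\star},\widetilde C-C^{\star})$ converges in distribution to a centered Gaussian distribution on $\mathbb{R}^{d+1}$ with covariance matrix $\Sigma=AVA^T$, where $A=\begin{pmatrix}0_{1\times d}&-\frac{1}{M''(R^{\star})}\\ I_d&\frac{E(S(U_1))}{M''(R^{\star})}\end{pmatrix}$ and $V$ is the $(d+1)\times(d+1)$ covariance matrix of the centered Gaussian limit in distribution of $\sqrt n\left(\frac1n\sum_{i=1}^nY_i-E(Y_1),\,M_n'(R^{\star})\right)$ (this limit exists and $M''(R^{\star})\ne0$ under these assumptions).
   Context: Let $d\ge2$. Observations $Y_i=X_i+\varepsilon_i$, $i=1,\dots,n$, i.i.d., $X_i=C^{\star}+R^{\star}S(U_i)$, where $U_i$ i.i.d. in $[0,1]^{d-1}$ with known density $f^{\star}$, $\varepsilon_i$ i.i.d. with law $\mathbb{Q}^{\star}$, independent of $(U_i)$. $S(u)$ is the unit-sphere point with $S(u)^{(1)}=\cos(2\pi u^{(1)})$, $S(u)^{(k)}=\sin(2\pi u^{(1)})\prod_{l=2}^{k-1}\sin(\pi u^{(l)})\cos(\pi u^{(k)})$ ($2\le k\le d-1$), $S(u)^{(d)}=\sin(2\pi u^{(1)})\prod_{l=2}^{d-1}\sin(\pi u^{(l)})$. Standing assumptions: (H1) the coordinates of $\varepsilon_1$ are independent; (H2) $f^{\star}$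 is a Lebesgue density on $[0,1]^{d-1}$, positive on $(0,\gamma)^{d-1}$ for some $\gamma>0$ when $d>2$. $\Psi_{f,R}(t)=\int_{(0,1)^{d-1}}\exp\{iRt^TS(u)\}f(u)du$; write $t=(t_1,t_2)$, $t_1\in\mathbb{R}$, $t_2\in\mathbb{R}^{d-1}$; $\tilde\psi_n(t)=\frac1n\sum_\ell\exp\{it^TY_\ell\}$. Fix $\nu_{\mathrm{est}}>0$, $B_\nu=[-\nu,\nu]$. $M_n(R)=\int_{B_{\nu_{\mathrm{est}}}\times B^{d-1}_{\nu_{\mathrm{est}}}}|\Psi_{f^{\star},R}(t_1,t_2)\tilde\psi_n(t_1,0)\tilde\psi_n(0,t_2)-\tilde\psi_n(t_1,t_2)\Psi_{f^{\star},R}(t_1,0)\Psi_{f^{\star},R}(0,t_2)|^2dt_1dt_2$ and $M(R)=\int_{B_{\nu_{\mathrm{est}}}\times B^{d-1}_{\nu_{\mathrm{est}}}}|\Psi_{f^{\star},R}(t_1,t_2)\Psi_{f^{\star},R^{\star}}(t_1,0)\Psi_{f^{\star},R^{\star}}(0,t_2)-\Psi_{f^{\star},R^{\star}}(t_1,t_2)\Psi_{f^{\star},R}(t_1,0)\Psi_{f^{\star},R}(0,t_2)|^2|\Phi_\varepsilon(t_1,t_2)|^2dt_1dt_2$, with $\Phi_\varepsilon$ the characteristic function of $\varepsilon_1$; $'$ and $''$ denote derivatives in $R$. With $0<R_{\min}<R_{\max}$, $\widetilde R$ is a minimizer of $M_n$ over $[R_{\min},R_{\max}]$ and $\widetilde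 C=\frac1n\sum_iY_i-\widetilde R\int_{(0,1)^{d-1}}S(u)f^{\star}(u)du$. *)

theory Defs
  imports "HOL-Probability.Probability"
begin

text \<open>Vectors of R^k are represented as functions nat => real, coordinate j of the
paper (1-based) being index j-1 here; only indices < k matter.  Lebesgue measure on R^k
is the product measure on the extensional functions over the index set {..<k}.\<close>

definition lebK :: "nat \<Rightarrow> (nat \<Rightarrow> real) measure" where
  "lebK k = (\<Pi>\<^sub>M j\<in>{..<k}. lborel)"

definition ip :: "nat \<Rightarrow> (nat \<Rightarrow> real) \<Rightarrow> (nat \<Rightarrow> real) \<Rightarrow> real" where
  "ip k t x = (\<Sum>j<k. t j * x j)"

definition Sph :: "nat \<Rightarrow> (nat \<Rightarrow> real) \<Rightarrow> nat \<Rightarrow> real" where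
  "Sph d u j =
     (if j = 0 then cos (2 * pi * u 0)
      else if j < d - 1 then sin (2 * pi * u 0) * (\<Prod>l\<in>{1..<j}. sin (pi * u l)) * cos (pi * u j)
      else if j = d - 1 then sin (2 * pi * u 0) * (\<Prod>l\<in>{1..<d - 1}. sin (pi * u l))
      else 0)"

definition open_cube :: "nat \<Rightarrow> (nat \<Rightarrow> real) set" where
  "open_cube k = {u. \<forall>j<k. 0 < u j \<and> u j < 1}"

definition closed_cube :: "nat \<Rightarrow> (nat \<Rightarrow> real) set" where
  "closed_cube k = {u. \<forall>j<k. 0 \<le> u j \<and> u j \<le> 1}"

definition box_nu :: "nat \<Rightarrow> real \<Rightarrow> (nat \<Rightarrow> real) set" where
  "box_nu k \<nu> = {t. \<forall>j<k. \<bar>t j\<bar> \<le> \<nu>}"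

definition e1 :: "(nat \<Rightarrow> real) \<Rightarrow> nat \<Rightarrow> real" where
  "e1 t = (\<lambda>j. if j = 0 then t 0 else 0)"

definition e2 :: "(nat \<Rightarrow> real) \<Rightarrow> nat \<Rightarrow> real" where
  "e2 t = (\<lambda>j. if j = 0 then 0 else t j)"

definition Psi :: "nat \<Rightarrow> ((nat \<Rightarrow> real) \<Rightarrow> real) \<Rightarrow> real \<Rightarrow> (nat \<Rightarrow> real) \<Rightarrow> complex" where
  "Psi d f R t = (\<integral>u. of_real (indicator (open_cube (d - 1)) u * f u) * cis (R * ip d t (Sph d u))
                    \<partial>lebK (d - 1))"

definition psin :: "nat \<Rightarrow> (nat \<Rightarrow> 'a \<Rightarrow> nat \<Rightarrow> real) \<Rightarrow> nat \<Rightarrow> 'a \<Rightarrow> (nat \<Rightarrow> real) \<Rightarrow> complex" where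
  "psin d Y n \<omega> t = of_real (1 / real n) * (\<Sum>l<n. cis (ip d t (Y l \<omega>)))"

definition charf :: "nat \<Rightarrow> (nat \<Rightarrow> real) measure \<Rightarrow> (nat \<Rightarrow> real) \<Rightarrow> complex" where
  "charf d Q t = (\<integral>x. cis (ip d t x) \<partial>Q)"

definition Mn :: "nat \<Rightarrow> ((nat \<Rightarrow> real) \<Rightarrow> real) \<Rightarrow> real \<Rightarrow> (nat \<Rightarrow> 'a \<Rightarrow> nat \<Rightarrow> real)
                   \<Rightarrow> nat \<Rightarrow> 'a \<Rightarrow> real \<Rightarrow> real" where
  "Mn d f \<nu> Y n \<omega> R =
     (\<integral>t. indicator (box_nu d \<nu>) t *
          (cmod (Psi d f R t * psin d Y n \<omega> (e1 t) * psin d Y n \<omega> (e2 t)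
                 - psin d Y n \<omega> t * Psi d f R (e1 t) * Psi d f R (e2 t)))\<^sup>2 \<partial>lebK d)"

definition Mlim :: "nat \<Rightarrow> ((nat \<Rightarrow> real) \<Rightarrow> real) \<Rightarrow> real \<Rightarrow> (nat \<Rightarrow> real) measure
                     \<Rightarrow> real \<Rightarrow> real \<Rightarrow> real" where
  "Mlim d f \<nu> Q Rstar R =
     (\<integral>t. indicator (box_nu d \<nu>) t *
          (cmod (Psi d f R t * Psi d f Rstar (e1 t) * Psi d f Rstar (e2 t)
                 - Psi d f Rstar t * Psi d f R (e1 t) * Psi d f R (e2 t)))\<^sup>2 *
          (cmod (charf d Q t))\<^sup>2 \<partial>lebK d)"

definition centered_gaussian :: "nat \<Rightarrow> (nat \<Rightarrow> nat \<Rightarrow> real) \<Rightarrow> (nat \<Rightarrow> real) measure \<Rightarrow> bool" where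
  "centered_gaussian k Sig N \<longleftrightarrow>
     prob_space N \<and> sets N = sets (lebK k) \<and>
     (\<forall>t. (\<integral>x. cis (ip k t x) \<partial>N) =
          of_real (exp (- (\<Sum>i<k. \<Sum>j<k. t i * Sig i j * t j) / 2)))"

definition bdd_cont_test :: "nat \<Rightarrow> ((nat \<Rightarrow> real) \<Rightarrow> real) \<Rightarrow> bool" where
  "bdd_cont_test k g \<longleftrightarrow>
     bounded (range g) \<and>
     (\<forall>x y. (\<forall>j<k. x j = y j) \<longrightarrow> g x = g y) \<and>
     (\<forall>x e. e > 0 \<longrightarrow> (\<exists>\<delta>>0. \<forall>y. sqrt (\<Sum>j<k. (x j - y j)\<^sup>2) < \<delta> \<longrightarrow> \<bar>g x - g y\<bar> < e))"

definition conv_distr :: "'a measure \<Rightarrow> nat \<Rightarrow> (nat \<Rightarrow> 'a \<Rightarrow> nat \<Rightarrow> real) \<Rightarrow> (nat \<Rightarrow> real) measure \<Rightarrow> bool" where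
  "conv_distr M k Z N \<longleftrightarrow>
     (\<forall>n. (\<lambda>\<omega>. restrict (Z n \<omega>) {..<k}) \<in> M \<rightarrow>\<^sub>M lebK k) \<and>
     (\<forall>g. bdd_cont_test k g \<longrightarrow>
          (\<lambda>n. \<integral>\<omega>. g (Z n \<omega>) \<partial>M) \<longlonglongrightarrow> (\<integral>x. g x \<partial>N))"

definition ES_f :: "nat \<Rightarrow> ((nat \<Rightarrow> real) \<Rightarrow> real) \<Rightarrow> nat \<Rightarrow> real" where
  "ES_f d f j = (\<integral>u. indicator (open_cube (d - 1)) u * f u * Sph d u j \<partial>lebK (d - 1))"

definition Ctilde :: "nat \<Rightarrow> ((nat \<Rightarrow> real) \<Rightarrow> real) \<Rightarrow> (nat \<Rightarrow> 'a \<Rightarrow> nat \<Rightarrow> real)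
                       \<Rightarrow> (nat \<Rightarrow> 'a \<Rightarrow> real) \<Rightarrow> nat \<Rightarrow> 'a \<Rightarrow> nat \<Rightarrow> real" where
  "Ctilde d f Y Rt n \<omega> j = (1 / real n) * (\<Sum>i<n. Y i \<omega> j) - Rt n \<omega> * ES_f d f j"

text \<open>The matrix A (size (d+1)x(d+1)), with ES = E(S(U_1)) and m2 = M''(R*).\<close>
definition Amat :: "nat \<Rightarrow> (nat \<Rightarrow> real) \<Rightarrow> real \<Rightarrow> nat \<Rightarrow> nat \<Rightarrow> real" where
  "Amat d ES m2 i j =
     (if i = 0 then (if j = d then - 1 / m2 else 0)
      else (if j = d then ES (i - 1) / m2 else if j = i - 1 then 1 else 0))"

definition sandwich :: "nat \<Rightarrow> (nat \<Rightarrow> nat \<Rightarrow> real) \<Rightarrow> (nat \<Rightarrow> nat \<Rightarrow> real) \<Rightarrow> nat \<Rightarrow> nat \<Rightarrow> real" where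
  "sandwich k A V i j = (\<Sum>a<k. \<Sum>b<k. A i a * V a b * A j b)"

end

theory Submission
  imports Defs
begin

text \<open>
  Write \<open>a\<^sub>R\<close> for the characteristic function of \<open>R S(U)\<close>, \<open>b\<^sub>R(t) = a\<^sub>R(t\<^sub>1,0) a\<^sub>R(0,t\<^sub>2)\<close>,
  and \<open>p\<close>, \<open>q\<close> for the characteristic function of \<open>Y\<close> and the product of its two marginals. Since the
  noise has independent coordinates, \<open>M\<close> and \<open>M\<^sub>n\<close> are the integrals of \<open>\<bar>a\<^sub>R q - b\<^sub>R p\<bar>\<^sup>2\<close>
  for the true and the empirical pair \<open>(p, q)\<close>, and \<open>a\<^sub>R q = b\<^sub>R p\<close> at the true radius.

  If \<open>M\<close> vanished at another radius, or \<open>M''\<close> at the true one, then \<open>a\<^sub>R(v) / b\<^sub>R(v)\<close> would be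
  constant along rays, so \<open>a = b\<close> near the origin; the terms of order two in each block give
  \<open>Var (S\<^sub>1\<^sup>2) = 0\<close> because \<open>S\<close> lies on the unit sphere, contradicting that \<open>U\<close> has a density.

  Every error term is bounded by the integrated squared distance between the empirical and the true
  characteristic functions, which has mean of order \<open>1/n\<close>. Hence \<open>sqrt n M\<^sub>n'\<close> at the true radius is
  a normalized i.i.d. sum up to \<open>o(1)\<close> in mean, and the mean value theorem transfers this to the minimizer.
\<close>

section \<open>Weak convergence from characteristic functions\<close>

text \<open>The characteristic function of the noise may have zeros, so a vanishing contrast gives
  information only near the origin, where that function is nonzero. This is enough because scaling a
  frequency amounts to scaling the radius: an identity near the origin at fixed radii becomes, on
  each ray, an identity at all smaller radii, and at radius zero the ratio of \<open>P 0\<close> and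
  \<open>Q 0\<close> is one.

  Two kinds of error control are needed. The contrast and its second derivative are compared through
  a first-order distance, which is replaced by \<open>s\<close> times a squared distance plus a
  constant over \<open>s\<close>; with \<open>s = sqrt n\<close> both terms vanish in mean. The
  first derivative at the true radius must survive the factor \<open>sqrt n\<close>. There the true
  residual is zero, so that everything beyond the linear part is quadratic in the deviations, of
  order 1/n in mean.

  Both vectors of the theorem are then linear images of one normalized i.i.d. sum up to negligible
  errors, which is why a single \<open>V\<close> serves both limits. Characteristic functions handle
  linear maps and negligible errors easily, so weak convergence is deduced from them.\<close>

lemma measurable_cis [measurable]: "cis \<in> borel_measurable borel"
  by (intro borel_measurable_continuous_onI continuous_on_cis continuous_on_id)

lemma measurable_lebK_component [measurable (raw)]:
  "j < k \<Longrightarrow> (\<lambda>x. x j) \<in> borel_measurable (lebK k)"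
  unfolding lebK_def
  using measurable_component_singleton[of j "{..<k}" "\<lambda>_. lborel :: real measure"] by simp

lemma measurable_lebK_restrict:
  assumes "\<And>j. j < k \<Longrightarrow> (\<lambda>\<omega>. Z \<omega> j) \<in> borel_measurable M"
  shows "(\<lambda>\<omega>. restrict (Z \<omega>) {..<k}) \<in> M \<rightarrow>\<^sub>M lebK k"
  unfolding lebK_def using assms by (intro measurable_restrict) auto

lemma measurable_ip [measurable]: "ip k t \<in> borel_measurable (lebK k)"
  unfolding ip_def by measurable

lemma ip_restrict [simp]: "ip k t (restrict x {..<k}) = ip k t x"
  by (simp add: ip_def)

lemma ip_split: "ip d t x = ip d (e1 t) x + ip d (e2 t) x"
  unfolding ip_def sum.distrib[symmetric] by (intro sum.cong) (auto simp: e1_def e2_def)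

lemma cis_sum: "finite A \<Longrightarrow> cis (\<Sum>i\<in>A. f i) = (\<Prod>i\<in>A. cis (f i))"
  by (induction A rule: finite_induct) (auto simp: cis_mult[symmetric])

lemma norm_cis_diff_le: "cmod (cis x - cis y) \<le> \<bar>x - y\<bar>"
proof -
  have "cmod (cis x - cis y) = cmod (cis y * (cis (x - y) - 1))"
    by (simp add: algebra_simps cis_mult)
  also have "\<dots> = cmod (iexp (x - y) - 1)"
    by (simp add: norm_mult cis_conv_exp)
  also have "\<dots> \<le> \<bar>x - y\<bar>"
    using iexp_approx1[of "x - y" 0] by simp
  finally show ?thesis .
qed

text \<open>The Euclidean distance of the first \<open>k\<close> coordinates is a continuous
  function in the product topology on all sequences, so continuity of \<open>g\<close> for that
  distance carries over to the product topology.\<close>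

lemma bdd_cont_test_continuous:
  assumes "bdd_cont_test k g"
  shows "continuous_on UNIV g"
  unfolding continuous_on_eq_continuous_at[OF open_UNIV]
proof (intro ballI)
  fix x :: "nat \<Rightarrow> real"
  show "isCont g x"
    unfolding isCont_def tendsto_iff
  proof (intro allI impI)
    fix e :: real assume "e > 0"
    with assms obtain \<delta> where \<delta>: "\<delta> > 0"
      "\<And>y. sqrt (\<Sum>j<k. (x j - y j)\<^sup>2) < \<delta> \<Longrightarrow> \<bar>g x - g y\<bar> < e"
      unfolding bdd_cont_test_def by meson
    have "isCont (\<lambda>y. sqrt (\<Sum>j<k. (x j - y j)\<^sup>2)) x"
    proof (intro continuous_intros)
      fix j show "isCont (\<lambda>y. y j) x"
        using continuous_on_eq_continuous_at[OF open_UNIV] continuous_on_product_coordinates[of j] by blast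
    qed
    then have "((\<lambda>y. sqrt (\<Sum>j<k. (x j - y j)\<^sup>2)) \<longlongrightarrow> 0) (at x)"
      by (simp add: isCont_def)
    then have "\<forall>\<^sub>F y in at x. sqrt (\<Sum>j<k. (x j - y j)\<^sup>2) < \<delta>"
      using \<delta>(1) by (rule order_tendstoD)
    then show "\<forall>\<^sub>F y in at x. dist (g y) (g x) < e"
      by eventually_elim (use \<delta>(2) in \<open>force simp: dist_real_def abs_minus_commute\<close>)
  qed
qed

lemma bdd_cont_test_measurable:
  assumes "bdd_cont_test k g"
  shows "g \<in> borel_measurable (lebK k)"
proof -
  \<comment> \<open>Points of \<open>lebK k\<close> are \<open>undefined\<close> from index
    \<open>k\<close> on. Extending by 0 instead lands measurably in the full product, whose
    sigma-algebra is the Borel one, and does not change the value of \<open>g\<close>.\<close>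
  let ?ext = "\<lambda>x j. if j < k then x j else (0::real)"
  have "g \<in> borel_measurable borel"
    by (intro borel_measurable_continuous_onI bdd_cont_test_continuous[OF assms])
  then have g: "g \<in> borel_measurable (Pi\<^sub>M UNIV (\<lambda>_. borel))"
    using measurable_cong_sets[OF sets_PiM_equal_borel refl] by blast
  have "?ext \<in> lebK k \<rightarrow>\<^sub>M Pi\<^sub>M UNIV (\<lambda>_. borel)"
  proof (rule measurable_PiM_single')
    fix j show "(\<lambda>x. if j < k then x j else 0) \<in> borel_measurable (lebK k)"
      by (cases "j < k") auto
  qed auto
  from measurable_compose[OF this g] have "(\<lambda>x. g (?ext x)) \<in> borel_measurable (lebK k)" .
  moreover have "g (?ext x) = g x" for x
    using assms unfolding bdd_cont_test_def by auto
  ultimately show ?thesis by simp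
qed

text \<open>Finite sums of characters: their expectations converge as soon as the characteristic
  functions do. Exponents add under multiplication, so the class is an algebra and contains the
  polynomials in sines of the coordinates.\<close>

inductive_set trig_poly :: "nat \<Rightarrow> ((nat \<Rightarrow> real) \<Rightarrow> complex) set" for k where
  trig_poly_cis: "(\<lambda>x. c * cis (ip k t x)) \<in> trig_poly k"
| trig_poly_add: "p \<in> trig_poly k \<Longrightarrow> q \<in> trig_poly k \<Longrightarrow> (\<lambda>x. p x + q x) \<in> trig_poly k"

lemma trig_poly_cis_mult:
  assumes "p \<in> trig_poly k"
  shows "(\<lambda>x. c * cis (ip k t x) * p x) \<in> trig_poly k"
  using assms
proof induction
  case (trig_poly_cis c' t')
  have "(\<lambda>x. c * cis (ip k t x) * (c' * cis (ip k t' x))) =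
        (\<lambda>x. (c * c') * cis (ip k (\<lambda>j. t j + t' j) x))"
    by (auto simp: ip_def cis_mult[symmetric] sum.distrib algebra_simps)
  then show ?case by (simp add: trig_poly.trig_poly_cis)
next
  case (trig_poly_add p q)
  then show ?case
    using trig_poly.trig_poly_add[OF trig_poly_add.IH] by (simp add: algebra_simps)
qed

lemma trig_poly_mult:
  assumes "p \<in> trig_poly k" "q \<in> trig_poly k"
  shows "(\<lambda>x. p x * q x) \<in> trig_poly k"
  using assms(1)
proof induction
  case (trig_poly_cis c t)
  then show ?case by (rule trig_poly_cis_mult[OF assms(2)])
next
  case (trig_poly_add p p')
  then show ?case
    using trig_poly.trig_poly_add[OF trig_poly_add.IH] by (simp add: algebra_simps)
qed

lemma trig_poly_const: "(\<lambda>x. c) \<in> trig_poly k"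
  using trig_poly_cis[of c k "\<lambda>_. 0"] by (simp add: ip_def)

lemma trig_poly_sin:
  assumes "j < k"
  shows "(\<lambda>x. complex_of_real (sin (a * x j))) \<in> trig_poly k"
proof -
  let ?t = "\<lambda>s i. if i = j then s else 0"
  have ip: "ip k (?t s) x = s * x j" for s x
    using assms by (simp add: ip_def if_distrib[of "\<lambda>y. y * _"] cong: if_cong)
  have "(\<lambda>x. complex_of_real (sin (a * x j))) =
      (\<lambda>x. (- \<i> / 2) * cis (ip k (?t a) x) + (\<i> / 2) * cis (ip k (?t (- a)) x))"
    unfolding ip by (auto simp: complex_eq_iff)
  then show ?thesis
    by (simp only:) (intro trig_poly_add trig_poly_cis)
qed

text \<open>The algebra to which the Stone-Weierstrass theorem is applied on a compact cube; its
  members become trigonometric polynomials once sines are put in for the coordinates.\<close>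

inductive_set coord_poly :: "nat \<Rightarrow> ((nat \<Rightarrow> real) \<Rightarrow> real) set" for k where
  coord_poly_const: "(\<lambda>x. c) \<in> coord_poly k"
| coord_poly_coord: "j < k \<Longrightarrow> (\<lambda>x. x j) \<in> coord_poly k"
| coord_poly_add: "p \<in> coord_poly k \<Longrightarrow> q \<in> coord_poly k \<Longrightarrow> (\<lambda>x. p x + q x) \<in> coord_poly k"
| coord_poly_mult: "p \<in> coord_poly k \<Longrightarrow> q \<in> coord_poly k \<Longrightarrow> (\<lambda>x. p x * q x) \<in> coord_poly k"

lemma coord_poly_continuous: "p \<in> coord_poly k \<Longrightarrow> continuous_on A p"
proof (induction rule: coord_poly.induct)
  case (coord_poly_coord j)
  show ?case
    by (rule continuous_on_subset[OF continuous_on_product_coordinates]) simp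
qed (auto intro: continuous_on_add continuous_on_mult)

lemma coord_poly_sin_trig:
  "p \<in> coord_poly k \<Longrightarrow> (\<lambda>x. complex_of_real (p (\<lambda>j. if j < k then sin (a * x j) else 0))) \<in> trig_poly k"
proof (induction rule: coord_poly.induct)
  case (coord_poly_const c)
  show ?case by (rule trig_poly_const)
next
  case (coord_poly_coord j)
  then show ?case using trig_poly_sin[of j k a] by simp
next
  case (coord_poly_add p q)
  then show ?case using trig_poly_add by fastforce
next
  case (coord_poly_mult p q)
  then show ?case using trig_poly_mult by fastforce
qed

text \<open>Coordinates from \<open>k\<close> on are pinned at 0: the set is then compact by
  Tychonoff's theorem, and the first \<open>k\<close> coordinates separate its points.\<close>

lemma coord_poly_approx:
  assumes g: "continuous_on {x. \<forall>j. x j \<in> (if j < k then {-1..1} else {0})} g" and e: "e > 0"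
  shows "\<exists>p\<in>coord_poly k. \<forall>x. (\<forall>j. x j \<in> (if j < k then {-1..1} else {0})) \<longrightarrow> \<bar>g x - p x\<bar> < e"
proof -
  let ?S = "{x :: nat \<Rightarrow> real. \<forall>j. x j \<in> (if j < k then {-1..1} else {0})}"
  have "?S = PiE UNIV (\<lambda>j. if j < k then {-1..1} else {0})"
    by (auto simp: PiE_def Pi_def)
  moreover have "compactin (product_topology (\<lambda>_. euclideanreal) UNIV)
      (PiE UNIV (\<lambda>j::nat. if j < k then {-1..1} else {0}))"
    by (subst compactin_PiE) auto
  ultimately have S: "compact ?S"
    by (simp add: euclidean_product_topology flip: compactin_euclidean_iff)
  interpret function_ring_on "coord_poly k" ?S
  proof
    fix x y :: "nat \<Rightarrow> real" assume xy: "x \<in> ?S" "y \<in> ?S" "x \<noteq> y"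
    then obtain j where "x j \<noteq> y j" by (meson ext)
    with xy have "j < k" by (cases "j < k") (auto dest!: spec[of _ j])
    with \<open>x j \<noteq> y j\<close> show "\<exists>f\<in>coord_poly k. f x \<noteq> f y"
      by (intro bexI[of _ "\<lambda>x. x j"]) (auto intro: coord_poly_coord)
  qed (use S in \<open>auto intro: coord_poly.intros coord_poly_continuous simp del: mem_Collect_eq if_split\<close>)
  from Stone_Weierstrass_basic[OF g e] show ?thesis by auto
qed

text \<open>\<open>L * arcsin (sin (x / L))\<close> is periodic and continuous, and equals
  \<open>x\<close> when \<open>x / L\<close> is small. After this substitution \<open>g\<close> is a
  continuous function of sines, hence a uniform limit of trigonometric polynomials on the whole
  space and not only on compact sets.\<close>

lemma trig_poly_approx:
  assumes g: "bdd_cont_test k g" and e: "e > 0" and L: "L > 0"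
  shows "\<exists>p. (\<lambda>x. complex_of_real (p x)) \<in> trig_poly k \<and>
           (\<forall>x. \<bar>g (\<lambda>j. L * arcsin (sin (x j / L))) - p x\<bar> < e)"
proof -
  let ?S = "{x :: nat \<Rightarrow> real. \<forall>j. x j \<in> (if j < k then {-1..1} else {0})}"
  have "continuous_on ?S (\<lambda>s. g (\<lambda>j. L * arcsin (s j)))"
  proof (rule continuous_on_compose2[OF bdd_cont_test_continuous[OF g]])
    have "continuous_on ?S (\<lambda>s. L * arcsin (s j))" for j
    proof (intro continuous_intros)
      show "continuous_on ?S (\<lambda>s. s j)"
        by (rule continuous_on_subset[OF continuous_on_product_coordinates]) simp
      have "- 1 \<le> x j \<and> x j \<le> 1" if "x \<in> ?S" for x
        using that by (cases "j < k") (auto dest!: spec[of _ j])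
      then show "\<forall>x\<in>?S. - 1 \<le> x j \<and> x j \<le> 1" by blast
    qed
    then show "continuous_on ?S (\<lambda>s j. L * arcsin (s j))"
      by (rule continuous_on_coordinatewise_then_product)
  qed auto
  from coord_poly_approx[OF this e] obtain p where p: "p \<in> coord_poly k"
    "\<And>x. x \<in> ?S \<Longrightarrow> \<bar>g (\<lambda>j. L * arcsin (x j)) - p x\<bar> < e"
    by auto
  let ?s = "\<lambda>x j. if j < k then sin (1 / L * x j) else 0"
  have "\<bar>g (\<lambda>j. L * arcsin (sin (x j / L))) - p (?s x)\<bar> < e" for x
  proof -
    have "g (\<lambda>j. L * arcsin (sin (x j / L))) = g (\<lambda>j. L * arcsin (?s x j))"
      using g unfolding bdd_cont_test_def by auto
    moreover have "?s x \<in> ?S" by auto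
    ultimately show ?thesis using p(2)[of "?s x"] by simp
  qed
  moreover have "(\<lambda>x. complex_of_real (p (?s x))) \<in> trig_poly k"
    by (rule coord_poly_sin_trig[OF p(1)])
  ultimately show ?thesis
    by (intro exI[of _ "\<lambda>x. p (?s x)"]) auto
qed


lemma trig_poly_integral_tendsto:
  assumes M: "prob_space M" and N: "prob_space N" and sets_N: "sets N = sets (lebK k)"
    and Z: "\<And>n. (\<lambda>\<omega>. restrict (Z n \<omega>) {..<k}) \<in> M \<rightarrow>\<^sub>M lebK k"
    and conv: "\<And>t. (\<lambda>n. \<integral>\<omega>. cis (ip k t (Z n \<omega>)) \<partial>M) \<longlonglongrightarrow> (\<integral>x. cis (ip k t x) \<partial>N)"
    and p: "p \<in> trig_poly k"
  shows "(\<forall>n. integrable M (\<lambda>\<omega>. p (Z n \<omega>))) \<and> integrable N p \<and>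
         (\<lambda>n. \<integral>\<omega>. p (Z n \<omega>) \<partial>M) \<longlonglongrightarrow> (\<integral>x. p x \<partial>N)"
  using p
proof induction
  case (trig_poly_cis c t)
  interpret M: prob_space M by fact
  interpret N: prob_space N by fact
  have [measurable]: "ip k t \<in> borel_measurable N"
    using measurable_ip[of k t] measurable_cong_sets[OF sets_N refl] by blast
  have [measurable]: "(\<lambda>\<omega>. ip k t (Z n \<omega>)) \<in> borel_measurable M" for n
    using measurable_compose[OF Z measurable_ip[of k t]] by simp
  show ?case
    by (intro conjI allI M.integrable_const_bound[where B="cmod c"] N.integrable_const_bound[where B="cmod c"])
       (auto simp: norm_mult intro!: tendsto_mult_left conv)
next
  case (trig_poly_add p q)
  then show ?case by (auto intro: tendsto_add)
qed

text \<open>A frequency supported on one axis yields the characteristic function of a marginal, so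
  the one-dimensional continuity theorem applies. The result serves to control the tails.\<close>

lemma coordinate_integral_tendsto:
  fixes f :: "real \<Rightarrow> real"
  assumes M: "prob_space M" and N: "prob_space N" and sets_N: "sets N = sets (lebK k)"
    and Z: "\<And>n. (\<lambda>\<omega>. restrict (Z n \<omega>) {..<k}) \<in> M \<rightarrow>\<^sub>M lebK k"
    and conv: "\<And>t. (\<lambda>n. \<integral>\<omega>. cis (ip k t (Z n \<omega>)) \<partial>M) \<longlonglongrightarrow> (\<integral>x. cis (ip k t x) \<partial>N)"
    and j: "j < k" and f: "\<And>x. isCont f x" "\<And>x. norm (f x) \<le> B"
  shows "(\<lambda>n. \<integral>\<omega>. f (Z n \<omega> j) \<partial>M) \<longlonglongrightarrow> (\<integral>x. f (x j) \<partial>N)"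
proof -
  interpret M: prob_space M by fact
  interpret N: prob_space N by fact
  have [measurable]: "(\<lambda>x. x j) \<in> borel_measurable N"
    using measurable_lebK_component[OF j] measurable_cong_sets[OF sets_N refl] by blast
  have [measurable]: "(\<lambda>\<omega>. Z n \<omega> j) \<in> borel_measurable M" for n
    using measurable_compose[OF Z measurable_lebK_component[OF j]] j by simp
  have [measurable]: "f \<in> borel_measurable borel"
    using f(1) by (intro borel_measurable_continuous_onI continuous_at_imp_continuous_on) auto
  let ?D = "\<lambda>n. distr M borel (\<lambda>\<omega>. Z n \<omega> j)" and ?D' = "distr N borel (\<lambda>x. x j)"
  have D: "real_distribution (?D n)" for n by (intro M.real_distribution_distr) simp
  have D': "real_distribution ?D'" by (intro N.real_distribution_distr) simp
  have ip: "ip k (\<lambda>i. if i = j then s else 0) x = s * x j" for s x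
    using j by (simp add: ip_def if_distrib[of "\<lambda>y. y * _"] cong: if_cong)
  have "weak_conv_m ?D ?D'"
  proof (rule levy_continuity[OF D D'])
    fix s
    show "(\<lambda>n. char (?D n) s) \<longlonglongrightarrow> char ?D' s"
      using conv[of "\<lambda>i. if i = j then s else 0"] unfolding ip
      by (simp add: char_def integral_distr cis_conv_exp)
  qed
  from weak_conv_imp_integral_bdd_continuous_conv[OF D D' this f]
  show ?thesis by (simp add: integral_distr)
qed

text \<open>The Levy continuity theorem in dimension \<open>k\<close> for a known limit law.
  Tightness is replaced by a direct comparison: \<open>g\<close> is within \<open>w\<close> of a
  trigonometric polynomial, where \<open>w\<close> measures how far out the point lies. The means of
  \<open>w\<close> converge because each of its summands depends on a single coordinate.\<close>

lemma conv_distr_of_char_tendsto: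
  assumes M: "prob_space M" and N: "prob_space N" and sets_N: "sets N = sets (lebK k)"
    and Z: "\<And>n. (\<lambda>\<omega>. restrict (Z n \<omega>) {..<k}) \<in> M \<rightarrow>\<^sub>M lebK k"
    and conv: "\<And>t. (\<lambda>n. \<integral>\<omega>. cis (ip k t (Z n \<omega>)) \<partial>M) \<longlonglongrightarrow> (\<integral>x. cis (ip k t x) \<partial>N)"
  shows "conv_distr M k Z N"
  unfolding conv_distr_def
proof (intro conjI allI impI Z)
  interpret M: prob_space M by fact
  interpret N: prob_space N by fact
  fix g assume g: "bdd_cont_test k g"
  then have g_cong: "g x = g y" if "\<And>j. j < k \<Longrightarrow> x j = y j" for x y
    using that unfolding bdd_cont_test_def by blast
  obtain B where B: "B > 0" "\<And>x. \<bar>g x\<bar> \<le> B"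
    using g unfolding bdd_cont_test_def bounded_pos by auto
  have gN [measurable]: "g \<in> borel_measurable N"
    using bdd_cont_test_measurable[OF g] measurable_cong_sets[OF sets_N refl] by blast
  have gZ [measurable]: "(\<lambda>\<omega>. g (Z n \<omega>)) \<in> borel_measurable M" for n
  proof -
    have "(\<lambda>\<omega>. g (restrict (Z n \<omega>) {..<k})) \<in> borel_measurable M"
      using measurable_compose[OF Z bdd_cont_test_measurable[OF g]] .
    moreover have "g (restrict (Z n \<omega>) {..<k}) = g (Z n \<omega>)" for \<omega>
      by (rule g_cong) simp
    ultimately show ?thesis by simp
  qed
  have xN [measurable (raw)]: "j < k \<Longrightarrow> (\<lambda>x. x j) \<in> borel_measurable N" for j
    using measurable_lebK_component[of j k] measurable_cong_sets[OF sets_N refl] by blast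
  have xZ [measurable (raw)]: "j < k \<Longrightarrow> (\<lambda>\<omega>. Z n \<omega> j) \<in> borel_measurable M" for n j
    using measurable_compose[OF Z measurable_lebK_component[of j k]] by simp
  have gN_int: "integrable N g"
    using B by (intro N.integrable_const_bound[where B=B]) auto
  have gZ_int: "integrable M (\<lambda>\<omega>. g (Z n \<omega>))" for n
    using B by (intro M.integrable_const_bound[where B=B]) auto
  \<comment> \<open>A continuous stand-in for the indicator of a tail: it is 1 once
    \<open>\<bar>y\<bar>\<close> reaches \<open>Suc m\<close> and tends to 0 pointwise as
    \<open>m\<close> grows. Continuity is what makes its mean converge.\<close>
  define h where "h m y = min 1 ((y / real (Suc m))\<^sup>2)" for m y
  have h01: "0 \<le> h m y" "h m y \<le> 1" for m y by (auto simp: h_def)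
  have h_cont: "isCont (h m) y" for m y
    unfolding h_def by (intro continuous_intros) auto
  have h_meas [measurable]: "h m \<in> borel_measurable borel" for m
    unfolding h_def by measurable
  have hN_int: "integrable N (\<lambda>x. h m (x j))" if "j < k" for m j
    using that h01 by (intro N.integrable_const_bound[where B=1]) auto
  have hZ_int: "integrable M (\<lambda>\<omega>. h m (Z n \<omega> j))" if "j < k" for m n j
    using that h01 by (intro M.integrable_const_bound[where B=1]) auto
  show "(\<lambda>n. \<integral>\<omega>. g (Z n \<omega>) \<partial>M) \<longlonglongrightarrow> (\<integral>x. g x \<partial>N)"
  proof (rule LIMSEQ_I)
    fix e :: real assume "e > 0"
    \<comment> \<open>The budget: \<open>w\<close> costs less than \<open>2 * e'\<close> under the
      law of \<open>Z n\<close> and again under \<open>N\<close>, and the trigonometric polynomial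
      costs less than \<open>e'\<close>.\<close>
    define e' where "e' = e / 5"
    have "e' > 0" using \<open>e > 0\<close> by (simp add: e'_def)
    have "(\<lambda>m. \<integral>x. h m (x j) \<partial>N) \<longlonglongrightarrow> (\<integral>x. 0 \<partial>N)" if "j < k" for j
    proof (rule integral_dominated_convergence[where w="\<lambda>_. 1"])
      show "AE x in N. (\<lambda>m. h m (x j)) \<longlonglongrightarrow> 0"
      proof (intro AE_I2)
        fix x
        have "(\<lambda>m. (x j / real (Suc m))\<^sup>2) \<longlonglongrightarrow> 0\<^sup>2"
          by (intro tendsto_power lim_const_over_n[THEN LIMSEQ_Suc])
        then have "(\<lambda>m. min 1 ((x j / real (Suc m))\<^sup>2)) \<longlonglongrightarrow> min 1 (0\<^sup>2)"
          by (intro tendsto_min tendsto_const)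
        then show "(\<lambda>m. h m (x j)) \<longlonglongrightarrow> 0" by (simp add: h_def)
      qed
    qed (use h01 that in auto)
    then have "(\<lambda>m. 2 * B * (\<Sum>j<k. \<integral>x. h m (x j) \<partial>N)) \<longlonglongrightarrow> 2 * B * (\<Sum>j<k. \<integral>x. 0 \<partial>N)"
      by (intro tendsto_intros) auto
    then have "\<forall>\<^sub>F m in sequentially. 2 * B * (\<Sum>j<k. \<integral>x. h m (x j) \<partial>N) < e'"
      using \<open>e' > 0\<close> by (intro order_tendstoD(2)) auto
    then obtain m where m: "2 * B * (\<Sum>j<k. \<integral>x. h m (x j) \<partial>N) < e'"
      by (auto simp: eventually_sequentially)
    \<comment> \<open>With this \<open>L\<close>, \<open>h m\<close> is 1 as soon as one coordinate
      exceeds \<open>L\<close> in modulus; inside the cube every \<open>x j / L\<close> is within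
      \<open>pi / 2\<close> of 0, where \<open>arcsin\<close> inverts \<open>sin\<close>.\<close>
    define L where "L = real (Suc m)"
    have "L > 0" by (simp add: L_def)
    obtain p where p: "(\<lambda>x. complex_of_real (p x)) \<in> trig_poly k"
      "\<And>x. \<bar>g (\<lambda>j. L * arcsin (sin (x j / L))) - p x\<bar> < e'"
      using trig_poly_approx[OF g \<open>e' > 0\<close> \<open>L > 0\<close>] by blast
    define w where "w x = 2 * B * (\<Sum>j<k. h m (x j)) + e'" for x
    have gp: "\<bar>g x - p x\<bar> \<le> w x" for x
    proof -
      have "\<bar>g x - g (\<lambda>j. L * arcsin (sin (x j / L)))\<bar> \<le> 2 * B * (\<Sum>j<k. h m (x j))"
      proof (cases "\<forall>j<k. \<bar>x j\<bar> \<le> L")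
        case True
        have "L * arcsin (sin (x j / L)) = x j" if "j < k" for j
        proof -
          have "\<bar>x j / L\<bar> \<le> 1" using True that \<open>L > 0\<close> by (simp add: abs_div)
          then have "\<bar>x j / L\<bar> \<le> pi / 2" using pi_ge_two by linarith
          then have "arcsin (sin (x j / L)) = x j / L" by (intro arcsin_sin; linarith)
          then show ?thesis using \<open>L > 0\<close> by simp
        qed
        then have "g (\<lambda>j. L * arcsin (sin (x j / L))) = g x" by (intro g_cong) auto
        then show ?thesis using B h01 by (auto intro!: mult_nonneg_nonneg sum_nonneg)
      next
        case False
        then obtain i where i: "i < k" "\<bar>x i\<bar> > L" by force
        have "1 \<le> (x i / L)\<^sup>2"
          using i(2) \<open>L > 0\<close> by (simp add: abs_le_square_iff[of 1, simplified, symmetric])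
        then have "h m (x i) = 1" by (simp add: h_def L_def)
        moreover have "h m (x i) \<le> (\<Sum>j<k. h m (x j))"
          using i h01 by (intro member_le_sum) auto
        ultimately have "2 * B * 1 \<le> 2 * B * (\<Sum>j<k. h m (x j))"
          using B by (intro mult_left_mono) auto
        moreover have "\<bar>g x - g (\<lambda>j. L * arcsin (sin (x j / L)))\<bar> \<le> 2 * B"
          using B(2)[of x] B(2)[of "\<lambda>j. L * arcsin (sin (x j / L))"] by linarith
        ultimately show ?thesis by linarith
      qed
      then show ?thesis using p(2)[of x] unfolding w_def by linarith
    qed
    have wN: "integrable N w"
      unfolding w_def using hN_int
      by (intro Bochner_Integration.integrable_add integrable_mult_right Bochner_Integration.integrable_sum) auto
    have wZ: "integrable M (\<lambda>\<omega>. w (Z n \<omega>))" for n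
      unfolding w_def using hZ_int
      by (intro Bochner_Integration.integrable_add integrable_mult_right Bochner_Integration.integrable_sum) auto
    have wN_eq: "(\<integral>x. w x \<partial>N) = 2 * B * (\<Sum>j<k. \<integral>x. h m (x j) \<partial>N) + e'"
      unfolding w_def using hN_int
      by (subst Bochner_Integration.integral_add)
         (auto simp: Bochner_Integration.integral_sum N.prob_space
           intro!: integrable_mult_right Bochner_Integration.integrable_sum)
    have wZ_eq: "(\<integral>\<omega>. w (Z n \<omega>) \<partial>M) = 2 * B * (\<Sum>j<k. \<integral>\<omega>. h m (Z n \<omega> j) \<partial>M) + e'" for n
      unfolding w_def using hZ_int
      by (subst Bochner_Integration.integral_add)
         (auto simp: Bochner_Integration.integral_sum M.prob_space
           intro!: integrable_mult_right Bochner_Integration.integrable_sum)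
    have w_lim: "(\<integral>x. w x \<partial>N) < 2 * e'" using m wN_eq by simp
    have "(\<lambda>n. 2 * B * (\<Sum>j<k. \<integral>\<omega>. h m (Z n \<omega> j) \<partial>M) + e')
            \<longlonglongrightarrow> 2 * B * (\<Sum>j<k. \<integral>x. h m (x j) \<partial>N) + e'"
      using h01 h_cont
      by (intro tendsto_intros coordinate_integral_tendsto[OF M N sets_N Z conv, where B=1]) auto
    then have "(\<lambda>n. \<integral>\<omega>. w (Z n \<omega>) \<partial>M) \<longlonglongrightarrow> (\<integral>x. w x \<partial>N)"
      by (simp add: wN_eq wZ_eq)
    then have ev1: "\<forall>\<^sub>F n in sequentially. (\<integral>\<omega>. w (Z n \<omega>) \<partial>M) < 2 * e'"
      using w_lim by (rule order_tendstoD)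
    note tp = trig_poly_integral_tendsto[OF M N sets_N Z conv p(1)]
    have pN: "integrable N p" and pZ: "integrable M (\<lambda>\<omega>. p (Z n \<omega>))" for n
      using tp by (auto simp: complex_of_real_integrable_eq)
    have "(\<lambda>n. \<integral>\<omega>. p (Z n \<omega>) \<partial>M) \<longlonglongrightarrow> (\<integral>x. p x \<partial>N)"
      using tp by (simp add: tendsto_of_real_iff)
    then have ev2: "\<forall>\<^sub>F n in sequentially. dist (\<integral>\<omega>. p (Z n \<omega>) \<partial>M) (\<integral>x. p x \<partial>N) < e'"
      using \<open>e' > 0\<close> by (rule tendstoD)
    have "\<forall>\<^sub>F n in sequentially. norm ((\<integral>\<omega>. g (Z n \<omega>) \<partial>M) - (\<integral>x. g x \<partial>N)) < e"
      using ev1 ev2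
    proof eventually_elim
      case (elim n)
      have "\<bar>(\<integral>\<omega>. g (Z n \<omega>) \<partial>M) - (\<integral>\<omega>. p (Z n \<omega>) \<partial>M)\<bar> \<le> (\<integral>\<omega>. w (Z n \<omega>) \<partial>M)"
      proof -
        have "\<bar>\<integral>\<omega>. g (Z n \<omega>) - p (Z n \<omega>) \<partial>M\<bar> \<le> (\<integral>\<omega>. w (Z n \<omega>) \<partial>M)"
          using gp gZ_int pZ wZ
          by (intro order.trans[OF integral_abs_bound] integral_mono) auto
        then show ?thesis using gZ_int pZ by simp
      qed
      moreover have "\<bar>(\<integral>x. g x \<partial>N) - (\<integral>x. p x \<partial>N)\<bar> \<le> (\<integral>x. w x \<partial>N)"
      proof -
        have "\<bar>\<integral>x. g x - p x \<partial>N\<bar> \<le> (\<integral>x. w x \<partial>N)"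
          using gp gN_int pN wN
          by (intro order.trans[OF integral_abs_bound] integral_mono) auto
        then show ?thesis using gN_int pN by simp
      qed
      ultimately show ?case
        using elim w_lim unfolding e'_def dist_real_def real_norm_def by linarith
    qed
    then show "\<exists>no. \<forall>n\<ge>no. norm ((\<integral>\<omega>. g (Z n \<omega>) \<partial>M) - (\<integral>x. g x \<partial>N)) < e"
      by (auto simp: eventually_sequentially)
  qed
qed

section \<open>Gaussian vectors and the central limit theorem\<close>

lemma cholesky_exists:
  fixes V :: "nat \<Rightarrow> nat \<Rightarrow> real"
  assumes sym: "\<And>i j. i < k \<Longrightarrow> j < k \<Longrightarrow> V i j = V j i"
    and psd: "\<And>x. 0 \<le> (\<Sum>i<k. \<Sum>j<k. x i * V i j * x j)"
  shows "\<exists>B. \<forall>i<k. \<forall>j<k. V i j = (\<Sum>l<k. B i l * B j l)"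
  using assms
proof (induction k arbitrary: V)
  case 0
  show ?case by simp
next
  case (Suc k)
  have form: "(\<Sum>i<Suc k. \<Sum>j<Suc k. x i * V i j * x j) =
      (\<Sum>i<k. \<Sum>j<k. x i * V i j * x j) + 2 * x k * (\<Sum>i<k. x i * V i k) + (x k)\<^sup>2 * V k k" for x
  proof -
    have "(\<Sum>j<k. x k * V k j * x j) = x k * (\<Sum>i<k. x i * V i k)"
      unfolding sum_distrib_left by (intro sum.cong) (auto simp: Suc.prems(1)[of k])
    moreover have "(\<Sum>i<k. x i * V i k * x k) = x k * (\<Sum>i<k. x i * V i k)"
      unfolding sum_distrib_left by (intro sum.cong) auto
    ultimately show ?thesis
      by (simp add: sum.distrib power2_eq_square algebra_simps)
  qed
  have psd: "0 \<le> (\<Sum>i<k. \<Sum>j<k. x i * V i j * x j) + 2 * c * (\<Sum>i<k. x i * V i k) + c\<^sup>2 * V k k" for x c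
  proof -
    have "0 \<le> (\<Sum>i<Suc k. \<Sum>j<Suc k. (x(k := c)) i * V i j * (x(k := c)) j)"
      by (rule Suc.prems(2))
    then show ?thesis unfolding form by simp
  qed
  have nonneg: "0 \<le> V k k" using psd[of "\<lambda>_. 0" 1] by simp
  \<comment> \<open>Without a square term the form is affine in \<open>c\<close>, and for a nonzero
    slope the coefficient used here makes it equal to -1. So a zero pivot has a zero column, and the
    value 0 returned by division by a zero pivot is the right one.\<close>
  have zero: "V i k = 0" if "V k k = 0" "i < k" for i
  proof (rule ccontr)
    assume nz: "V i k \<noteq> 0"
    define x where "x j = (if j = i then 1 else 0 :: real)" for j
    have x: "(\<Sum>i<k. x i * V i k) = V i k" "(\<Sum>i<k. \<Sum>j<k. x i * V i j * x j) = V i i"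
      using that(2) by (simp_all add: x_def if_distrib[of "\<lambda>y. y * _"] if_distrib[of "\<lambda>y. _ * y"] cong: if_cong)
    have "0 \<le> V i i + 2 * (- (V i i + 1) / (2 * V i k)) * V i k"
      using psd[of x "- (V i i + 1) / (2 * V i k)"] that(1) unfolding x by simp
    then show False using nz by (simp add: field_simps)
  qed
  define W where "W i j = V i j - V i k * V j k / V k k" for i j
  have "\<exists>B. \<forall>i<k. \<forall>j<k. W i j = (\<Sum>l<k. B i l * B j l)"
  proof (rule Suc.IH)
    fix i j assume "i < k" "j < k"
    then show "W i j = W j i" by (simp add: W_def Suc.prems(1)[of i j])
  next
    fix x :: "nat \<Rightarrow> real"
    define s where "s = (\<Sum>i<k. x i * V i k)"
    have "(\<Sum>i<k. \<Sum>j<k. x i * W i j * x j) =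
        (\<Sum>i<k. \<Sum>j<k. x i * V i j * x j) - (\<Sum>i<k. \<Sum>j<k. (x i * V i k) * (x j * V j k)) / V k k"
      by (simp add: W_def sum_subtractf sum_divide_distrib algebra_simps)
    also have "(\<Sum>i<k. \<Sum>j<k. (x i * V i k) * (x j * V j k)) = s * s"
      by (simp add: s_def sum_product)
    \<comment> \<open>For a positive pivot, \<open>- s / V k k\<close> minimises the form in the
      last coordinate and the minimum is the form of \<open>W\<close>. For a zero pivot both sides
      reduce to the form of \<open>V\<close>.\<close>
    also have "(\<Sum>i<k. \<Sum>j<k. x i * V i j * x j) - s * s / V k k =
       (\<Sum>i<k. \<Sum>j<k. x i * V i j * x j) + 2 * (- s / V k k) * s + (- s / V k k)\<^sup>2 * V k k"
      by (simp add: power2_eq_square)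
    also have "\<dots> \<ge> 0" unfolding s_def by (rule psd)
    finally show "0 \<le> (\<Sum>i<k. \<Sum>j<k. x i * W i j * x j)" .
  qed
  then obtain B where B: "\<And>i j. i < k \<Longrightarrow> j < k \<Longrightarrow> W i j = (\<Sum>l<k. B i l * B j l)" by blast
  \<comment> \<open>The last column of the factor carries the eliminated coordinate; the earlier
    columns factor the Schur complement.\<close>
  define B' where "B' i l = (if l < k then if i < k then B i l else 0 else V i k / sqrt (V k k))" for i l
  have "V i j = (\<Sum>l<Suc k. B' i l * B' j l)" if "i < Suc k" "j < Suc k" for i j
  proof -
    have sq: "V i k / sqrt (V k k) * (V j k / sqrt (V k k)) = V i k * V j k / V k k"
      using nonneg by (simp add: real_sqrt_mult_self)
    have eq: "V a k * V k k / V k k = V a k" if "a < Suc k" for a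
      using zero[of a] that by (cases "V k k = 0"; cases "a = k") auto
    have "(\<Sum>l<Suc k. B' i l * B' j l) =
        (if i < k \<and> j < k then W i j else 0) + V i k * V j k / V k k"
      using sq by (auto simp: B'_def B)
    also have "\<dots> = V i j"
      using that eq[of i] eq[of j] Suc.prems(1)[of i j]
      by (cases "i = k"; cases "j = k") (auto simp: W_def mult.commute)
    finally show ?thesis by simp
  qed
  then show ?case by blast
qed

text \<open>The image of \<open>k\<close> independent standard normals under a square root of
  \<open>V\<close>; as no density is involved, \<open>V\<close> may be singular. The characteristic
  function is a product over the independent components.\<close>

lemma centered_gaussian_exists:
  assumes sym: "\<And>i j. i < k \<Longrightarrow> j < k \<Longrightarrow> V i j = V j i"
    and psd: "\<And>x. 0 \<le> (\<Sum>i<k. \<Sum>j<k. x i * V i j * x j)"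
  shows "\<exists>N. centered_gaussian k V N"
proof -
  obtain B where B: "\<And>i j. i < k \<Longrightarrow> j < k \<Longrightarrow> V i j = (\<Sum>l<k. B i l * B j l)"
    using cholesky_exists[OF sym psd] by blast
  let ?P = "Pi\<^sub>M {..<k} (\<lambda>_. std_normal_distribution)"
  interpret P1: prob_space "std_normal_distribution"
    by (rule prob_space_normal_density) simp
  interpret product_prob_space "\<lambda>_. std_normal_distribution" "{..<k}"
    by unfold_locales
  interpret P: prob_space ?P by (rule prob_space_PiM) (rule P1.prob_space_axioms)
  define G where "G z = restrict (\<lambda>i. \<Sum>l<k. B i l * z l) {..<k}" for z
  have [measurable]: "(\<lambda>z. z l) \<in> borel_measurable ?P" if "l < k" for l
    using that measurable_component_singleton[of l "{..<k}" "\<lambda>_. std_normal_distribution"] by simp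
  have G [measurable]: "G \<in> ?P \<rightarrow>\<^sub>M lebK k"
    unfolding G_def by (intro measurable_lebK_restrict) simp
  have "(\<integral>x. cis (ip k t x) \<partial>distr ?P (lebK k) G) =
        of_real (exp (- (\<Sum>i<k. \<Sum>j<k. t i * V i j * t j) / 2))" for t
  proof -
    define c where "c l = (\<Sum>i<k. t i * B i l)" for l
    have ipG: "ip k t (G z) = (\<Sum>l<k. c l * z l)" for z
    proof -
      have "ip k t (G z) = (\<Sum>i<k. \<Sum>l<k. t i * B i l * z l)"
        by (simp add: ip_def G_def sum_distrib_left mult.assoc)
      also have "\<dots> = (\<Sum>l<k. \<Sum>i<k. t i * B i l * z l)" by (rule sum.swap)
      finally show ?thesis by (simp add: c_def sum_distrib_right)
    qed
    have "(\<integral>x. cis (ip k t x) \<partial>distr ?P (lebK k) G) = (\<integral>z. cis (\<Sum>l<k. c l * z l) \<partial>?P)"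
      by (subst integral_distr) (simp_all add: ipG)
    also have "\<dots> = (\<integral>z. (\<Prod>l<k. cis (c l * z l)) \<partial>?P)"
      by (simp add: cis_sum)
    also have "\<dots> = (\<Prod>l<k. \<integral>z. cis (c l * z) \<partial>std_normal_distribution)"
      by (intro product_integral_prod P1.integrable_const_bound[where B=1]) auto
    also have "\<dots> = (\<Prod>l<k. of_real (exp (- (c l)\<^sup>2 / 2)))"
      using char_std_normal_distribution
      by (simp add: char_def fun_eq_iff cis_conv_exp del: of_real_exp)
    also have "\<dots> = of_real (exp (\<Sum>l<k. - (c l)\<^sup>2 / 2))"
      by (simp only: exp_sum[OF finite_lessThan] of_real_prod)
    also have "(\<Sum>l<k. - (c l)\<^sup>2 / 2) = - (\<Sum>l<k. (c l)\<^sup>2) / 2"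
      by (simp add: sum_negf sum_divide_distrib)
    also have "(\<Sum>l<k. (c l)\<^sup>2) = (\<Sum>i<k. \<Sum>j<k. t i * V i j * t j)"
    proof -
      have "(\<Sum>l<k. (c l)\<^sup>2) = (\<Sum>l<k. \<Sum>i<k. \<Sum>j<k. t i * (B i l * B j l) * t j)"
        by (simp add: c_def power2_eq_square sum_product algebra_simps)
      also have "\<dots> = (\<Sum>i<k. \<Sum>l<k. \<Sum>j<k. t i * (B i l * B j l) * t j)" by (rule sum.swap)
      also have "\<dots> = (\<Sum>i<k. \<Sum>j<k. \<Sum>l<k. t i * (B i l * B j l) * t j)"
        by (intro sum.cong refl sum.swap)
      also have "\<dots> = (\<Sum>i<k. \<Sum>j<k. t i * V i j * t j)"
        by (simp add: B sum_distrib_left sum_distrib_right)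
      finally show ?thesis .
    qed
    finally show ?thesis .
  qed
  then have "centered_gaussian k V (distr ?P (lebK k) G)"
    unfolding centered_gaussian_def by (simp add: P.prob_space_distr)
  then show ?thesis ..
qed

lemma (in prob_space) clt_cis_real:
  fixes X :: "nat \<Rightarrow> 'a \<Rightarrow> real"
  assumes indep: "indep_vars (\<lambda>_. borel) X UNIV"
    and distr: "\<And>n. distr M borel (X n) = \<mu>"
    and int: "integrable \<mu> (\<lambda>x. x\<^sup>2)" and mean: "(\<integral>x. x \<partial>\<mu>) = 0"
  shows "(\<lambda>n. \<integral>\<omega>. cis ((\<Sum>i<n. X i \<omega>) / sqrt (real n)) \<partial>M) \<longlonglongrightarrow>
           of_real (exp (- (\<integral>x. x\<^sup>2 \<partial>\<mu>) / 2))"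
proof -
  have X [measurable]: "random_variable borel (X n)" for n
    using indep unfolding indep_vars_def2 by simp
  have int2: "integrable M (\<lambda>\<omega>. (X n \<omega>)\<^sup>2)" for n
    using int unfolding distr[of n, symmetric] by (subst (asm) integrable_distr_eq) auto
  have int1: "integrable M (X n)" for n
    by (rule square_integrable_imp_integrable[OF _ int2]) simp
  have mean0: "expectation (X n) = 0" for n
    using mean unfolding distr[of n, symmetric] by (subst (asm) integral_distr) auto
  have var: "variance (X n) = (\<integral>x. x\<^sup>2 \<partial>\<mu>)" for n
    unfolding distr[of n, symmetric] mean0 by (subst integral_distr) auto
  define v where "v = (\<integral>x. x\<^sup>2 \<partial>\<mu>)"
  have "v \<ge> 0" unfolding v_def by simp
  show ?thesis
  proof (cases "v = 0")
    case True
    \<comment> \<open>In the degenerate case every summand vanishes almost surely and both sides of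
      the limit are 1.\<close>
    have "AE \<omega> in M. X i \<omega> = 0" for i
    proof -
      have "(\<integral>\<omega>. (X i \<omega>)\<^sup>2 \<partial>M) = 0"
        using var[of i] True unfolding mean0 v_def by simp
      then have "AE \<omega> in M. (X i \<omega>)\<^sup>2 = 0"
        by (subst (asm) integral_nonneg_eq_0_iff_AE) (auto intro: int2)
      then show ?thesis by simp
    qed
    then have ae: "AE \<omega> in M. \<forall>i. X i \<omega> = 0" by (simp add: AE_all_countable)
    have "(\<integral>\<omega>. cis ((\<Sum>i<n. X i \<omega>) / sqrt (real n)) \<partial>M) = (\<integral>\<omega>. 1 \<partial>M)" for n
      by (rule integral_cong_AE) (use ae in auto)
    then show ?thesis using True by (simp add: prob_space v_def)
  next
    case False
    define \<sigma> where "\<sigma> = sqrt v"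
    have \<sigma>: "\<sigma> > 0" "\<sigma>\<^sup>2 = v" using False \<open>v \<ge> 0\<close> by (auto simp: \<sigma>_def)
    have wc: "weak_conv_m (\<lambda>n. distr M borel (\<lambda>x. (\<Sum>i<n. X i x) / sqrt (real n * \<sigma>\<^sup>2))) std_normal_distribution"
      using var \<sigma> unfolding v_def[symmetric]
      by (intro central_limit_theorem_zero_mean[OF indep mean0 \<sigma>(1) int2 _ distr]) simp
    \<comment> \<open>Evaluating at \<open>\<sigma>\<close> rather than at 1 undoes the division by
      the standard deviation.\<close>
    have "(\<lambda>n. char (distr M borel (\<lambda>x. (\<Sum>i<n. X i x) / sqrt (real n * \<sigma>\<^sup>2))) \<sigma>)
            \<longlonglongrightarrow> char std_normal_distribution \<sigma>"
      by (intro levy_continuity1[OF _ _ wc] real_distribution_distr real_dist_normal_dist) simp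
    moreover have "char (distr M borel (\<lambda>x. (\<Sum>i<n. X i x) / sqrt (real n * \<sigma>\<^sup>2))) \<sigma> =
        (\<integral>\<omega>. cis ((\<Sum>i<n. X i \<omega>) / sqrt (real n)) \<partial>M)" for n
    proof -
      have "\<sigma> * ((\<Sum>i<n. X i x) / sqrt (real n * \<sigma>\<^sup>2)) = (\<Sum>i<n. X i x) / sqrt (real n)" for x
        using \<sigma>(1) by (simp add: real_sqrt_mult)
      then show ?thesis
        unfolding char_def by (subst integral_distr) (simp_all add: cis_conv_exp flip: of_real_mult)
    qed
    ultimately show ?thesis
      using \<sigma>(2) by (simp add: char_std_normal_distribution v_def del: of_real_exp)
  qed
qed

text \<open>The Cramer-Wold device: for fixed \<open>t\<close> the combination \<open>Xi\<close>
  produces a real i.i.d. sequence. The coordinates are functions \<open>\<xi> j\<close> of one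
  observation, so that coordinates of the data and a nonlinear statistic can be treated
  jointly.\<close>

lemma clt_cis_vector:
  fixes W :: "nat \<Rightarrow> 'a \<Rightarrow> 'b" and \<xi> :: "nat \<Rightarrow> 'b \<Rightarrow> real"
  assumes M: "prob_space M"
    and indep: "prob_space.indep_vars M (\<lambda>_. S) W UNIV"
    and distr: "\<And>l. distr M S (W l) = D"
    and meas: "\<And>j. j < k \<Longrightarrow> \<xi> j \<in> borel_measurable S"
    and int: "\<And>j. j < k \<Longrightarrow> integrable D (\<lambda>y. (\<xi> j y)\<^sup>2)"
    and mean: "\<And>j. j < k \<Longrightarrow> (\<integral>y. \<xi> j y \<partial>D) = 0"
  shows "(\<lambda>n. \<integral>\<omega>. cis (ip k t (\<lambda>j. (\<Sum>l<n. \<xi> j (W l \<omega>)) / sqrt (real n))) \<partial>M) \<longlonglongrightarrow>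
     of_real (exp (- (\<Sum>i<k. \<Sum>j<k. t i * (\<integral>y. \<xi> i y * \<xi> j y \<partial>D) * t j) / 2))"
proof -
  interpret prob_space M by fact
  define Xi where "Xi y = (\<Sum>j<k. t j * \<xi> j y)" for y
  have [measurable]: "Xi \<in> borel_measurable S" unfolding Xi_def using meas by measurable
  have W [measurable]: "random_variable S (W l)" for l
    using indep unfolding indep_vars_def2 by simp
  have sets_D: "sets D = sets S" using distr[of 0] by auto
  have measD: "j < k \<Longrightarrow> \<xi> j \<in> borel_measurable D" for j
    using meas measurable_cong_sets[OF sets_D refl] by blast
  interpret D: prob_space D
    using prob_space_distr[OF W[of 0]] distr[of 0] by simp
  have intp: "integrable D (\<lambda>y. \<xi> i y * \<xi> j y)" if "i < k" "j < k" for i j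
  proof (rule Bochner_Integration.integrable_bound)
    show "integrable D (\<lambda>y. (\<xi> i y)\<^sup>2 + (\<xi> j y)\<^sup>2)"
      using int that by (intro Bochner_Integration.integrable_add) auto
    have "\<bar>a * b\<bar> \<le> \<bar>a\<^sup>2 + b\<^sup>2\<bar>" for a b :: real
    proof -
      have "2 * (\<bar>a\<bar> * \<bar>b\<bar>) \<le> a\<^sup>2 + b\<^sup>2"
        using sum_squares_bound[of "\<bar>a\<bar>" "\<bar>b\<bar>"] by (simp add: mult.assoc)
      moreover have "0 \<le> \<bar>a\<bar> * \<bar>b\<bar>" by simp
      ultimately show ?thesis unfolding abs_mult by linarith
    qed
    then show "AE y in D. norm (\<xi> i y * \<xi> j y) \<le> norm ((\<xi> i y)\<^sup>2 + (\<xi> j y)\<^sup>2)"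
      by simp
  qed (use measD that in auto)
  have int1: "integrable D (\<xi> j)" if "j < k" for j
    by (rule D.square_integrable_imp_integrable[OF measD[OF that] int[OF that]])
  have sq: "(Xi y)\<^sup>2 = (\<Sum>i<k. \<Sum>j<k. t i * (\<xi> i y * \<xi> j y) * t j)" for y
    by (simp add: Xi_def power2_eq_square sum_product algebra_simps)
  have intX: "integrable D (\<lambda>y. (Xi y)\<^sup>2)"
    unfolding sq using intp
    by (intro Bochner_Integration.integrable_sum integrable_mult_left integrable_mult_right) auto
  have XiD [measurable]: "Xi \<in> borel_measurable D"
    using \<open>Xi \<in> borel_measurable S\<close> measurable_cong_sets[OF sets_D refl] by blast
  let ?\<mu> = "distr D borel Xi"
  have "(\<lambda>n. \<integral>\<omega>. cis ((\<Sum>i<n. Xi (W i \<omega>)) / sqrt (real n)) \<partial>M) \<longlonglongrightarrow>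
           of_real (exp (- (\<integral>x. x\<^sup>2 \<partial>?\<mu>) / 2))"
  proof (rule clt_cis_real)
    show "indep_vars (\<lambda>_. borel) (\<lambda>i \<omega>. Xi (W i \<omega>)) UNIV"
      by (rule indep_vars_compose2[OF indep]) simp
    show "distr M borel (\<lambda>\<omega>. Xi (W n \<omega>)) = ?\<mu>" for n
      unfolding distr[of n, symmetric] by (simp add: distr_distr comp_def)
    show "integrable ?\<mu> power2"
      using intX by (subst integrable_distr_eq) auto
    show "(\<integral>x. x \<partial>?\<mu>) = 0"
    proof -
      have "(\<integral>y. Xi y \<partial>D) = 0"
        unfolding Xi_def using int1 mean by (subst Bochner_Integration.integral_sum) auto
      then show ?thesis by (subst integral_distr) auto
    qed
  qed
  moreover have "(\<integral>x. x\<^sup>2 \<partial>?\<mu>) = (\<Sum>i<k. \<Sum>j<k. t i * (\<integral>y. \<xi> i y * \<xi> j y \<partial>D) * t j)"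
  proof -
    have "(\<integral>x. x\<^sup>2 \<partial>?\<mu>) = (\<integral>y. (\<Sum>i<k. \<Sum>j<k. t i * (\<xi> i y * \<xi> j y) * t j) \<partial>D)"
      by (subst integral_distr) (auto simp: sq)
    also have "\<dots> = (\<Sum>i<k. \<integral>y. (\<Sum>j<k. t i * (\<xi> i y * \<xi> j y) * t j) \<partial>D)"
      using intp by (intro Bochner_Integration.integral_sum Bochner_Integration.integrable_sum
        integrable_mult_left integrable_mult_right) auto
    also have "\<dots> = (\<Sum>i<k. \<Sum>j<k. \<integral>y. t i * (\<xi> i y * \<xi> j y) * t j \<partial>D)"
      using intp by (intro sum.cong refl Bochner_Integration.integral_sum
        integrable_mult_left integrable_mult_right) auto
    finally show ?thesis by simp
  qed
  moreover have "ip k t (\<lambda>j. (\<Sum>l<n. \<xi> j (W l \<omega>)) / sqrt (real n)) = (\<Sum>i<n. Xi (W i \<omega>)) / sqrt (real n)" for n \<omega>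
  proof -
    have "(\<Sum>i<n. Xi (W i \<omega>)) = (\<Sum>j<k. \<Sum>i<n. t j * \<xi> j (W i \<omega>))"
      unfolding Xi_def by (rule sum.swap)
    then show ?thesis by (simp add: ip_def sum_distrib_left sum_divide_distrib)
  qed
  ultimately show ?thesis by simp
qed

text \<open>Convergence to zero in probability is expressed as \<open>E (min 1 \<bar>X n\<bar>) \<longlonglongrightarrow> 0\<close>.\<close>

lemma min_1_mult_le: "min 1 (a * b) \<le> (1 + a) * min 1 b" if "a \<ge> 0" "b \<ge> 0" for a b :: real
proof (cases "b \<le> 1")
  case True
  then have "a * b \<le> (1 + a) * b" using that by (simp add: algebra_simps)
  then show ?thesis using True by simp
next
  case False
  then show ?thesis using that by simp
qed

text \<open>\<open>cis\<close> is bounded and 1-Lipschitz, so the two characteristic functions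
  differ by at most a combination of the truncated mean distances between coordinates.\<close>

lemma slutsky_cis:
  assumes M: "prob_space M"
    and Z: "\<And>n j. j < k \<Longrightarrow> (\<lambda>\<omega>. Z n \<omega> j) \<in> borel_measurable M"
    and Z': "\<And>n j. j < k \<Longrightarrow> (\<lambda>\<omega>. Z' n \<omega> j) \<in> borel_measurable M"
    and conv: "(\<lambda>n. \<integral>\<omega>. cis (ip k t (Z n \<omega>)) \<partial>M) \<longlonglongrightarrow> c"
    and diff: "\<And>j. j < k \<Longrightarrow> (\<lambda>n. \<integral>\<omega>. min 1 \<bar>Z' n \<omega> j - Z n \<omega> j\<bar> \<partial>M) \<longlonglongrightarrow> 0"
  shows "(\<lambda>n. \<integral>\<omega>. cis (ip k t (Z' n \<omega>)) \<partial>M) \<longlonglongrightarrow> c"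
proof -
  interpret prob_space M by fact
  \<comment> \<open>The 2 is the largest distance of two unit complex numbers;
    \<open>1 + \<bar>t j\<bar>\<close> is the price of pulling \<open>\<bar>t j\<bar>\<close> out of
    the truncation.\<close>
  define b where "b n \<omega> = (\<Sum>j<k. 2 * (1 + \<bar>t j\<bar>) * min 1 \<bar>Z' n \<omega> j - Z n \<omega> j\<bar>)" for n \<omega>
  have int: "integrable M (\<lambda>\<omega>. min 1 \<bar>Z' n \<omega> j - Z n \<omega> j\<bar>)" if "j < k" for n j
    using Z[OF that] Z'[OF that] by (intro integrable_const_bound[where B=1]) auto
  have ipm: "(\<lambda>\<omega>. ip k t (Z n \<omega>)) \<in> borel_measurable M" "(\<lambda>\<omega>. ip k t (Z' n \<omega>)) \<in> borel_measurable M" for n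
    unfolding ip_def using Z Z' by measurable
  note [measurable] = ipm
  have cint: "integrable M (\<lambda>\<omega>. cis (ip k t (Z n \<omega>)))" "integrable M (\<lambda>\<omega>. cis (ip k t (Z' n \<omega>)))" for n
    by (auto intro!: integrable_const_bound[where B=1])
  have le: "cmod (cis (ip k t (Z' n \<omega>)) - cis (ip k t (Z n \<omega>))) \<le> b n \<omega>" for n \<omega>
  proof -
    define a where "a j = min 1 (\<bar>t j\<bar> * \<bar>Z' n \<omega> j - Z n \<omega> j\<bar>)" for j
    have min_sum: "min 1 (\<Sum>j\<in>J. x j) \<le> (\<Sum>j\<in>J. min 1 (x j))"
      if "finite J" "\<And>j. j \<in> J \<Longrightarrow> 0 \<le> x j" for J :: "nat set" and x :: "nat \<Rightarrow> real"
      using that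
    proof (induction J rule: finite_induct)
      case (insert i J)
      then have "min 1 (sum x J) \<le> (\<Sum>j\<in>J. min 1 (x j))" "0 \<le> sum x J" "0 \<le> x i"
        by (auto intro: sum_nonneg)
      then show ?case using insert.hyps by (simp add: min_def split: if_splits)
    qed simp
    have "\<bar>ip k t (Z' n \<omega>) - ip k t (Z n \<omega>)\<bar> \<le> (\<Sum>j<k. \<bar>t j\<bar> * \<bar>Z' n \<omega> j - Z n \<omega> j\<bar>)"
      unfolding ip_def sum_subtractf[symmetric] right_diff_distrib[symmetric] abs_mult[symmetric]
      by (rule sum_abs)
    then have "cmod (cis (ip k t (Z' n \<omega>)) - cis (ip k t (Z n \<omega>))) \<le> (\<Sum>j<k. \<bar>t j\<bar> * \<bar>Z' n \<omega> j - Z n \<omega> j\<bar>)"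
      using norm_cis_diff_le order.trans by blast
    moreover have "cmod (cis (ip k t (Z' n \<omega>)) - cis (ip k t (Z n \<omega>))) \<le> 2"
      using norm_triangle_ineq4[of "cis (ip k t (Z' n \<omega>))" "cis (ip k t (Z n \<omega>))"] by simp
    ultimately have "cmod (cis (ip k t (Z' n \<omega>)) - cis (ip k t (Z n \<omega>)))
       \<le> 2 * min 1 (\<Sum>j<k. \<bar>t j\<bar> * \<bar>Z' n \<omega> j - Z n \<omega> j\<bar>)"
      using sum_nonneg[of "{..<k}" "\<lambda>j. \<bar>t j\<bar> * \<bar>Z' n \<omega> j - Z n \<omega> j\<bar>"] by (auto simp: min_def)
    also have "\<dots> \<le> 2 * (\<Sum>j<k. a j)"
      unfolding a_def by (intro mult_left_mono min_sum) auto
    also have "\<dots> \<le> 2 * (\<Sum>j<k. (1 + \<bar>t j\<bar>) * min 1 \<bar>Z' n \<omega> j - Z n \<omega> j\<bar>)"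
      unfolding a_def by (intro mult_left_mono sum_mono min_1_mult_le) auto
    finally show ?thesis by (simp only: b_def sum_distrib_left mult.assoc)
  qed
  have "(\<lambda>n. (\<integral>\<omega>. cis (ip k t (Z' n \<omega>)) \<partial>M) - (\<integral>\<omega>. cis (ip k t (Z n \<omega>)) \<partial>M)) \<longlonglongrightarrow> 0"
  proof (rule Lim_null_comparison)
    have bint: "integrable M (b n)" for n unfolding b_def using int
      by (intro Bochner_Integration.integrable_sum integrable_mult_right) auto
    show "\<forall>\<^sub>F n in sequentially. norm ((\<integral>\<omega>. cis (ip k t (Z' n \<omega>)) \<partial>M) - (\<integral>\<omega>. cis (ip k t (Z n \<omega>)) \<partial>M))
            \<le> (\<integral>\<omega>. b n \<omega> \<partial>M)"
    proof (intro always_eventually allI)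
      fix n
      have "norm (\<integral>\<omega>. cis (ip k t (Z' n \<omega>)) - cis (ip k t (Z n \<omega>)) \<partial>M) \<le> (\<integral>\<omega>. b n \<omega> \<partial>M)"
        using cint bint le by (intro order.trans[OF integral_norm_bound] integral_mono) auto
      then show "norm ((\<integral>\<omega>. cis (ip k t (Z' n \<omega>)) \<partial>M) - (\<integral>\<omega>. cis (ip k t (Z n \<omega>)) \<partial>M))
            \<le> (\<integral>\<omega>. b n \<omega> \<partial>M)"
        using cint by simp
    qed
    have "(\<lambda>n. \<Sum>j<k. 2 * (1 + \<bar>t j\<bar>) * (\<integral>\<omega>. min 1 \<bar>Z' n \<omega> j - Z n \<omega> j\<bar> \<partial>M)) \<longlonglongrightarrow>
       (\<Sum>j<k. 2 * (1 + \<bar>t j\<bar>) * 0)"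
      by (intro tendsto_intros diff) auto
    then show "(\<lambda>n. \<integral>\<omega>. b n \<omega> \<partial>M) \<longlonglongrightarrow> 0"
      unfolding b_def using int by (subst Bochner_Integration.integral_sum) auto
  qed
  from tendsto_add[OF this conv] show ?thesis by simp
qed

section \<open>Differentiability of least-squares contrasts\<close>

text \<open>Dominated convergence for the remainder of the first-order expansion: by the mean value
  inequality, the uniform bound on \<open>g'\<close> keeps the remainder divided by the step below
  \<open>2 * B\<close>.\<close>

lemma has_vector_derivative_integral:
  fixes g :: "real \<Rightarrow> 'x \<Rightarrow> 'b::{banach,second_countable_topology}"
  assumes fin: "finite_measure M"
    and int: "\<And>r. integrable M (g r)"
    and meas: "g' x \<in> borel_measurable M"
    and der: "\<And>r u. u \<in> space M \<Longrightarrow> ((\<lambda>r. g r u) has_vector_derivative g' r u) (at r)"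
    and bnd: "\<And>r u. u \<in> space M \<Longrightarrow> norm (g' r u) \<le> B"
  shows "((\<lambda>r. \<integral>u. g r u \<partial>M) has_vector_derivative (\<integral>u. g' x u \<partial>M)) (at x)"
proof -
  interpret finite_measure M by fact
  have int': "integrable M (g' x)"
    using meas bnd by (intro integrable_const_bound[where B=B]) auto
  let ?r = "\<lambda>y u. norm (g y u - g x u - (y - x) *\<^sub>R g' x u) / \<bar>y - x\<bar>"
  have lip: "norm (g y u - g x u) \<le> B * \<bar>y - x\<bar>" if "u \<in> space M" for u y
  proof -
    have "norm (g y u - g x u) \<le> B * norm (y - x)"
    proof (rule differentiable_bound[where S=UNIV and f'="\<lambda>r h. h *\<^sub>R g' r u"])
      show "((\<lambda>r. g r u) has_derivative (\<lambda>h. h *\<^sub>R g' r u)) (at r within UNIV)" for r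
        using der[OF that] by (simp add: has_vector_derivative_def)
      show "onorm (\<lambda>h. h *\<^sub>R g' r u) \<le> B" for r
        using bnd[OF that, of r] by (intro onorm_le) (auto simp: mult.commute[of B] intro: mult_left_mono)
    qed auto
    then show ?thesis by simp
  qed
  have "((\<lambda>y. \<integral>u. ?r y u \<partial>M) \<longlongrightarrow> 0) (at x)"
    unfolding tendsto_at_iff_sequentially comp_def
  proof (intro allI impI)
    fix X :: "nat \<Rightarrow> real" assume X: "\<forall>i. X i \<in> UNIV - {x}" "X \<longlonglongrightarrow> x"
    have "(\<lambda>i. \<integral>u. ?r (X i) u \<partial>M) \<longlonglongrightarrow> (\<integral>u. 0 \<partial>M)"
    proof (rule integral_dominated_convergence[where w="\<lambda>_. 2 * B"])
      show "(\<lambda>u. ?r (X i) u) \<in> borel_measurable M" for i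
        using meas int[THEN borel_measurable_integrable] by measurable
      show "AE u in M. (\<lambda>i. ?r (X i) u) \<longlonglongrightarrow> 0"
      proof (intro AE_I2)
        fix u assume "u \<in> space M"
        from der[OF this, of x] have "((\<lambda>y. ?r y u) \<longlongrightarrow> 0) (at x)"
          unfolding has_vector_derivative_def has_derivative_iff_norm by simp
        with X show "(\<lambda>i. ?r (X i) u) \<longlonglongrightarrow> 0"
          unfolding tendsto_at_iff_sequentially comp_def by blast
      qed
      show "AE u in M. norm (?r (X i) u) \<le> 2 * B" for i
      proof (intro AE_I2)
        fix u assume u: "u \<in> space M"
        have "norm (g (X i) u - g x u - (X i - x) *\<^sub>R g' x u) \<le> B * \<bar>X i - x\<bar> + \<bar>X i - x\<bar> * B"
          using lip[OF u, of "X i"] bnd[OF u, of x]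
          by (intro order.trans[OF norm_triangle_ineq4 add_mono]) (auto intro: mult_left_mono)
        then show "norm (?r (X i) u) \<le> 2 * B"
          using X(1) by (simp add: divide_le_eq algebra_simps)
      qed
    qed auto
    then show "(\<lambda>i. \<integral>u. ?r (X i) u \<partial>M) \<longlonglongrightarrow> 0" by simp
  qed
  then have "((\<lambda>y. norm ((\<integral>u. g y u \<partial>M) - (\<integral>u. g x u \<partial>M) - (y - x) *\<^sub>R (\<integral>u. g' x u \<partial>M)) / norm (y - x)) \<longlongrightarrow> 0) (at x)"
  proof (rule Lim_null_comparison[rotated])
    show "\<forall>\<^sub>F y in at x. norm (norm ((\<integral>u. g y u \<partial>M) - (\<integral>u. g x u \<partial>M) - (y - x) *\<^sub>R (\<integral>u. g' x u \<partial>M)) / norm (y - x))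
            \<le> (\<integral>u. ?r y u \<partial>M)"
    proof (intro always_eventually allI)
      fix y
      have "norm (\<integral>u. g y u - g x u - (y - x) *\<^sub>R g' x u \<partial>M) \<le> (\<integral>u. norm (g y u - g x u - (y - x) *\<^sub>R g' x u) \<partial>M)"
        by (rule integral_norm_bound)
      then show "norm (norm ((\<integral>u. g y u \<partial>M) - (\<integral>u. g x u \<partial>M) - (y - x) *\<^sub>R (\<integral>u. g' x u \<partial>M)) / norm (y - x))
            \<le> (\<integral>u. ?r y u \<partial>M)"
        using int int' by (simp add: divide_right_mono)
    qed
  qed
  then show ?thesis
    unfolding has_vector_derivative_def has_derivative_iff_norm
    by (simp add: bounded_linear_scaleR_left)
qed

text \<open>Puts the squared modulus into the bilinear shape of the mixed terms in the derivatives,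
  so that one derivative rule and one Lipschitz estimate serve for all of them.\<close>

lemma cmod_power2_Re: "(cmod z)\<^sup>2 = Re (cnj z * z)"
  by (simp add: cmod_power2) (simp add: power2_eq_square)

lemma measurable_cnj [measurable]: "cnj \<in> borel_measurable borel"
  by (intro borel_measurable_continuous_onI continuous_on_cnj continuous_on_id)

lemma Re_cnj_mult_diff_le:
  assumes "cmod z \<le> K" "cmod z' \<le> K" "cmod (w - w') \<le> D" "cmod (z - z') \<le> D" "cmod w \<le> K" "cmod w' \<le> K"
  shows "\<bar>Re (cnj z * w) - Re (cnj z' * w')\<bar> \<le> 2 * K * D"
proof -
  have "cnj z * w - cnj z' * w' = cnj z * (w - w') + cnj (z - z') * w'"
    by (simp add: algebra_simps)
  then have "\<bar>Re (cnj z * w) - Re (cnj z' * w')\<bar> = \<bar>Re (cnj z * (w - w') + cnj (z - z') * w')\<bar>"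
    by (metis minus_complex.simps(1))
  also have "\<dots> \<le> cmod (cnj z * (w - w') + cnj (z - z') * w')" by (rule abs_Re_le_cmod)
  also have "\<dots> \<le> cmod z * cmod (w - w') + cmod (z - z') * cmod w'"
    by (metis complex_mod_cnj norm_mult norm_triangle_ineq)
  also have "\<dots> \<le> K * D + D * K"
    using assms by (intro add_mono mult_mono) (auto intro: order.trans[OF norm_ge_zero])
  finally show ?thesis by (simp add: mult.commute)
qed

text \<open>\<open>a m\<close> and \<open>b m\<close> stand for the \<open>m\<close>-th derivatives
  in \<open>R\<close> of the two model characteristic functions. Bounds go up to order 2 and
  derivatives up to order 3: the third order makes the second derivative of the contrast
  continuous.\<close>

locale least_squares_contrast = finite_measure \<tau> for \<tau> :: "'t measure" +
  fixes a b :: "nat \<Rightarrow> real \<Rightarrow> 't \<Rightarrow> complex" and B :: real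
  assumes a_meas [measurable]: "\<And>m R. a m R \<in> borel_measurable \<tau>"
    and b_meas [measurable]: "\<And>m R. b m R \<in> borel_measurable \<tau>"
    and a_deriv: "\<And>m R t. t \<in> space \<tau> \<Longrightarrow> m \<le> 2 \<Longrightarrow> ((\<lambda>R. a m R t) has_vector_derivative a (Suc m) R t) (at R)"
    and b_deriv: "\<And>m R t. t \<in> space \<tau> \<Longrightarrow> m \<le> 2 \<Longrightarrow> ((\<lambda>R. b m R t) has_vector_derivative b (Suc m) R t) (at R)"
    and a_bound: "\<And>m R t. t \<in> space \<tau> \<Longrightarrow> m \<le> 2 \<Longrightarrow> cmod (a m R t) \<le> B"
    and b_bound: "\<And>m R t. t \<in> space \<tau> \<Longrightarrow> m \<le> 2 \<Longrightarrow> cmod (b m R t) \<le> B"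
begin

text \<open>The residual and its derivatives in \<open>R\<close>. The data \<open>q\<close> and
  \<open>p\<close> do not depend on \<open>R\<close>, so only the coefficients are
  differentiated.\<close>

definition T :: "nat \<Rightarrow> ('t \<Rightarrow> complex) \<Rightarrow> ('t \<Rightarrow> complex) \<Rightarrow> real \<Rightarrow> 't \<Rightarrow> complex" where
  "T m q p R t = a m R t * q t - b m R t * p t"

definition J :: "('t \<Rightarrow> complex) \<Rightarrow> ('t \<Rightarrow> complex) \<Rightarrow> real \<Rightarrow> real" where
  "J q p R = (\<integral>t. (cmod (T 0 q p R t))\<^sup>2 \<partial>\<tau>)"

definition J1 :: "('t \<Rightarrow> complex) \<Rightarrow> ('t \<Rightarrow> complex) \<Rightarrow> real \<Rightarrow> real" where
  "J1 q p R = (\<integral>t. 2 * Re (cnj (T 0 q p R t) * T 1 q p R t) \<partial>\<tau>)"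

definition J2 :: "('t \<Rightarrow> complex) \<Rightarrow> ('t \<Rightarrow> complex) \<Rightarrow> real \<Rightarrow> real" where
  "J2 q p R = (\<integral>t. 2 * (cmod (T 1 q p R t))\<^sup>2 + 2 * Re (cnj (T 0 q p R t) * T 2 q p R t) \<partial>\<tau>)"

text \<open>True and empirical characteristic functions and their products all qualify, which makes
  the bounds uniform over them.\<close>

definition admissible :: "('t \<Rightarrow> complex) \<Rightarrow> bool" where
  "admissible q \<longleftrightarrow> q \<in> borel_measurable \<tau> \<and> (\<forall>t\<in>space \<tau>. cmod (q t) \<le> 1)"

lemma T_meas [measurable]: "admissible q \<Longrightarrow> admissible p \<Longrightarrow> T m q p R \<in> borel_measurable \<tau>"
  unfolding T_def admissible_def by (intro borel_measurable_diff borel_measurable_times) auto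

lemma B_nonneg: "t \<in> space \<tau> \<Longrightarrow> 0 \<le> B"
  using a_bound[of t 0] norm_ge_zero order.trans by blast

lemma T_bound:
  assumes "admissible q" "admissible p" "t \<in> space \<tau>" "m \<le> 2"
  shows "cmod (T m q p R t) \<le> 2 * B"
proof -
  have "cmod (T m q p R t) \<le> cmod (a m R t) * cmod (q t) + cmod (b m R t) * cmod (p t)"
    unfolding T_def by (metis norm_mult norm_triangle_ineq4)
  also have "\<dots> \<le> B * 1 + B * 1"
    using assms a_bound b_bound B_nonneg unfolding admissible_def by (intro add_mono mult_mono) auto
  finally show ?thesis by simp
qed

lemma T_diff:
  assumes "t \<in> space \<tau>" "m \<le> 2"
  shows "cmod (T m q p R t - T m q' p' R t) \<le> B * (cmod (q t - q' t) + cmod (p t - p' t))"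
proof -
  have "T m q p R t - T m q' p' R t = a m R t * (q t - q' t) - b m R t * (p t - p' t)"
    by (simp add: T_def algebra_simps)
  then have "cmod (T m q p R t - T m q' p' R t) \<le> cmod (a m R t) * cmod (q t - q' t) + cmod (b m R t) * cmod (p t - p' t)"
    by (metis norm_mult norm_triangle_ineq4)
  also have "\<dots> \<le> B * cmod (q t - q' t) + B * cmod (p t - p' t)"
    using assms a_bound b_bound by (intro add_mono mult_right_mono) auto
  finally show ?thesis by (simp add: distrib_left)
qed

lemma T_deriv:
  assumes "t \<in> space \<tau>" "m \<le> 2"
  shows "((\<lambda>R. T m q p R t) has_vector_derivative T (Suc m) q p R t) (at R)"
  unfolding T_def
  by (intro has_vector_derivative_diff has_vector_derivative_mult_left a_deriv b_deriv assms)

lemma Re_cnj_mult_le: "cmod z \<le> K \<Longrightarrow> cmod w \<le> K \<Longrightarrow> \<bar>Re (cnj z * w)\<bar> \<le> K * K"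
  by (metis abs_Re_le_cmod complex_mod_cnj mult_mono norm_ge_zero norm_mult order.trans)

lemma Re_T_integrable:
  assumes "m \<le> 2" "m' \<le> 2" and q: "admissible q" "admissible p"
  shows "integrable \<tau> (\<lambda>t. Re (cnj (T m q p R t) * T m' q p R t))"
proof (rule integrable_const_bound[where B="2 * B * (2 * B)"])
  show "AE t in \<tau>. norm (Re (cnj (T m q p R t) * T m' q p R t)) \<le> 2 * B * (2 * B)"
    unfolding real_norm_def using assms by (intro AE_I2 Re_cnj_mult_le T_bound)
  note [measurable] = T_meas[OF q]
  show "(\<lambda>t. Re (cnj (T m q p R t) * T m' q p R t)) \<in> borel_measurable \<tau>"
    by measurable
qed

lemma Re_cnj_mult_deriv:
  assumes "(z has_vector_derivative z') (at R)" "(w has_vector_derivative w') (at R)"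
  shows "((\<lambda>R. Re (cnj (z R) * w R)) has_vector_derivative Re (cnj z' * w R) + Re (cnj (z R) * w')) (at R)"
proof -
  have "((\<lambda>R. Re (cnj (z R) * w R)) has_vector_derivative Re (cnj (z R) * w' + cnj z' * w R)) (at R)"
    by (intro bounded_linear.has_vector_derivative[OF bounded_linear_Re] has_vector_derivative_mult has_vector_derivative_cnj assms)
  then show ?thesis by (simp add: add.commute)
qed

lemma J_deriv:
  assumes q: "admissible q" "admissible p"
  shows "(J q p has_real_derivative J1 q p R) (at R)"
proof -
  note [measurable] = T_meas[OF q]
  have "((\<lambda>R. \<integral>t. Re (cnj (T 0 q p R t) * T 0 q p R t) \<partial>\<tau>) has_vector_derivative
        (\<integral>t. 2 * Re (cnj (T 0 q p R t) * T 1 q p R t) \<partial>\<tau>)) (at R)"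
  proof (rule has_vector_derivative_integral[where B="2 * (2 * B * (2 * B))"])
    show "integrable \<tau> (\<lambda>t. Re (cnj (T 0 q p R t) * T 0 q p R t))" for R
      by (rule Re_T_integrable[OF _ _ q]) auto
    fix R t assume t: "t \<in> space \<tau>"
    show "((\<lambda>R. Re (cnj (T 0 q p R t) * T 0 q p R t)) has_vector_derivative
            2 * Re (cnj (T 0 q p R t) * T 1 q p R t)) (at R)"
      using Re_cnj_mult_deriv[OF T_deriv[OF t, of 0 q p R] T_deriv[OF t, of 0 q p R]]
      by (simp add: algebra_simps)
    show "norm (2 * Re (cnj (T 0 q p R t) * T 1 q p R t)) \<le> 2 * (2 * B * (2 * B))"
      using Re_cnj_mult_le[OF T_bound[OF q t, of 0 R] T_bound[OF q t, of 1 R]] by (simp add: abs_mult)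
  qed (rule finite_measure_axioms, measurable)
  then show ?thesis
    by (simp add: has_real_derivative_iff_has_vector_derivative J_def[abs_def] J1_def cmod_power2_Re del: times_complex.sel)
qed

lemma J1_deriv:
  assumes q: "admissible q" "admissible p"
  shows "(J1 q p has_real_derivative J2 q p R) (at R)"
proof -
  note [measurable] = T_meas[OF q]
  have "((\<lambda>R. \<integral>t. 2 * Re (cnj (T 0 q p R t) * T 1 q p R t) \<partial>\<tau>) has_vector_derivative
        (\<integral>t. 2 * (cmod (T 1 q p R t))\<^sup>2 + 2 * Re (cnj (T 0 q p R t) * T 2 q p R t) \<partial>\<tau>)) (at R)"
  proof (rule has_vector_derivative_integral[where B="4 * (2 * B * (2 * B))"])
    show "integrable \<tau> (\<lambda>t. 2 * Re (cnj (T 0 q p R t) * T 1 q p R t))" for R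
      by (intro integrable_mult_right Re_T_integrable q) auto
    fix R t assume t: "t \<in> space \<tau>"
    have "((\<lambda>R. 2 * Re (cnj (T 0 q p R t) * T 1 q p R t)) has_vector_derivative
            2 * (Re (cnj (T 1 q p R t) * T 1 q p R t) + Re (cnj (T 0 q p R t) * T 2 q p R t))) (at R)"
      using Re_cnj_mult_deriv[OF T_deriv[OF t, of 0 q p R] T_deriv[OF t, of 1 q p R]]
      by (intro has_vector_derivative_mult_right) (simp del: times_complex.sel add: eval_nat_numeral)
    then show "((\<lambda>R. 2 * Re (cnj (T 0 q p R t) * T 1 q p R t)) has_vector_derivative
            2 * (cmod (T 1 q p R t))\<^sup>2 + 2 * Re (cnj (T 0 q p R t) * T 2 q p R t)) (at R)"
      by (simp only: cmod_power2_Re distrib_left)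
    show "norm (2 * (cmod (T 1 q p R t))\<^sup>2 + 2 * Re (cnj (T 0 q p R t) * T 2 q p R t)) \<le> 4 * (2 * B * (2 * B))"
      using Re_cnj_mult_le[OF T_bound[OF q t, of 0 R] T_bound[OF q t, of 2 R]]
        Re_cnj_mult_le[OF T_bound[OF q t, of 1 R] T_bound[OF q t, of 1 R]]
      unfolding cmod_power2_Re real_norm_def by linarith
  qed (rule finite_measure_axioms, measurable)
  then show ?thesis
    by (simp add: has_real_derivative_iff_has_vector_derivative J1_def[abs_def] J2_def del: times_complex.sel)
qed

lemma J2_isCont:
  assumes q: "admissible q" "admissible p"
  shows "isCont (J2 q p) R"
  unfolding isCont_def tendsto_at_iff_sequentially comp_def J2_def
proof (intro allI impI)
  note [measurable] = T_meas[OF q]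
  fix X :: "nat \<Rightarrow> real" assume X: "\<forall>i. X i \<in> UNIV - {R}" "X \<longlonglongrightarrow> R"
  have T: "(\<lambda>i. T m q p (X i) t) \<longlonglongrightarrow> T m q p R t" if "t \<in> space \<tau>" "m \<le> 2" for m t
    using isCont_tendsto_compose[OF has_vector_derivative_continuous[OF T_deriv[OF that]] X(2)] .
  show "(\<lambda>i. \<integral>t. 2 * (cmod (T 1 q p (X i) t))\<^sup>2 + 2 * Re (cnj (T 0 q p (X i) t) * T 2 q p (X i) t) \<partial>\<tau>)
     \<longlonglongrightarrow> (\<integral>t. 2 * (cmod (T 1 q p R t))\<^sup>2 + 2 * Re (cnj (T 0 q p R t) * T 2 q p R t) \<partial>\<tau>)"
  proof (rule integral_dominated_convergence[where w="\<lambda>_. 4 * (2 * B * (2 * B))"])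
    show "AE t in \<tau>. (\<lambda>i. 2 * (cmod (T 1 q p (X i) t))\<^sup>2 + 2 * Re (cnj (T 0 q p (X i) t) * T 2 q p (X i) t))
       \<longlonglongrightarrow> 2 * (cmod (T 1 q p R t))\<^sup>2 + 2 * Re (cnj (T 0 q p R t) * T 2 q p R t)"
      by (intro AE_I2 tendsto_intros T) auto
    show "AE t in \<tau>. norm (2 * (cmod (T 1 q p (X i) t))\<^sup>2 + 2 * Re (cnj (T 0 q p (X i) t) * T 2 q p (X i) t))
        \<le> 4 * (2 * B * (2 * B))" for i
    proof (intro AE_I2)
      fix t assume t: "t \<in> space \<tau>"
      show "norm (2 * (cmod (T 1 q p (X i) t))\<^sup>2 + 2 * Re (cnj (T 0 q p (X i) t) * T 2 q p (X i) t))
        \<le> 4 * (2 * B * (2 * B))"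
        using Re_cnj_mult_le[OF T_bound[OF q t, of 0 "X i"] T_bound[OF q t, of 2 "X i"]]
          Re_cnj_mult_le[OF T_bound[OF q t, of 1 "X i"] T_bound[OF q t, of 1 "X i"]]
        unfolding cmod_power2_Re real_norm_def by linarith
    qed
  qed auto
qed

lemma admissible_diff_integrable:
  assumes "admissible q" "admissible q'"
  shows "integrable \<tau> (\<lambda>t. cmod (q t - q' t))"
proof (rule integrable_const_bound[where B=2])
  show "AE t in \<tau>. norm (cmod (q t - q' t)) \<le> 2"
    using assms norm_triangle_ineq4[of "q _" "q' _"] unfolding admissible_def
    by (intro AE_I2) (smt (verit) norm_triangle_ineq4 norm_ge_zero real_norm_def)
qed (use assms in \<open>auto simp: admissible_def\<close>)

text \<open>A product of two residuals moves by at most \<open>4 * B\<^sup>2\<close> times the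
  distance of the pairs. \<open>J2\<close> consists of two such products with weight 2, whence the
  16, which also serves for \<open>J\<close>. The bounds do not depend on \<open>R\<close>.\<close>

lemma J_diff:
  assumes q: "admissible q" "admissible p" and q': "admissible q'" "admissible p'"
  shows "\<bar>J q p R - J q' p' R\<bar> \<le> 16 * B\<^sup>2 * (\<integral>t. cmod (q t - q' t) + cmod (p t - p' t) \<partial>\<tau>)" (is ?A)
    and "\<bar>J2 q p R - J2 q' p' R\<bar> \<le> 16 * B\<^sup>2 * (\<integral>t. cmod (q t - q' t) + cmod (p t - p' t) \<partial>\<tau>)" (is ?C)
proof -
  note [measurable] = T_meas[OF q] T_meas[OF q']
  let ?D = "\<lambda>t. cmod (q t - q' t) + cmod (p t - p' t)"
  have D: "integrable \<tau> ?D"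
    using admissible_diff_integrable q q' by auto
  have main: "\<bar>(\<integral>t. F t \<partial>\<tau>) - (\<integral>t. F' t \<partial>\<tau>)\<bar> \<le> 16 * B\<^sup>2 * (\<integral>t. ?D t \<partial>\<tau>)"
    if "integrable \<tau> F" "integrable \<tau> F'" "\<And>t. t \<in> space \<tau> \<Longrightarrow> \<bar>F t - F' t\<bar> \<le> 16 * B\<^sup>2 * ?D t" for F F'
  proof -
    have "\<bar>\<integral>t. F t - F' t \<partial>\<tau>\<bar> \<le> (\<integral>t. 16 * B\<^sup>2 * ?D t \<partial>\<tau>)"
      using that D by (intro order.trans[OF integral_abs_bound] integral_mono) auto
    then show ?thesis using that by simp
  qed
  have bd: "\<bar>Re (cnj (T m q p R t) * T m' q p R t) - Re (cnj (T m q' p' R t) * T m' q' p' R t)\<bar> \<le> 4 * B\<^sup>2 * ?D t"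
    if "t \<in> space \<tau>" "m \<le> 2" "m' \<le> 2" for t m m'
    using Re_cnj_mult_diff_le[OF T_bound[OF q that(1,2), of R] T_bound[OF q' that(1,2), of R]
      T_diff[OF that(1,3), of q p R q' p'] T_diff[OF that(1,2), of q p R q' p']
      T_bound[OF q that(1,3), of R] T_bound[OF q' that(1,3), of R]]
    by (simp add: power2_eq_square mult.assoc del: times_complex.sel)
  have D0: "0 \<le> B\<^sup>2 * ?D t" for t by simp
  show ?A
    unfolding J_def
  proof (rule main)
    fix t assume t: "t \<in> space \<tau>"
    show "\<bar>(cmod (T 0 q p R t))\<^sup>2 - (cmod (T 0 q' p' R t))\<^sup>2\<bar> \<le> 16 * B\<^sup>2 * ?D t"
      using bd[OF t, of 0 0] D0[of t] unfolding cmod_power2_Re by linarith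
  qed (use Re_T_integrable[of 0 0] q q' in \<open>simp_all only: cmod_power2_Re\<close>)
  show ?C
    unfolding J2_def
  proof (rule main)
    fix t assume t: "t \<in> space \<tau>"
    show "\<bar>2 * (cmod (T 1 q p R t))\<^sup>2 + 2 * Re (cnj (T 0 q p R t) * T 2 q p R t)
        - (2 * (cmod (T 1 q' p' R t))\<^sup>2 + 2 * Re (cnj (T 0 q' p' R t) * T 2 q' p' R t))\<bar> \<le> 16 * B\<^sup>2 * ?D t"
      using bd[OF t, of 1 1] bd[OF t, of 0 2] D0[of t] unfolding cmod_power2_Re by linarith
  qed (use Re_T_integrable[of 1 1] Re_T_integrable[of 0 2] q q' in \<open>auto simp only: cmod_power2_Re intro!: Bochner_Integration.integrable_add integrable_mult_right\<close>)
qed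

text \<open>Where the residual vanishes, the term with its second derivative disappears. What
  remains of the curvature is the Gauss-Newton term, which is visibly nonnegative.\<close>

lemma J_zero:
  assumes "\<And>t. t \<in> space \<tau> \<Longrightarrow> T 0 q p R t = 0"
  shows "J q p R = 0" "J2 q p R = 2 * (\<integral>t. (cmod (T 1 q p R t))\<^sup>2 \<partial>\<tau>)"
proof -
  show "J q p R = 0"
    unfolding J_def using assms by (simp cong: Bochner_Integration.integral_cong)
  have "J2 q p R = (\<integral>t. 2 * (cmod (T 1 q p R t))\<^sup>2 \<partial>\<tau>)"
    unfolding J2_def using assms by (intro Bochner_Integration.integral_cong) auto
  then show "J2 q p R = 2 * (\<integral>t. (cmod (T 1 q p R t))\<^sup>2 \<partial>\<tau>)" by simp
qed

end

section \<open>Characteristic function of a law on the sphere\<close>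

text \<open>Freezing the coordinates from \<open>d\<close> on leaves finitely many radii, and these
  have a positive minimum. Such cubes have positive measure under \<open>lebK d\<close>, which links
  the topology with almost everywhere statements.\<close>

lemma open_product_contains_cube:
  fixes x :: "nat \<Rightarrow> real"
  assumes "open U" "x \<in> U"
  shows "\<exists>r>0. \<forall>y. (\<forall>j<d. \<bar>y j - x j\<bar> < r) \<and> (\<forall>j\<ge>d. y j = x j) \<longrightarrow> y \<in> U"
proof -
  have "openin (product_topology (\<lambda>_. euclidean) UNIV) U"
    using assms(1) by (simp add: euclidean_product_topology)
  from product_topology_open_contains_basis[OF this assms(2)]
  obtain X where X: "x \<in> PiE UNIV X" "\<And>i. open (X i)" "PiE UNIV X \<subseteq> U" by auto
  have "\<exists>r>0. \<forall>z. \<bar>z - x j\<bar> < r \<longrightarrow> z \<in> X j" for j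
    using X(2)[of j] X(1) unfolding open_dist dist_real_def by (auto simp: PiE_iff)
  then obtain r where r: "\<And>j. r j > 0" "\<And>j z. \<bar>z - x j\<bar> < r j \<Longrightarrow> z \<in> X j" by metis
  \<comment> \<open>The extra 1 keeps the set nonempty when \<open>d = 0\<close>.\<close>
  define r0 where "r0 = Min (insert 1 (r ` {..<d}))"
  have "r0 > 0" using r(1) by (auto simp: r0_def)
  have r0_le: "r0 \<le> r j" if "j < d" for j using that by (auto simp: r0_def)
  have "y \<in> U" if "\<forall>j<d. \<bar>y j - x j\<bar> < r0" "\<forall>j\<ge>d. y j = x j" for y
  proof -
    have "y j \<in> X j" for j
    proof (cases "j < d")
      case True
      with that(1) r0_le[of j] show ?thesis by (intro r(2)) force
    next
      case False
      with that(2) X(1) show ?thesis by (auto simp: PiE_iff)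
    qed
    then show ?thesis using X(3) by (auto simp: PiE_iff)
  qed
  with \<open>r0 > 0\<close> show ?thesis by blast
qed

lemma emeasure_lebK_cube_pos:
  assumes "r > 0"
  shows "emeasure (lebK d) (PiE {..<d} (\<lambda>j. {x j - r<..<x j + r})) > 0"
proof -
  interpret product_sigma_finite "\<lambda>_. lborel :: real measure" by unfold_locales
  have "emeasure (lebK d) (PiE {..<d} (\<lambda>j. {x j - r<..<x j + r})) = (\<Prod>j<d. ennreal (2 * r))"
    unfolding lebK_def by (subst emeasure_PiM) (use assms in auto)
  then show ?thesis unfolding zero_less_iff_neq_zero using assms by (simp add: ennreal_eq_0_iff)
qed

text \<open>Restricting the measure, in place of multiplying by an indicator, gives a finite measure
  on which bounded measurable functions are integrable.\<close>

definition boxm :: "nat \<Rightarrow> real \<Rightarrow> (nat \<Rightarrow> real) measure" where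
  "boxm d \<nu> = restrict_space (lebK d) (box_nu d \<nu>)"

lemma box_nu_sets [measurable]: "box_nu d \<nu> \<inter> space (lebK d) \<in> sets (lebK d)"
proof -
  have "{t \<in> space (lebK d). \<forall>j\<in>{..<d}. \<bar>t j\<bar> \<le> \<nu>} \<in> sets (lebK d)" by measurable
  also have "{t \<in> space (lebK d). \<forall>j\<in>{..<d}. \<bar>t j\<bar> \<le> \<nu>} = box_nu d \<nu> \<inter> space (lebK d)"
    by (auto simp: box_nu_def)
  finally show ?thesis .
qed

lemma space_boxm: "space (boxm d \<nu>) = box_nu d \<nu> \<inter> space (lebK d)"
  by (simp add: boxm_def space_restrict_space)

lemma measurable_boxm: "f \<in> borel_measurable (lebK d) \<Longrightarrow> f \<in> borel_measurable (boxm d \<nu>)"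
  unfolding boxm_def by (rule measurable_restrict_space1)

lemma integral_boxm:
  fixes f :: "(nat \<Rightarrow> real) \<Rightarrow> real"
  shows "(\<integral>t. f t \<partial>boxm d \<nu>) = (\<integral>t. indicator (box_nu d \<nu>) t * f t \<partial>lebK d)"
  unfolding boxm_def by (subst integral_restrict_space[OF box_nu_sets]) simp

lemma finite_measure_boxm: "finite_measure (boxm d \<nu>)"
proof (rule finite_measureI)
  interpret product_sigma_finite "\<lambda>_. lborel :: real measure" by unfold_locales
  have "space (boxm d \<nu>) = PiE {..<d} (\<lambda>_. {-\<nu>..\<nu>})"
  proof -
    have "\<bar>x\<bar> \<le> \<nu> \<longleftrightarrow> x \<in> {-\<nu>..\<nu>}" for x :: real
      unfolding atLeastAtMost_iff by linarith
    then show ?thesis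
      unfolding space_boxm box_nu_def lebK_def space_PiM by (simp add: set_eq_iff PiE_iff) blast
  qed
  moreover have "emeasure (lebK d) (PiE {..<d} (\<lambda>_. {-\<nu>..\<nu>})) < \<infinity>"
  proof -
    have "emeasure (lebK d) (PiE {..<d} (\<lambda>_. {-\<nu>..\<nu>})) = (\<Prod>j<d. emeasure lborel {-\<nu>..\<nu>})"
      unfolding lebK_def by (rule emeasure_PiM) auto
    also have "\<dots> < \<infinity>"
      by (simp add: emeasure_lborel_Icc_eq power_less_top_ennreal)
    finally show ?thesis .
  qed
  ultimately show "emeasure (boxm d \<nu>) (space (boxm d \<nu>)) \<noteq> \<infinity>"
    using box_nu_sets[of d \<nu>] unfolding boxm_def
    by (subst emeasure_restrict_space) (auto simp: space_restrict_space Int_commute)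
qed

text \<open>A continuous function that is nonzero at a point inside the box is nonzero on a cube of
  positive measure, hence not zero almost everywhere.\<close>

lemma integral_boxm_zero_imp:
  fixes G :: "(nat \<Rightarrow> real) \<Rightarrow> complex"
  assumes cont: "continuous_on UNIV G" and meas: "G \<in> borel_measurable (lebK d)"
    and int: "integrable (boxm d \<nu>) (\<lambda>t. (cmod (G t))\<^sup>2)"
    and zero: "(\<integral>t. (cmod (G t))\<^sup>2 \<partial>boxm d \<nu>) = 0"
    and t: "t \<in> space (lebK d)" "\<And>j. j < d \<Longrightarrow> \<bar>t j\<bar> < \<nu>"
  shows "G t = 0"
proof (rule ccontr)
  assume "G t \<noteq> 0"
  define U where "U = {s. G s \<noteq> 0} \<inter> {s. \<forall>j\<in>{..<d}. \<bar>s j\<bar> < \<nu>}"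
  have "open {s. G s \<noteq> 0}"
    by (intro open_Collect_neq cont continuous_on_const)
  moreover have "open (\<Inter>j\<in>{..<d}. {s :: nat \<Rightarrow> real. \<bar>s j\<bar> < \<nu>})"
    by (intro open_INT finite_lessThan ballI open_Collect_less continuous_on_rabs continuous_on_product_coordinates continuous_on_const)
  moreover have "(\<Inter>j\<in>{..<d}. {s :: nat \<Rightarrow> real. \<bar>s j\<bar> < \<nu>}) = {s. \<forall>j\<in>{..<d}. \<bar>s j\<bar> < \<nu>}"
    by auto
  ultimately have "open U" unfolding U_def by (simp add: open_Int)
  moreover have "t \<in> U" using t \<open>G t \<noteq> 0\<close> by (auto simp: U_def)
  ultimately obtain r where r: "r > 0" "\<And>y. (\<forall>j<d. \<bar>y j - t j\<bar> < r) \<Longrightarrow> (\<forall>j\<ge>d. y j = t j) \<Longrightarrow> y \<in> U"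
    using open_product_contains_cube[of U t d] by blast
  let ?C = "PiE {..<d} (\<lambda>j. {t j - r<..<t j + r})"
  have C: "y \<in> U \<and> y \<in> space (lebK d)" if "y \<in> ?C" for y
  proof
    have "\<bar>y j - t j\<bar> < r" if "j < d" for j
      using \<open>y \<in> ?C\<close> that by (force simp: PiE_iff abs_less_iff)
    moreover have "y j = t j" if "j \<ge> d" for j
      using \<open>y \<in> ?C\<close> t(1) that by (auto simp: PiE_iff lebK_def space_PiM extensional_def)
    ultimately show "y \<in> U" using r(2) by blast
  qed (use that in \<open>auto simp: lebK_def space_PiM PiE_iff\<close>)
  have "AE t in boxm d \<nu>. (cmod (G t))\<^sup>2 = 0"
    using zero int by (subst (asm) integral_nonneg_eq_0_iff_AE) auto
  then have "AE t in boxm d \<nu>. G t = 0" by simp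
  then have ae: "AE t in lebK d. t \<in> box_nu d \<nu> \<longrightarrow> G t = 0"
    unfolding boxm_def by (subst (asm) AE_restrict_space_iff) auto
  have Csets: "?C \<in> sets (lebK d)" unfolding lebK_def by (intro sets_PiM_I_finite) auto
  have "AE t in lebK d. t \<notin> ?C"
    using ae
  proof eventually_elim
    case (elim s)
    show ?case
    proof
      assume "s \<in> ?C"
      with C have "s \<in> U" by blast
      with elim show False by (auto simp: U_def box_nu_def less_imp_le)
    qed
  qed
  then have "emeasure (lebK d) ?C = 0"
    using Csets AE_iff_measurable[OF Csets, of "\<lambda>s. s \<notin> ?C"] sets.sets_into_space[OF Csets] by auto
  then show False using emeasure_lebK_cube_pos[OF r(1), of d t] by simp
qed

text \<open>What is kept of the spherical coordinates and the density: the values lie on the unit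
  sphere, and the square of the first coordinate is not almost surely constant.\<close>

locale sphere_law = prob_space \<mu> for \<mu> :: "'u measure" +
  fixes d :: nat and S :: "'u \<Rightarrow> nat \<Rightarrow> real"
  assumes d2: "d \<ge> 2"
    and S_meas [measurable (raw)]: "\<And>j. j < d \<Longrightarrow> (\<lambda>u. S u j) \<in> borel_measurable \<mu>"
    and S_sphere: "\<And>u. (\<Sum>j<d. (S u j)\<^sup>2) = 1"
    and S_nondeg: "\<And>c. \<not> (AE u in \<mu>. (S u 0)\<^sup>2 = c)"
begin

text \<open>\<open>P 0 R\<close> is the characteristic function of \<open>R\<close> times the random
  point of the sphere, and \<open>P m R\<close> is its \<open>m\<close>-th derivative in
  \<open>R\<close>, taken under the integral.\<close>

definition P :: "nat \<Rightarrow> real \<Rightarrow> (nat \<Rightarrow> real) \<Rightarrow> complex" where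
  "P m R t = (\<integral>u. (\<i> * of_real (ip d t (S u))) ^ m * cis (R * ip d t (S u)) \<partial>\<mu>)"

text \<open>Dominates \<open>ip d t (S u)\<close>, because coordinates of a unit vector are at most
  1 in modulus.\<close>

definition l1 :: "(nat \<Rightarrow> real) \<Rightarrow> real" where "l1 t = (\<Sum>j<d. \<bar>t j\<bar>)"

lemma l1_nonneg [simp]: "0 \<le> l1 t" by (simp add: l1_def sum_nonneg)

lemma S_bound: "j < d \<Longrightarrow> \<bar>S u j\<bar> \<le> 1"
proof -
  assume "j < d"
  then have "(S u j)\<^sup>2 \<le> (\<Sum>j<d. (S u j)\<^sup>2)" by (intro member_le_sum) auto
  then have "(S u j)\<^sup>2 \<le> 1" by (simp add: S_sphere)
  then show ?thesis by (simp add: abs_square_le_1)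
qed

lemma ip_bound: "\<bar>ip d t (S u)\<bar> \<le> l1 t"
proof -
  have "\<bar>ip d t (S u)\<bar> \<le> (\<Sum>j<d. \<bar>t j * S u j\<bar>)" unfolding ip_def by (rule sum_abs)
  also have "\<dots> \<le> (\<Sum>j<d. \<bar>t j\<bar> * 1)"
    unfolding abs_mult using S_bound by (intro sum_mono mult_left_mono) auto
  finally show ?thesis by (simp add: l1_def)
qed

lemma ip_meas [measurable]: "(\<lambda>u. ip d t (S u)) \<in> borel_measurable \<mu>"
  unfolding ip_def by measurable

lemma P_integrand_bound: "cmod ((\<i> * of_real (ip d t (S u))) ^ m * cis (R * ip d t (S u))) \<le> l1 t ^ m"
  using ip_bound[of t u] by (simp add: norm_mult norm_power power_mono)

lemma P_integrable: "integrable \<mu> (\<lambda>u. (\<i> * of_real (ip d t (S u))) ^ m * cis (R * ip d t (S u)))"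
  using P_integrand_bound by (intro integrable_const_bound[where B="l1 t ^ m"]) auto

lemma P_bound: "cmod (P m R t) \<le> l1 t ^ m"
proof -
  have "cmod (P m R t) \<le> (\<integral>u. l1 t ^ m \<partial>\<mu>)"
    unfolding P_def using P_integrand_bound P_integrable
    by (intro order.trans[OF integral_norm_bound] integral_mono) (auto intro: integrable_norm)
  then show ?thesis by (simp add: prob_space)
qed

lemma P_deriv: "((\<lambda>R. P m R t) has_vector_derivative P (Suc m) R t) (at R)"
  unfolding P_def
proof (rule has_vector_derivative_integral[where B="l1 t ^ Suc m"])
  fix R u
  have "((\<lambda>R. cis (R * ip d t (S u))) has_vector_derivative
      of_real (ip d t (S u)) * (\<i> * cis (R * ip d t (S u)))) (at R)"
  proof -
    have "((\<lambda>R. iexp (R * ip d t (S u))) has_vector_derivative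
      ip d t (S u) *\<^sub>R (\<i> * iexp (R * ip d t (S u)))) (at R)"
      by (intro vector_diff_chain_at[of "\<lambda>R. R * ip d t (S u)", unfolded comp_def] has_vector_derivative_iexp)
         (auto intro!: derivative_eq_intros)
    then show ?thesis by (simp add: cis_conv_exp scaleR_conv_of_real)
  qed
  from has_vector_derivative_mult_right[OF this, of "(\<i> * of_real (ip d t (S u))) ^ m"]
  show "((\<lambda>R. (\<i> * of_real (ip d t (S u))) ^ m * cis (R * ip d t (S u))) has_vector_derivative
     (\<i> * of_real (ip d t (S u))) ^ Suc m * cis (R * ip d t (S u))) (at R)"
    by (simp add: algebra_simps)
  show "cmod ((\<i> * of_real (ip d t (S u))) ^ Suc m * cis (R * ip d t (S u))) \<le> l1 t ^ Suc m"
    by (rule P_integrand_bound)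
qed (use finite_measure_axioms P_integrable in auto)

lemma P_cong: "(\<And>j. j < d \<Longrightarrow> t j = t' j) \<Longrightarrow> P m R t = P m R t'"
  unfolding P_def ip_def by (auto intro!: Bochner_Integration.integral_cong sum.cong)

lemma P_meas [measurable]: "P m R \<in> borel_measurable (lebK d)"
proof -
  have "(\<lambda>(t, u). ip d t (S u)) \<in> borel_measurable (lebK d \<Otimes>\<^sub>M \<mu>)"
    unfolding ip_def split_beta
    by (intro borel_measurable_sum borel_measurable_times measurable_compose[OF measurable_fst measurable_lebK_component]
        measurable_compose[OF measurable_snd S_meas]) auto
  then have "(\<lambda>(t, u). (\<i> * of_real (ip d t (S u))) ^ m * cis (R * ip d t (S u))) \<in> borel_measurable (lebK d \<Otimes>\<^sub>M \<mu>)"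
    unfolding split_beta by measurable
  then show ?thesis unfolding P_def by (rule borel_measurable_lebesgue_integral)
qed

lemma P_continuous: "continuous_on UNIV (P m R)"
  unfolding continuous_on_eq_continuous_at[OF open_UNIV] isCont_def
proof
  fix t0 :: "nat \<Rightarrow> real"
  have ipc: "continuous_on UNIV (\<lambda>t. ip d t x)" for x
    unfolding ip_def by (intro continuous_intros continuous_on_product_coordinates)
  have "((\<lambda>t. P m R t) \<longlongrightarrow> P m R t0) (at t0 within UNIV)"
    unfolding tendsto_at_iff_sequentially comp_def
  proof (intro allI impI)
    fix X :: "nat \<Rightarrow> nat \<Rightarrow> real" assume X: "\<forall>i. X i \<in> UNIV - {t0}" "X \<longlonglongrightarrow> t0"
    have ipl: "(\<lambda>i. ip d (X i) x) \<longlonglongrightarrow> ip d t0 x" for x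
      using continuous_on_tendsto_compose[OF ipc X(2)] by auto
    have l1c: "continuous_on UNIV l1" unfolding l1_def[abs_def] by (intro continuous_intros continuous_on_product_coordinates)
    have "(\<lambda>i. l1 (X i)) \<longlonglongrightarrow> l1 t0"
      using continuous_on_tendsto_compose[OF l1c X(2)] by auto
    then have "Bseq (\<lambda>i. l1 (X i))" by (auto intro: convergent_imp_Bseq convergentI)
    then obtain K where K: "\<And>i. l1 (X i) \<le> K" unfolding Bseq_def by (auto dest: order.trans[OF abs_ge_self])
    show "(\<lambda>i. P m R (X i)) \<longlonglongrightarrow> P m R t0"
      unfolding P_def
    proof (rule integral_dominated_convergence[where w="\<lambda>_. K ^ m"])
      show "AE u in \<mu>. (\<lambda>i. (\<i> * of_real (ip d (X i) (S u))) ^ m * cis (R * ip d (X i) (S u)))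
        \<longlonglongrightarrow> (\<i> * of_real (ip d t0 (S u))) ^ m * cis (R * ip d t0 (S u))"
        by (intro AE_I2 tendsto_intros ipl tendsto_of_real)
      show "AE u in \<mu>. cmod ((\<i> * of_real (ip d (X i) (S u))) ^ m * cis (R * ip d (X i) (S u))) \<le> K ^ m" for i
        using order.trans[OF P_integrand_bound power_mono[OF K l1_nonneg]] by auto
    qed auto
  qed
  then show "P m R \<midarrow>t0\<rightarrow> P m R t0" by simp
qed

lemma ip_scale: "ip d (\<lambda>j. c * t j) x = c * ip d t x"
  by (simp add: ip_def sum_distrib_left mult.assoc)

text \<open>A factor in the frequency can be moved into the radius. This is what carries an identity
  near the origin to all smaller radii along a ray.\<close>

lemma P_scale: "P m R (\<lambda>j. c * t j) = of_real c ^ m * P m (c * R) t"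
proof -
  have "(\<i> * of_real (c * x)) ^ m * cis (R * (c * x)) = of_real c ^ m * ((\<i> * of_real x) ^ m * cis (c * R * x))" for x
  proof -
    have "(\<i> * of_real (c * x)) ^ m = (of_real c * (\<i> * complex_of_real x)) ^ m"
      by (simp add: mult.left_commute)
    moreover have "R * (c * x) = c * R * x" by simp
    ultimately show ?thesis by (simp only: power_mult_distrib mult.assoc)
  qed
  then show ?thesis unfolding P_def ip_scale by simp
qed

lemma P_0_0 [simp]: "P 0 0 t = 1"
  by (simp add: P_def prob_space)

text \<open>\<open>cis\<close> is 1-Lipschitz and equals 1 at 0, so the expectation stays in a disc
  around 1 that misses 0. Ratios with \<open>Q 0\<close> as denominator rely on this.\<close>

lemma P_nonzero:
  assumes "\<bar>R\<bar> * l1 t < 1"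
  shows "P 0 R t \<noteq> 0"
proof -
  have "cmod (P 0 R t - 1) = cmod (\<integral>u. cis (R * ip d t (S u)) - 1 \<partial>\<mu>)"
    using P_integrable[of t 0 R] by (simp add: P_def prob_space)
  also have "\<dots> \<le> (\<integral>u. \<bar>R\<bar> * l1 t \<partial>\<mu>)"
  proof (intro order.trans[OF integral_norm_bound] integral_mono integrable_norm)
    show "integrable \<mu> (\<lambda>u. cis (R * ip d t (S u)) - 1)"
      using P_integrable[of t 0 R] by simp
    show "cmod (cis (R * ip d t (S u)) - 1) \<le> \<bar>R\<bar> * l1 t" for u
      using norm_cis_diff_le[of "R * ip d t (S u)" 0] ip_bound[of t u]
        mult_left_mono[OF ip_bound[of t u], of "\<bar>R\<bar>"] by (simp add: abs_mult)
  qed auto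
  finally have "cmod (P 0 R t - 1) < 1" using assms by (simp add: prob_space)
  then show ?thesis by auto
qed

lemma l1_e1: "l1 (e1 t) \<le> l1 t" and l1_e2: "l1 (e2 t) \<le> l1 t"
  unfolding l1_def e1_def e2_def by (auto intro!: sum_mono)

lemma e12_scale: "e1 (\<lambda>j. c * t j) = (\<lambda>j. c * e1 t j)" "e2 (\<lambda>j. c * t j) = (\<lambda>j. c * e2 t j)"
  by (auto simp: e1_def e2_def)

lemma e12_cont: "continuous_on UNIV e1" "continuous_on UNIV e2"
proof -
  show "continuous_on UNIV e1"
  proof (rule continuous_on_coordinatewise_then_product)
    fix j show "continuous_on UNIV (\<lambda>t. e1 t j)"
      by (cases "j = 0") (auto simp: e1_def intro: continuous_on_product_coordinates)
  qed
  show "continuous_on UNIV e2"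
  proof (rule continuous_on_coordinatewise_then_product)
    fix j show "continuous_on UNIV (\<lambda>t. e2 t j)"
      by (cases "j = 0") (auto simp: e2_def intro: continuous_on_product_coordinates)
  qed
qed

text \<open>The Leibniz formula for the \<open>m\<close>-th derivative in \<open>R\<close> of the
  product of the two block characteristic functions; that product is \<open>Q 0\<close>.\<close>

definition Q :: "nat \<Rightarrow> real \<Rightarrow> (nat \<Rightarrow> real) \<Rightarrow> complex" where
  "Q m R t = (\<Sum>i\<le>m. of_nat (m choose i) * (P i R (e1 t) * P (m - i) R (e2 t)))"

lemma Q_0: "Q 0 R t = P 0 R (e1 t) * P 0 R (e2 t)"
  by (simp add: Q_def)

lemma Q_1: "Q 1 R t = P 0 R (e1 t) * P 1 R (e2 t) + P 1 R (e1 t) * P 0 R (e2 t)"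
  by (simp add: Q_def)

lemma Q_2: "Q 2 R t = P 0 R (e1 t) * P 2 R (e2 t) + 2 * (P 1 R (e1 t) * P 1 R (e2 t)) + P 2 R (e1 t) * P 0 R (e2 t)"
  by (simp add: Q_def eval_nat_numeral)

lemma Q_3: "Q 3 R t = P 0 R (e1 t) * P 3 R (e2 t) + 3 * (P 1 R (e1 t) * P 2 R (e2 t))
   + 3 * (P 2 R (e1 t) * P 1 R (e2 t)) + P 3 R (e1 t) * P 0 R (e2 t)"
  by (simp add: Q_def eval_nat_numeral)

lemma Q_deriv:
  assumes "m \<le> 2"
  shows "((\<lambda>R. Q m R t) has_vector_derivative Q (Suc m) R t) (at R)"
proof -
  have PP: "((\<lambda>R. P i R (e1 t) * P j R (e2 t)) has_vector_derivative
     P i R (e1 t) * P (Suc j) R (e2 t) + P (Suc i) R (e1 t) * P j R (e2 t)) (at R)" for i j R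
    by (intro has_vector_derivative_mult P_deriv)
  from assms consider "m = 0" | "m = 1" | "m = 2" by linarith
  then show ?thesis
  proof cases
    case 1
    then show ?thesis using PP[of 0 0 R] Q_1[of R t] by (simp add: Q_0)
  next
    case 2
    have "((\<lambda>R. Q 1 R t) has_vector_derivative
      (P 0 R (e1 t) * P (Suc 1) R (e2 t) + P (Suc 0) R (e1 t) * P 1 R (e2 t))
      + (P 1 R (e1 t) * P (Suc 0) R (e2 t) + P (Suc 1) R (e1 t) * P 0 R (e2 t))) (at R)"
      unfolding Q_1 by (intro has_vector_derivative_add PP)
    then show ?thesis using 2 Q_2[of R t] by (simp add: eval_nat_numeral algebra_simps)
  next
    case 3
    have "((\<lambda>R. Q 2 R t) has_vector_derivative
      (P 0 R (e1 t) * P (Suc 2) R (e2 t) + P (Suc 0) R (e1 t) * P 2 R (e2 t))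
      + 2 * (P 1 R (e1 t) * P (Suc 1) R (e2 t) + P (Suc 1) R (e1 t) * P 1 R (e2 t))
      + (P 2 R (e1 t) * P (Suc 0) R (e2 t) + P (Suc 2) R (e1 t) * P 0 R (e2 t))) (at R)"
      unfolding Q_2 by (intro has_vector_derivative_add has_vector_derivative_mult_right PP)
    then show ?thesis using 3 Q_3[of R t] by (simp add: eval_nat_numeral algebra_simps)
  qed
qed

text \<open>\<open>e1 t\<close> is 0 outside the index set and so need not be a point of
  \<open>lebK d\<close>. Restriction repairs this and does not affect the values of
  \<open>P\<close>.\<close>

lemma measurable_e12 [measurable]: "(\<lambda>t. restrict (e1 t) {..<d}) \<in> lebK d \<rightarrow>\<^sub>M lebK d"
   "(\<lambda>t. restrict (e2 t) {..<d}) \<in> lebK d \<rightarrow>\<^sub>M lebK d"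
proof -
  show "(\<lambda>t. restrict (e1 t) {..<d}) \<in> lebK d \<rightarrow>\<^sub>M lebK d"
  proof (rule measurable_lebK_restrict)
    fix j assume "j < d" then show "(\<lambda>t. e1 t j) \<in> borel_measurable (lebK d)"
      by (cases "j = 0") (auto simp: e1_def)
  qed
  show "(\<lambda>t. restrict (e2 t) {..<d}) \<in> lebK d \<rightarrow>\<^sub>M lebK d"
  proof (rule measurable_lebK_restrict)
    fix j assume "j < d" then show "(\<lambda>t. e2 t j) \<in> borel_measurable (lebK d)"
      by (cases "j = 0") (auto simp: e2_def)
  qed
qed

lemma P_e12_meas [measurable]: "(\<lambda>t. P m R (e1 t)) \<in> borel_measurable (lebK d)"
   "(\<lambda>t. P m R (e2 t)) \<in> borel_measurable (lebK d)"
proof -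
  have "P m R (restrict t {..<d}) = P m R t" for t by (rule P_cong) simp
  then show "(\<lambda>t. P m R (e1 t)) \<in> borel_measurable (lebK d)"
    "(\<lambda>t. P m R (e2 t)) \<in> borel_measurable (lebK d)"
    using measurable_compose[OF measurable_e12(1) P_meas[of m R]]
      measurable_compose[OF measurable_e12(2) P_meas[of m R]] by simp_all
qed

lemma Q_meas [measurable]: "Q m R \<in> borel_measurable (lebK d)"
  unfolding Q_def[abs_def] by measurable

lemma Q_continuous: "continuous_on UNIV (Q m R)"
  unfolding Q_def[abs_def]
  by (intro continuous_intros continuous_on_compose2[OF P_continuous] e12_cont) auto

lemma Q_bound: "cmod (Q m R t) \<le> (2 * l1 t) ^ m"
proof -
  have "cmod (Q m R t) \<le> (\<Sum>i\<le>m. of_nat (m choose i) * l1 t ^ m)"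
    unfolding Q_def
  proof (rule sum_norm_le)
    fix i assume "i \<in> {..m}"
    have "cmod (P i R (e1 t)) * cmod (P (m - i) R (e2 t)) \<le> l1 t ^ i * l1 t ^ (m - i)"
      using P_bound[of i R "e1 t"] P_bound[of "m - i" R "e2 t"] power_mono[OF l1_e1, of t i] power_mono[OF l1_e2, of t "m - i"]
      by (intro mult_mono) auto
    also have "\<dots> = l1 t ^ m" using \<open>i \<in> {..m}\<close> by (simp flip: power_add)
    finally show "cmod (of_nat (m choose i) * (P i R (e1 t) * P (m - i) R (e2 t))) \<le> of_nat (m choose i) * l1 t ^ m"
      by (simp add: norm_mult mult_left_mono)
  qed
  also have "\<dots> = 2 ^ m * l1 t ^ m"
    by (simp flip: sum_distrib_right of_nat_sum add: choose_row_sum)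
  finally show ?thesis by (simp add: power_mult_distrib)
qed

lemma Q_scale: "Q m R (\<lambda>j. c * t j) = of_real c ^ m * Q m (c * R) t"
proof -
  have "of_real c ^ i * P i (c * R) (e1 t) * (of_real c ^ (m - i) * P (m - i) (c * R) (e2 t))
     = of_real c ^ m * (P i (c * R) (e1 t) * P (m - i) (c * R) (e2 t))" if "i \<le> m" for i
  proof -
    have "(of_real c :: complex) ^ m = of_real c ^ i * of_real c ^ (m - i)"
      using that by (simp flip: power_add)
    then show ?thesis by simp
  qed
  then show ?thesis
    unfolding Q_def e12_scale P_scale sum_distrib_left
    by (intro sum.cong) (auto simp: mult.left_commute)
qed

end

section \<open>Identifiability of the radius\<close>

text \<open>The half-angle formula reduces this to the derivative of the sine at 0. The quotient is
  the device that extracts the square of a coordinate from a cosine.\<close>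

lemma tendsto_one_minus_cos:
  "((\<lambda>c. (1 - cos (c * s)) / c\<^sup>2) \<longlongrightarrow> s\<^sup>2 / 2) (at (0::real))"
proof -
  have "DERIV (\<lambda>c. sin (c * (s / 2))) 0 :> s / 2"
    by (auto intro!: derivative_eq_intros)
  then have "((\<lambda>c. sin (c * (s / 2)) / c) \<longlongrightarrow> s / 2) (at 0)"
    by (simp add: DERIV_def)
  then have "((\<lambda>c. 2 * (sin (c * (s / 2)) / c)\<^sup>2) \<longlongrightarrow> 2 * (s / 2)\<^sup>2) (at 0)"
    by (intro tendsto_mult tendsto_const tendsto_power)
  moreover have "2 * (sin (c * (s / 2)) / c)\<^sup>2 = (1 - cos (c * s)) / c\<^sup>2" for c
    using cos_double_sin[of "c * (s / 2)"] by (simp add: power_divide)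
  moreover have "2 * (s / 2)\<^sup>2 = s\<^sup>2 / 2" by (simp add: power_divide)
  ultimately show ?thesis by (simp only:)
qed

lemma one_minus_cos_le: "1 - cos x \<le> x\<^sup>2 / 2" for x :: real
proof -
  have "1 - cos x = 2 * (sin (x / 2))\<^sup>2" using cos_double_sin[of "x / 2"] by simp
  also have "(sin (x / 2))\<^sup>2 \<le> (x / 2)\<^sup>2"
    using abs_sin_x_le_abs_x[of "x / 2"] unfolding abs_le_square_iff .
  finally show ?thesis by (simp add: power_divide)
qed

context sphere_law
begin

text \<open>For a frequency supported on the axes 0 and \<open>j\<close>, the block factorisation
  becomes one for this pair of coordinates. Summing over the signs of \<open>a\<close> and
  \<open>b\<close> turns exponentials into cosines, which removes the odd terms before the expansion
  at the origin.\<close>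

lemma cos_factor:
  assumes "r > 0" and j: "0 < j" "j < d"
    and fac: "\<And>t. (\<And>j. j < d \<Longrightarrow> \<bar>t j\<bar> < r) \<Longrightarrow> P 0 R t = Q 0 R t"
    and ab: "\<bar>a\<bar> < r" "\<bar>b\<bar> < r"
  shows "expectation (\<lambda>u. cos (R * a * S u 0) * cos (R * b * S u j)) =
         expectation (\<lambda>u. cos (R * a * S u 0)) * expectation (\<lambda>u. cos (R * b * S u j))"
proof -
  have d0: "0 < d" using d2 by simp
  note [measurable] = S_meas[OF d0] S_meas[OF j(2)]
  have ci: "integrable \<mu> (\<lambda>u. cis (x * S u 0 + y * S u j))" for x y
    by (rule integrable_const_bound[where B=1]) auto
  define F where "F x y = (\<integral>u. cis (x * S u 0 + y * S u j) \<partial>\<mu>)" for x y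
  have eq: "F (R * a) (R * b) = F (R * a) 0 * F 0 (R * b)" if "\<bar>a\<bar> < r" "\<bar>b\<bar> < r" for a b
  proof -
    define t where "t i = (if i = 0 then a else if i = j then b else 0)" for i
    have two: "(\<Sum>i<d. (if i = 0 then x else if i = j then y else 0) * z i) = x * z 0 + y * z j" for x y :: real and z
    proof -
      have "(if i = 0 then x else if i = j then y else 0) * z i =
          (if i = 0 then x * z i else 0) + (if i = j then y * z i else 0)" for i
        using j by auto
      then show ?thesis using d0 j by (simp add: sum.distrib)
    qed
    have ip: "ip d t z = a * z 0 + b * z j" "ip d (e1 t) z = a * z 0" "ip d (e2 t) z = b * z j" for z
      using two[of a b z] two[of a 0 z] two[of 0 b z] j
      by (simp_all add: ip_def t_def e1_def e2_def cong: if_cong)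
    have "P 0 R t = Q 0 R t"
      using that \<open>r > 0\<close> by (intro fac) (auto simp: t_def)
    then show ?thesis by (simp add: P_def Q_0 ip F_def algebra_simps)
  qed
  have cosx: "2 * complex_of_real (cos x) = cis x + cis (- x)" for x
    by (simp add: complex_eq_iff)
  have "4 * of_real (expectation (\<lambda>u. cos (R * a * S u 0) * cos (R * b * S u j))) =
     F (R * a) (R * b) + F (R * a) (R * (- b)) + F (R * (- a)) (R * b) + F (R * (- a)) (R * (- b))"
  proof -
    have "4 * of_real (expectation (\<lambda>u. cos (R * a * S u 0) * cos (R * b * S u j))) =
      (\<integral>u. 4 * complex_of_real (cos (R * a * S u 0) * cos (R * b * S u j)) \<partial>\<mu>)"
      by (simp only: integral_mult_right_zero integral_complex_of_real)
    also have "\<dots> = (\<integral>u. cis (R * a * S u 0 + R * b * S u j) + cis (R * a * S u 0 + R * (- b) * S u j)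
       + cis (R * (- a) * S u 0 + R * b * S u j) + cis (R * (- a) * S u 0 + R * (- b) * S u j) \<partial>\<mu>)"
    proof (rule Bochner_Integration.integral_cong)
      fix u
      have "4 * complex_of_real (cos x * cos y) = cis (x + y) + cis (x - y) + cis (- x + y) + cis (- x - y)" for x y
        by (simp add: complex_eq_iff cos_add cos_diff sin_add sin_diff)
      from this[of "R * a * S u 0" "R * b * S u j"]
      show "4 * complex_of_real (cos (R * a * S u 0) * cos (R * b * S u j)) =
         cis (R * a * S u 0 + R * b * S u j) + cis (R * a * S u 0 + R * (- b) * S u j)
         + cis (R * (- a) * S u 0 + R * b * S u j) + cis (R * (- a) * S u 0 + R * (- b) * S u j)"
        by simp
    qed simp
    finally show ?thesis
      unfolding F_def by (simp only: Bochner_Integration.integral_add ci Bochner_Integration.integrable_add)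
  qed
  \<comment> \<open>The sum over four sign choices factors into two sums over one sign each.\<close>
  also have "\<dots> = (F (R * a) 0 + F (R * (- a)) 0) * (F 0 (R * b) + F 0 (R * (- b)))"
    using ab eq[of a b] eq[of a "-b"] eq[of "-a" b] eq[of "-a" "-b"] by (simp add: algebra_simps)
  also have "F (R * a) 0 + F (R * (- a)) 0 = 2 * of_real (expectation (\<lambda>u. cos (R * a * S u 0)))"
  proof -
    have "2 * of_real (expectation (\<lambda>u. cos (R * a * S u 0))) = (\<integral>u. 2 * complex_of_real (cos (R * a * S u 0)) \<partial>\<mu>)"
      by (simp only: integral_mult_right_zero integral_complex_of_real)
    also have "\<dots> = (\<integral>u. cis (R * a * S u 0 + 0 * S u j) + cis (R * (- a) * S u 0 + 0 * S u j) \<partial>\<mu>)"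
      by (simp add: cosx)
    finally show ?thesis
      unfolding F_def by (simp only: Bochner_Integration.integral_add ci)
  qed
  also have "F 0 (R * b) + F 0 (R * (- b)) = 2 * of_real (expectation (\<lambda>u. cos (R * b * S u j)))"
  proof -
    have "2 * of_real (expectation (\<lambda>u. cos (R * b * S u j))) = (\<integral>u. 2 * complex_of_real (cos (R * b * S u j)) \<partial>\<mu>)"
      by (simp only: integral_mult_right_zero integral_complex_of_real)
    also have "\<dots> = (\<integral>u. cis (0 * S u 0 + R * b * S u j) + cis (0 * S u 0 + R * (- b) * S u j) \<partial>\<mu>)"
      by (simp add: cosx)
    finally show ?thesis
      unfolding F_def by (simp only: Bochner_Integration.integral_add ci)
  qed
  finally have "complex_of_real (expectation (\<lambda>u. cos (R * a * S u 0) * cos (R * b * S u j))) =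
     of_real (expectation (\<lambda>u. cos (R * a * S u 0)) * expectation (\<lambda>u. cos (R * b * S u j)))"
    by simp
  then show ?thesis by (simp only: of_real_eq_iff)
qed

text \<open>The second-order terms at the origin of the factorisation say that \<open>S\<^sub>0\<^sup>2\<close> is uncorrelated with each
  \<open>S\<^sub>j\<^sup>2\<close>, hence with \<open>1 - S\<^sub>0\<^sup>2\<close>.\<close>

lemma not_factorized:
  assumes "R > 0" "r > 0"
    and fac: "\<And>t. (\<And>j. j < d \<Longrightarrow> \<bar>t j\<bar> < r) \<Longrightarrow> P 0 R t = Q 0 R t"
  shows False
proof -
  have d0: "0 < d" using d2 by simp
  note S0 [measurable] = S_meas[OF d0]
  have S1: "\<bar>S u j\<bar> \<le> 1" "(S u j)\<^sup>2 \<le> 1" if "j < d" for u j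
    using S_bound[OF that] by (auto simp: abs_square_le_1)
  \<comment> \<open>A second-order difference quotient with step \<open>R * (r / (n + 2))\<close>,
    tending to half the square of \<open>s\<close>. With \<open>n + 2\<close> the frequency is
    strictly below \<open>r\<close> already for \<open>n = 0\<close>.\<close>
  define D where "D n s = (1 - cos (R * (r / real (n + 2)) * s)) / (R * (r / real (n + 2)))\<^sup>2" for n s
  have D0: "0 \<le> D n s" for n s by (simp add: D_def)
  have Dle: "D n s \<le> 1 / 2" if "\<bar>s\<bar> \<le> 1" for n s
  proof -
    have "s\<^sup>2 \<le> 1" using that by (simp add: abs_square_le_1)
    have "1 - cos (R * (r / real (n + 2)) * s) \<le> (R * (r / real (n + 2)))\<^sup>2 * s\<^sup>2 / 2"
      using one_minus_cos_le[of "R * (r / real (n + 2)) * s"] by (simp only: power_mult_distrib)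
    also have "\<dots> \<le> (R * (r / real (n + 2)))\<^sup>2 * 1 / 2"
      using \<open>s\<^sup>2 \<le> 1\<close> by (intro divide_right_mono mult_left_mono) auto
    finally show ?thesis using assms(1,2) by (simp add: D_def divide_le_eq)
  qed
  have Dlim: "(\<lambda>n. D n s) \<longlonglongrightarrow> s\<^sup>2 / 2" for s
  proof -
    have "(\<lambda>n. R * (r / real (n + 2))) \<longlonglongrightarrow> R * 0"
      by (intro tendsto_mult tendsto_const LIMSEQ_ignore_initial_segment[OF lim_const_over_n])
    then have "filterlim (\<lambda>n. R * (r / real (n + 2))) (at 0) sequentially"
      using assms(1,2) by (intro filterlim_atI) auto
    from filterlim_compose[OF tendsto_one_minus_cos this] show ?thesis unfolding D_def .
  qed
  have Dm [measurable]: "D n \<in> borel_measurable borel" for n unfolding D_def by measurable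
  \<comment> \<open>Means of products of \<open>1 - cos\<close> factorise because those of the
    cosines do, and dominated convergence passes to the squares.\<close>
  have fac2: "expectation (\<lambda>u. (S u 0)\<^sup>2 * (S u j)\<^sup>2) = expectation (\<lambda>u. (S u 0)\<^sup>2) * expectation (\<lambda>u. (S u j)\<^sup>2)"
    if j: "0 < j" "j < d" for j
  proof -
    note Sj [measurable] = S_meas[OF j(2)]
    have eq: "expectation (\<lambda>u. D n (S u 0) * D n (S u j)) = expectation (\<lambda>u. D n (S u 0)) * expectation (\<lambda>u. D n (S u j))" for n
    proof -
      define c where "c = R * (r / real (n + 2))"
      have ab: "\<bar>r / real (n + 2)\<bar> < r" using assms(2) by (simp add: divide_less_eq)
      have int: "integrable \<mu> (\<lambda>u. cos (c * S u 0))" "integrable \<mu> (\<lambda>u. cos (c * S u j))"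
         "integrable \<mu> (\<lambda>u. cos (c * S u 0) * cos (c * S u j))"
        by (auto intro!: integrable_const_bound[where B=1] AE_I2 mult_le_one simp: abs_mult)
      have "expectation (\<lambda>u. (1 - cos (c * S u 0)) * (1 - cos (c * S u j))) =
        expectation (\<lambda>u. 1 - cos (c * S u 0) - cos (c * S u j) + cos (c * S u 0) * cos (c * S u j))"
        by (intro Bochner_Integration.integral_cong) (auto simp: algebra_simps)
      also have "\<dots> = 1 - expectation (\<lambda>u. cos (c * S u 0)) - expectation (\<lambda>u. cos (c * S u j))
          + expectation (\<lambda>u. cos (c * S u 0)) * expectation (\<lambda>u. cos (c * S u j))"
        using int cos_factor[OF assms(2) j fac ab ab] by (simp add: prob_space c_def)
      also have "\<dots> = expectation (\<lambda>u. 1 - cos (c * S u 0)) * expectation (\<lambda>u. 1 - cos (c * S u j))"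
        using int by (simp add: prob_space algebra_simps)
      finally show ?thesis unfolding D_def c_def[symmetric] by simp
    qed
    have lim1: "(\<lambda>n. expectation (\<lambda>u. D n (S u i))) \<longlonglongrightarrow> expectation (\<lambda>u. (S u i)\<^sup>2 / 2)" if "i < d" for i
      using D0 Dle[OF S_bound[OF that]] that
      by (intro integral_dominated_convergence[where w="\<lambda>_. 1 / 2"] AE_I2 Dlim) auto
    have lim2: "(\<lambda>n. expectation (\<lambda>u. D n (S u 0) * D n (S u j))) \<longlonglongrightarrow> expectation (\<lambda>u. (S u 0)\<^sup>2 / 2 * ((S u j)\<^sup>2 / 2))"
    proof (intro integral_dominated_convergence[where w="\<lambda>_. 1 / 2 * (1 / 2)"] AE_I2 tendsto_mult Dlim)
      show "norm (D n (S u 0) * D n (S u j)) \<le> 1 / 2 * (1 / 2)" for n u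
        unfolding norm_mult using D0 Dle[OF S_bound[OF d0]] Dle[OF S_bound[OF j(2)]] by (intro mult_mono) auto
    qed auto
    have "expectation (\<lambda>u. (S u 0)\<^sup>2 / 2 * ((S u j)\<^sup>2 / 2)) = expectation (\<lambda>u. (S u 0)\<^sup>2 / 2) * expectation (\<lambda>u. (S u j)\<^sup>2 / 2)"
      using LIMSEQ_unique[OF lim2[unfolded eq] tendsto_mult[OF lim1[OF d0] lim1[OF j(2)]]] .
    then show ?thesis by simp
  qed
  define m where "m = expectation (\<lambda>u. (S u 0)\<^sup>2)"
  have int: "integrable \<mu> (\<lambda>u. (S u j)\<^sup>2)" "integrable \<mu> (\<lambda>u. (S u 0)\<^sup>2 * (S u j)\<^sup>2)" if "j < d" for j
    using that S1[OF that] S1[OF d0]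
    by (auto intro!: integrable_const_bound[where B=1] AE_I2 mult_le_one)
  have split: "{..<d} = insert 0 {1..<d}" using d0 by auto
  have rest: "(\<Sum>j\<in>{1..<d}. (S u j)\<^sup>2) = 1 - (S u 0)\<^sup>2" for u
    using S_sphere[of u] unfolding split by simp
  have "expectation (\<lambda>u. (S u 0)\<^sup>2 * (1 - (S u 0)\<^sup>2)) = expectation (\<lambda>u. \<Sum>j\<in>{1..<d}. (S u 0)\<^sup>2 * (S u j)\<^sup>2)"
    by (simp only: rest sum_distrib_left[symmetric])
  also have "\<dots> = (\<Sum>j\<in>{1..<d}. expectation (\<lambda>u. (S u 0)\<^sup>2 * (S u j)\<^sup>2))"
    by (intro Bochner_Integration.integral_sum int) auto
  also have "\<dots> = (\<Sum>j\<in>{1..<d}. m * expectation (\<lambda>u. (S u j)\<^sup>2))"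
    by (intro sum.cong) (auto simp: fac2 m_def)
  also have "\<dots> = m * expectation (\<lambda>u. \<Sum>j\<in>{1..<d}. (S u j)\<^sup>2)"
    by (subst Bochner_Integration.integral_sum) (auto intro: int simp: sum_distrib_left)
  also have "\<dots> = m * (1 - m)"
    unfolding rest using int(1)[OF d0] by (simp add: m_def prob_space)
  finally have e1: "expectation (\<lambda>u. (S u 0)\<^sup>2 * (1 - (S u 0)\<^sup>2)) = m * (1 - m)" .
  have e2: "expectation (\<lambda>u. (S u 0)\<^sup>2 * (1 - (S u 0)\<^sup>2)) = m - expectation (\<lambda>u. (S u 0)\<^sup>2 * (S u 0)\<^sup>2)"
    using int[OF d0] by (simp add: right_diff_distrib m_def)
  \<comment> \<open>The two evaluations \<open>e1\<close> and \<open>e2\<close> force the fourth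
    moment of the first coordinate to be \<open>m * m\<close>, so its square has variance
    zero.\<close>
  have "expectation (\<lambda>u. ((S u 0)\<^sup>2 - m)\<^sup>2) = expectation (\<lambda>u. (S u 0)\<^sup>2 * (S u 0)\<^sup>2 - 2 * m * (S u 0)\<^sup>2 + m * m)"
    by (intro Bochner_Integration.integral_cong) (auto simp: power2_eq_square algebra_simps)
  also have "\<dots> = expectation (\<lambda>u. (S u 0)\<^sup>2 * (S u 0)\<^sup>2) - 2 * m * m + m * m"
    using int[OF d0] by (simp add: prob_space m_def)
  also have "\<dots> = 0" using e1 e2 by (simp add: algebra_simps)
  finally have zero: "expectation (\<lambda>u. ((S u 0)\<^sup>2 - m)\<^sup>2) = 0" .
  have "integrable \<mu> (\<lambda>u. (S u 0)\<^sup>2 * (S u 0)\<^sup>2 - 2 * m * (S u 0)\<^sup>2 + m * m)"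
    using int[OF d0] by (intro Bochner_Integration.integrable_add Bochner_Integration.integrable_diff integrable_mult_right) auto
  then have "integrable \<mu> (\<lambda>u. ((S u 0)\<^sup>2 - m)\<^sup>2)"
    by (rule Bochner_Integration.integrable_cong[THEN iffD1, rotated 2]) (auto simp: power2_eq_square algebra_simps)
  with zero have "AE u in \<mu>. ((S u 0)\<^sup>2 - m)\<^sup>2 = 0"
    by (subst (asm) integral_nonneg_eq_0_iff_AE) auto
  then have "AE u in \<mu>. (S u 0)\<^sup>2 = m" by simp
  with S_nondeg show False by blast
qed

text \<open>By continuity the product vanishes everywhere inside the box. \<open>\<phi>\<close> may
  have zeros, but none near the origin, so there it can be divided out.\<close>

lemma zero_near_origin:
  assumes H: "continuous_on UNIV H" "H \<in> borel_measurable (lebK d)" "\<And>t. t \<in> box_nu d \<nu> \<Longrightarrow> cmod (H t) \<le> K"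
    and Hcong: "\<And>t. H (restrict t {..<d}) = H t"
    and \<phi>: "continuous_on UNIV \<phi>" "\<phi> \<in> borel_measurable (lebK d)" "\<And>t. cmod (\<phi> t) \<le> 1"
      "\<phi> (restrict (\<lambda>_. 0) {..<d}) \<noteq> 0"
    and "\<nu> > 0"
    and zero: "(\<integral>t. (cmod (H t * \<phi> t))\<^sup>2 \<partial>boxm d \<nu>) = 0"
  shows "\<exists>r>0. \<forall>t. (\<forall>j<d. \<bar>t j\<bar> < r) \<longrightarrow> H t = 0"
proof -
  interpret bm: finite_measure "boxm d \<nu>" by (rule finite_measure_boxm)
  let ?z = "restrict (\<lambda>_. 0) {..<d} :: nat \<Rightarrow> real"
  have "open {t. \<phi> t \<noteq> 0}" by (intro open_Collect_neq \<phi>(1) continuous_on_const)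
  from open_product_contains_cube[OF this, of ?z d] \<phi>(4) obtain r where r: "r > 0"
    "\<And>y. (\<forall>j<d. \<bar>y j - ?z j\<bar> < r) \<Longrightarrow> (\<forall>j\<ge>d. y j = ?z j) \<Longrightarrow> \<phi> y \<noteq> 0" by auto
  have m: "(\<lambda>t. H t * \<phi> t) \<in> borel_measurable (lebK d)" using H(2) \<phi>(2) by measurable
  have int: "integrable (boxm d \<nu>) (\<lambda>t. (cmod (H t * \<phi> t))\<^sup>2)"
  proof (rule bm.integrable_const_bound[where B="K\<^sup>2"])
    show "AE t in boxm d \<nu>. norm ((cmod (H t * \<phi> t))\<^sup>2) \<le> K\<^sup>2"
    proof (intro AE_I2)
      fix t assume "t \<in> space (boxm d \<nu>)"
      then have "cmod (H t) * cmod (\<phi> t) \<le> K * 1"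
        using H(3)[of t] \<phi>(3)[of t] by (intro mult_mono) (auto simp: space_boxm intro: order.trans[OF norm_ge_zero])
      then show "norm ((cmod (H t * \<phi> t))\<^sup>2) \<le> K\<^sup>2"
        by (simp add: norm_mult power_mono)
    qed
    show "(\<lambda>t. (cmod (H t * \<phi> t))\<^sup>2) \<in> borel_measurable (boxm d \<nu>)"
      using borel_measurable_power[OF measurable_compose[OF m borel_measurable_norm], of 2] by (intro measurable_boxm)
  qed
  have "H t = 0" if t: "\<forall>j<d. \<bar>t j\<bar> < min r \<nu>" for t
  proof -
    let ?t = "restrict t {..<d}"
    have "H ?t * \<phi> ?t = 0"
    proof (rule integral_boxm_zero_imp[OF _ m int zero])
      show "continuous_on UNIV (\<lambda>t. H t * \<phi> t)" by (intro continuous_on_mult H \<phi>)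
      show "?t \<in> space (lebK d)" by (simp add: lebK_def space_PiM)
    qed (use t in auto)
    moreover have "\<phi> ?t \<noteq> 0" using t by (intro r(2)) auto
    ultimately show ?thesis using Hcong by simp
  qed
  then show ?thesis using r(1) \<open>\<nu> > 0\<close> by (intro exI[of _ "min r \<nu>"]) auto
qed

lemma Q_cong: "(\<And>j. j < d \<Longrightarrow> t j = t' j) \<Longrightarrow> Q m R t = Q m R t'"
proof -
  assume "\<And>j. j < d \<Longrightarrow> t j = t' j"
  then have "P i R (e1 t) = P i R (e1 t')" "P i R (e2 t) = P i R (e2 t')" for i
    using d2 by (auto intro!: P_cong simp: e1_def e2_def)
  then show ?thesis by (simp add: Q_def)
qed

lemma l1_less:
  assumes "\<And>j. j < d \<Longrightarrow> \<bar>t j\<bar> \<le> r"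
  shows "l1 t \<le> real d * r"
  unfolding l1_def using sum_bounded_above[of "{..<d}" "\<lambda>j. \<bar>t j\<bar>" r] assms by simp

lemma Q_0_nonzero: "\<bar>R\<bar> * l1 t < 1 \<Longrightarrow> Q 0 R t \<noteq> 0"
  unfolding Q_0
  using P_nonzero[of R "e1 t"] P_nonzero[of R "e2 t"] mult_left_mono[OF l1_e1[of t], of "\<bar>R\<bar>"]
    mult_left_mono[OF l1_e2[of t], of "\<bar>R\<bar>"] by force

lemma small_radius:
  assumes "r > 0" "K > 0"
  obtains r' where "r' > 0" "r' \<le> r" "\<And>t. (\<And>j. j < d \<Longrightarrow> \<bar>t j\<bar> < r') \<Longrightarrow> K * l1 t < 1"
proof
  \<comment> \<open>Half of the critical size, so that \<open>K * l1 t\<close> is at most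
    1/2.\<close>
  let ?r = "min r (1 / (2 * K * real d))"
  have dpos: "0 < real d" using d2 by simp
  show "?r > 0" using assms dpos by simp
  show "?r \<le> r" by simp
  fix t :: "nat \<Rightarrow> real" assume "\<And>j. j < d \<Longrightarrow> \<bar>t j\<bar> < ?r"
  then have "l1 t \<le> real d * (1 / (2 * K * real d))"
    by (intro l1_less) (auto intro: less_imp_le)
  also have "\<dots> = 1 / (2 * K)" using dpos by simp
  finally have "K * l1 t \<le> K * (1 / (2 * K))" using assms(2) by (intro mult_left_mono) auto
  then show "K * l1 t < 1" using assms(2) by simp
qed

text \<open>On each short ray the ratio \<open>g\<close> of \<open>P 0\<close> and
  \<open>Q 0\<close> agrees at the radii \<open>s * R\<close> and \<open>s * R'\<close> for all
  \<open>s\<close> up to 1. It is thus invariant under a contraction of the radius, and continuity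
  at radius 0 forces the value 1, which contradicts \<open>not_factorized\<close>.\<close>

lemma contrast_identifies:
  assumes R: "R > 0" "R' > 0" "R \<noteq> R'"
    and \<phi>: "continuous_on UNIV \<phi>" "\<phi> \<in> borel_measurable (lebK d)" "\<And>t. cmod (\<phi> t) \<le> 1"
      "\<phi> (restrict (\<lambda>_. 0) {..<d}) \<noteq> 0"
    and "\<nu> > 0"
  shows "(\<integral>t. (cmod ((P 0 R t * Q 0 R' t - Q 0 R t * P 0 R' t) * \<phi> t))\<^sup>2 \<partial>boxm d \<nu>) \<noteq> 0"
proof
  assume zero: "(\<integral>t. (cmod ((P 0 R t * Q 0 R' t - Q 0 R t * P 0 R' t) * \<phi> t))\<^sup>2 \<partial>boxm d \<nu>) = 0"
  have "\<exists>r>0. \<forall>t. (\<forall>j<d. \<bar>t j\<bar> < r) \<longrightarrow> P 0 R t * Q 0 R' t - Q 0 R t * P 0 R' t = 0"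
  proof (rule zero_near_origin[OF _ _ _ _ \<phi> \<open>\<nu> > 0\<close> zero])
    show "continuous_on UNIV (\<lambda>t. P 0 R t * Q 0 R' t - Q 0 R t * P 0 R' t)"
      by (intro continuous_intros P_continuous Q_continuous)
    show "(\<lambda>t. P 0 R t * Q 0 R' t - Q 0 R t * P 0 R' t) \<in> borel_measurable (lebK d)" by measurable
    show "cmod (P 0 R t * Q 0 R' t - Q 0 R t * P 0 R' t) \<le> 1 * 1 + 1 * 1" for t
      using P_bound[of 0 R t] P_bound[of 0 R' t] Q_bound[of 0 R t] Q_bound[of 0 R' t]
      by (intro order.trans[OF norm_triangle_ineq4 add_mono])
         (simp_all only: norm_mult, auto intro!: mult_le_one)
    show "P 0 R (restrict t {..<d}) * Q 0 R' (restrict t {..<d}) - Q 0 R (restrict t {..<d}) * P 0 R' (restrict t {..<d}) =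
       P 0 R t * Q 0 R' t - Q 0 R t * P 0 R' t" for t
      using P_cong[of "restrict t {..<d}" t] Q_cong[of "restrict t {..<d}" t] by simp
  qed
  then obtain r0 where r0: "r0 > 0" "\<And>t. (\<forall>j<d. \<bar>t j\<bar> < r0) \<Longrightarrow> P 0 R t * Q 0 R' t = Q 0 R t * P 0 R' t"
    by auto
  define Rx where "Rx = max R R'"
  \<comment> \<open>The smaller radius is \<open>\<theta>\<close> times the larger one; as the radii
    differ, this is a strict contraction.\<close>
  define \<theta> where "\<theta> = min R R' / Rx"
  have Rx: "Rx > 0" and \<theta>: "0 < \<theta>" "\<theta> < 1" using R by (auto simp: Rx_def \<theta>_def min_def max_def)
  \<comment> \<open>Small enough for the denominator of \<open>g\<close> to be nonzero at all radii
    up to \<open>Rx\<close>.\<close>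
  obtain r where r: "r > 0" "r \<le> r0" "\<And>t. (\<And>j. j < d \<Longrightarrow> \<bar>t j\<bar> < r) \<Longrightarrow> Rx * l1 t < 1"
    using small_radius[OF r0(1) Rx] by blast
  show False
  proof (rule not_factorized[OF Rx r(1)])
    fix v :: "nat \<Rightarrow> real" assume v: "\<And>j. j < d \<Longrightarrow> \<bar>v j\<bar> < r"
    define g where "g s = P 0 s v / Q 0 s v" for s
    have nz: "Q 0 s v \<noteq> 0" if "0 \<le> s" "s \<le> Rx" for s
    proof (rule Q_0_nonzero)
      have "\<bar>s\<bar> * l1 v \<le> Rx * l1 v" using that by (intro mult_right_mono) auto
      also have "\<dots> < 1" using v by (intro r(3))
      finally show "\<bar>s\<bar> * l1 v < 1" .
    qed
    have step: "g (Rx * s) = g (Rx * (\<theta> * s))" if s: "0 \<le> s" "s \<le> 1" for s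
    proof -
      have "\<bar>s * v j\<bar> < r0" if "j < d" for j
        using v[OF that] s r(2) mult_mono[of "\<bar>s\<bar>" 1 "\<bar>v j\<bar>" "\<bar>v j\<bar>"] by (simp add: abs_mult)
      then have eq: "P 0 (s * R) v * Q 0 (s * R') v = Q 0 (s * R) v * P 0 (s * R') v"
        using r0(2)[of "\<lambda>j. s * v j"] by (simp add: P_scale Q_scale)
      have le: "s * R \<le> Rx" "s * R' \<le> Rx"
        using s R mult_mono[of s 1 R Rx] mult_mono[of s 1 R' Rx] by (auto simp: Rx_def)
      have "g (s * R) = g (s * R')"
        using eq nz[of "s * R"] nz[of "s * R'"] s R le by (simp add: g_def field_simps)
      moreover have "Rx * (\<theta> * s) = s * min R R'" using Rx by (simp add: \<theta>_def)
      moreover have "Rx * s = s * max R R'" by (simp add: Rx_def)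
      ultimately show ?thesis by (simp only:) (simp add: min_def max_def)
    qed
    have iter: "g Rx = g (Rx * \<theta> ^ n)" for n
    proof (induction n)
      case (Suc n)
      have "\<theta> ^ n \<le> 1" using \<theta> by (intro power_le_one) auto
      then show ?case using Suc step[of "\<theta> ^ n"] \<theta> by simp
    qed simp
    have cont: "isCont g 0"
      unfolding g_def
      using has_vector_derivative_continuous[OF P_deriv[of 0 v 0]] has_vector_derivative_continuous[OF Q_deriv[of 0 v 0]]
        nz[of 0] Rx by (intro continuous_divide) auto
    have "(\<lambda>n. Rx * \<theta> ^ n) \<longlonglongrightarrow> Rx * 0"
      using \<theta> by (intro tendsto_intros LIMSEQ_power_zero) auto
    then have "(\<lambda>n. g (Rx * \<theta> ^ n)) \<longlonglongrightarrow> g 0"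
      using isCont_tendsto_compose[OF cont] by simp
    then have "g Rx = g 0" unfolding iter[symmetric] by (simp add: LIMSEQ_const_iff)
    then show "P 0 Rx v = Q 0 Rx v" using nz[of Rx] Rx by (simp add: g_def Q_0)
  qed
qed

text \<open>At radius 0 the first derivative is linear in the frequency. This covers radius 0 in
  \<open>contrast_nondegenerate\<close>, where the scaling factor would be 0 and could not be
  cancelled.\<close>

lemma P_1_0_add: "P 1 0 t = P 1 0 (e1 t) + P 1 0 (e2 t)"
proof -
  have "(\<i> * complex_of_real (ip d t x)) ^ 1 * cis (0 * ip d t x) =
     (\<i> * of_real (ip d (e1 t) x)) ^ 1 * cis (0 * ip d (e1 t) x) + (\<i> * of_real (ip d (e2 t) x)) ^ 1 * cis (0 * ip d (e2 t) x)" for x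
    using ip_split[of d t x] by (simp add: distrib_left)
  then show ?thesis
    unfolding P_def by (simp only: Bochner_Integration.integral_add[OF P_integrable P_integrable])
qed

text \<open>The infinitesimal counterpart of \<open>contrast_identifies\<close>: the expression is
  the numerator of the derivative of \<open>P 0 / Q 0\<close> in the radius. If it vanishes near the
  origin, scaling makes it vanish at all smaller radii, so the ratio is constant down to radius 0,
  where it is 1.\<close>

lemma contrast_nondegenerate:
  assumes R: "R > 0"
    and \<phi>: "continuous_on UNIV \<phi>" "\<phi> \<in> borel_measurable (lebK d)" "\<And>t. cmod (\<phi> t) \<le> 1"
      "\<phi> (restrict (\<lambda>_. 0) {..<d}) \<noteq> 0"
    and "\<nu> > 0"
  shows "(\<integral>t. (cmod ((P 1 R t * Q 0 R t - Q 1 R t * P 0 R t) * \<phi> t))\<^sup>2 \<partial>boxm d \<nu>) \<noteq> 0"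
proof
  assume zero: "(\<integral>t. (cmod ((P 1 R t * Q 0 R t - Q 1 R t * P 0 R t) * \<phi> t))\<^sup>2 \<partial>boxm d \<nu>) = 0"
  have "\<exists>r>0. \<forall>t. (\<forall>j<d. \<bar>t j\<bar> < r) \<longrightarrow> P 1 R t * Q 0 R t - Q 1 R t * P 0 R t = 0"
  proof (rule zero_near_origin[OF _ _ _ _ \<phi> \<open>\<nu> > 0\<close> zero])
    show "continuous_on UNIV (\<lambda>t. P 1 R t * Q 0 R t - Q 1 R t * P 0 R t)"
      by (intro continuous_intros P_continuous Q_continuous)
    show "(\<lambda>t. P 1 R t * Q 0 R t - Q 1 R t * P 0 R t) \<in> borel_measurable (lebK d)" by measurable
    show "cmod (P 1 R t * Q 0 R t - Q 1 R t * P 0 R t) \<le> (real d * \<nu>) * 1 + (2 * (real d * \<nu>)) * 1"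
      if "t \<in> box_nu d \<nu>" for t
    proof -
      have l: "l1 t \<le> real d * \<nu>" using that by (intro l1_less) (auto simp: box_nu_def)
      have b: "cmod (P 0 R t) \<le> 1" "cmod (P 1 R t) \<le> real d * \<nu>" "cmod (Q 0 R t) \<le> 1" "cmod (Q 1 R t) \<le> 2 * (real d * \<nu>)"
        using P_bound[of 0 R t] P_bound[of 1 R t] Q_bound[of 0 R t] Q_bound[of 1 R t] l by auto
      have "cmod (P 1 R t) * cmod (Q 0 R t) \<le> (real d * \<nu>) * 1" "cmod (Q 1 R t) * cmod (P 0 R t) \<le> (2 * (real d * \<nu>)) * 1"
        using \<open>\<nu> > 0\<close> by (intro mult_mono b; simp)+
      then show ?thesis
        using norm_triangle_ineq4[of "P 1 R t * Q 0 R t" "Q 1 R t * P 0 R t"] unfolding norm_mult by linarith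
    qed
    show "P 1 R (restrict t {..<d}) * Q 0 R (restrict t {..<d}) - Q 1 R (restrict t {..<d}) * P 0 R (restrict t {..<d}) =
       P 1 R t * Q 0 R t - Q 1 R t * P 0 R t" for t
      using P_cong[of "restrict t {..<d}" t] Q_cong[of "restrict t {..<d}" t] by simp
  qed
  then obtain r0 where r0: "r0 > 0" "\<And>t. (\<forall>j<d. \<bar>t j\<bar> < r0) \<Longrightarrow> P 1 R t * Q 0 R t = Q 1 R t * P 0 R t"
    by auto
  obtain r where r: "r > 0" "r \<le> r0" "\<And>t. (\<And>j. j < d \<Longrightarrow> \<bar>t j\<bar> < r) \<Longrightarrow> R * l1 t < 1"
    using small_radius[OF r0(1) R] by blast
  show False
  proof (rule not_factorized[OF R r(1)])
    fix v :: "nat \<Rightarrow> real" assume v: "\<And>j. j < d \<Longrightarrow> \<bar>v j\<bar> < r"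
    define g where "g s = P 0 s v / Q 0 s v" for s
    have nz: "Q 0 s v \<noteq> 0" if "s \<in> {0..R}" for s
    proof (rule Q_0_nonzero)
      have "\<bar>s\<bar> * l1 v \<le> R * l1 v" using that by (intro mult_right_mono) auto
      also have "\<dots> < 1" using v by (intro r(3))
      finally show "\<bar>s\<bar> * l1 v < 1" .
    qed
    have eq: "P 1 s v * Q 0 s v = Q 1 s v * P 0 s v" if s: "s \<in> {0..R}" for s
    proof (cases "s = 0")
      case True
      then show ?thesis using P_1_0_add[of v] by (simp add: Q_0 Q_1[unfolded One_nat_def] add.commute)
    next
      case False
      define c where "c = s / R"
      have c: "0 < c" "c \<le> 1" "c * R = s" using s False R by (auto simp: c_def)
      have "\<bar>c * v j\<bar> < r0" if "j < d" for j
        using v[OF that] c r(2) mult_mono[of "\<bar>c\<bar>" 1 "\<bar>v j\<bar>" "\<bar>v j\<bar>"] by (simp add: abs_mult)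
      then have "P 1 R (\<lambda>j. c * v j) * Q 0 R (\<lambda>j. c * v j) = Q 1 R (\<lambda>j. c * v j) * P 0 R (\<lambda>j. c * v j)"
        by (intro r0(2)) auto
      \<comment> \<open>Each side contains exactly one derivative in the radius, hence the same
        factor \<open>c\<close>, which cancels.\<close>
      then show ?thesis using c(1) unfolding P_scale Q_scale c(3) by simp
    qed
    have der: "(g has_vector_derivative 0) (at s within {0..R})" if s: "s \<in> {0..R}" for s
    proof -
      let ?D = "\<lambda>h. - P 0 s v * (inverse (Q 0 s v) * (h *\<^sub>R Q 1 s v) * inverse (Q 0 s v)) + (h *\<^sub>R P 1 s v) / Q 0 s v"
      have "(g has_derivative ?D) (at s)"
        using P_deriv[of 0 v s] Q_deriv[of 0 v s] nz[OF s] unfolding g_def has_vector_derivative_def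
        by (intro has_derivative_divide) auto
      moreover have "?D h = 0" for h
        using eq[OF s] nz[OF s] by (simp add: field_simps scaleR_conv_of_real)
      ultimately have "(g has_vector_derivative 0) (at s)"
        by (simp add: has_vector_derivative_def)
      then show ?thesis by (rule has_vector_derivative_at_within)
    qed
    have "\<exists>c. \<forall>s\<in>{0..R}. g s = c"
    proof (rule has_vector_derivative_zero_constant)
      show "convex {0..R}" by simp
    qed (use der in auto)
    then have "g R = g 0" using R by auto
    then show "P 0 R v = Q 0 R v" using nz[of R] R by (simp add: g_def Q_0)
  qed
qed

end

section \<open>Linearization of the estimator\<close>

text \<open>Distinct observations are independent and centred, so only the diagonal of the double
  sum contributes.\<close>

lemma iid_sum_second_moment:
  fixes g :: "'b \<Rightarrow> real"
  assumes M: "prob_space M"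
    and indep: "prob_space.indep_vars M (\<lambda>_. S) W UNIV"
    and distr: "\<And>l. distr M S (W l) = D"
    and g: "g \<in> borel_measurable S" "integrable D (\<lambda>y. (g y)\<^sup>2)"
    and mean: "(\<integral>y. g y \<partial>D) = 0"
  shows "integrable M (\<lambda>\<omega>. (\<Sum>l<n. g (W l \<omega>))\<^sup>2)" "(\<integral>\<omega>. (\<Sum>l<n. g (W l \<omega>))\<^sup>2 \<partial>M) = real n * (\<integral>y. (g y)\<^sup>2 \<partial>D)"
proof -
  interpret prob_space M by fact
  have W [measurable]: "random_variable S (W l)" for l
    using indep unfolding indep_vars_def2 by simp
  note [measurable] = g(1)
  have indep': "indep_vars (\<lambda>_. borel) (\<lambda>l \<omega>. g (W l \<omega>)) UNIV"
    by (rule indep_vars_compose2[OF indep]) simp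
  have sq: "integrable M (\<lambda>\<omega>. (g (W l \<omega>))\<^sup>2)" "expectation (\<lambda>\<omega>. (g (W l \<omega>))\<^sup>2) = (\<integral>y. (g y)\<^sup>2 \<partial>D)" for l
    using g(2) unfolding distr[of l, symmetric] by (simp_all add: integrable_distr_eq integral_distr)
  have int: "integrable M (\<lambda>\<omega>. g (W l \<omega>))" for l
    by (rule square_integrable_imp_integrable[OF _ sq(1)]) simp
  have mean': "expectation (\<lambda>\<omega>. g (W l \<omega>)) = 0" for l
    using mean unfolding distr[of l, symmetric] by (simp add: integral_distr)
  have prod: "integrable M (\<lambda>\<omega>. g (W l \<omega>) * g (W m \<omega>)) \<and>
      expectation (\<lambda>\<omega>. g (W l \<omega>) * g (W m \<omega>)) = (if l = m then \<integral>y. (g y)\<^sup>2 \<partial>D else 0)" for l m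
  proof (cases "l = m")
    case True
    then show ?thesis using sq[of m] by (simp add: power2_eq_square)
  next
    case False
    have "indep_vars (\<lambda>_. borel) (\<lambda>l \<omega>. g (W l \<omega>)) {l, m}"
      by (rule indep_vars_subset[OF indep']) auto
    from indep_vars_integrable[OF _ this int] indep_vars_lebesgue_integral[OF _ this int]
    show ?thesis using False mean' by auto
  qed
  have eq: "(\<Sum>l<n. g (W l \<omega>))\<^sup>2 = (\<Sum>l<n. \<Sum>m<n. g (W l \<omega>) * g (W m \<omega>))" for \<omega>
    by (simp add: power2_eq_square sum_product)
  show "integrable M (\<lambda>\<omega>. (\<Sum>l<n. g (W l \<omega>))\<^sup>2)"
    unfolding eq using prod by (intro Bochner_Integration.integrable_sum) auto
  have "(\<integral>\<omega>. (\<Sum>l<n. g (W l \<omega>))\<^sup>2 \<partial>M) = (\<Sum>l<n. \<Sum>m<n. expectation (\<lambda>\<omega>. g (W l \<omega>) * g (W m \<omega>)))"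
    unfolding eq using prod
    by (subst Bochner_Integration.integral_sum, force intro: Bochner_Integration.integrable_sum)
       (intro sum.cong refl Bochner_Integration.integral_sum, auto)
  also have "\<dots> = (\<Sum>l<n. \<Sum>m<n. if l = m then \<integral>y. (g y)\<^sup>2 \<partial>D else 0)"
    using prod by simp
  also have "\<dots> = real n * (\<integral>y. (g y)\<^sup>2 \<partial>D)" by simp
  finally show "(\<integral>\<omega>. (\<Sum>l<n. g (W l \<omega>))\<^sup>2 \<partial>M) = real n * (\<integral>y. (g y)\<^sup>2 \<partial>D)" .
qed

text \<open>The bound on the second derivative makes the error pointwise at most \<open>C \<eta> \<bar>X\<bar> + \<kappa> / c\<close>, so no
  event of small probability has to be discarded.\<close>

lemma M_estimator_linearization:
  fixes F F1 F2 :: "nat \<Rightarrow> 'a \<Rightarrow> real \<Rightarrow> real" and G G2 :: "real \<Rightarrow> real"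
  assumes M: "prob_space M"
    and F_deriv: "\<And>n \<omega> R. (F n \<omega> has_real_derivative F1 n \<omega> R) (at R)"
    and F1_deriv: "\<And>n \<omega> R. (F1 n \<omega> has_real_derivative F2 n \<omega> R) (at R)"
    and F_close: "\<And>n \<omega> R. n \<ge> 1 \<Longrightarrow> \<bar>F n \<omega> R - G R\<bar> \<le> \<kappa> n \<omega>"
    and F2_close: "\<And>n \<omega> R. n \<ge> 1 \<Longrightarrow> \<bar>F2 n \<omega> R - G2 R\<bar> \<le> \<kappa> n \<omega>"
    and \<kappa>_int: "\<And>n. integrable M (\<kappa> n)" and \<kappa>_lim: "(\<lambda>n. \<integral>\<omega>. \<kappa> n \<omega> \<partial>M) \<longlonglongrightarrow> 0"
    and G_cont: "continuous_on {Rmin..Rmax} G" and G_min: "G R0 = 0"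
    and G_pos: "\<And>R. R \<in> {Rmin..Rmax} \<Longrightarrow> R \<noteq> R0 \<Longrightarrow> G R > 0"
    and G2: "isCont G2 R0" "G2 R0 > 0"
    and R0: "Rmin < R0" "R0 < Rmax"
    and Rt_meas: "\<And>n. Rt n \<in> borel_measurable M"
    and Rt_min: "\<And>n \<omega>. \<omega> \<in> space M \<Longrightarrow> Rt n \<omega> \<in> {Rmin..Rmax} \<and> (\<forall>R\<in>{Rmin..Rmax}. F n \<omega> (Rt n \<omega>) \<le> F n \<omega> R)"
    and X_int: "\<And>n. integrable M (\<lambda>\<omega>. F1 n \<omega> R0)"
    and X_bound: "\<And>n. n \<ge> 1 \<Longrightarrow> (\<integral>\<omega>. \<bar>sqrt (real n) * F1 n \<omega> R0\<bar> \<partial>M) \<le> K"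
  shows "(\<lambda>n. \<integral>\<omega>. min 1 \<bar>sqrt (real n) * (Rt n \<omega> - R0) + sqrt (real n) * F1 n \<omega> R0 / G2 R0\<bar> \<partial>M) \<longlonglongrightarrow> 0"
proof -
  interpret prob_space M by fact
  define m where "m = G2 R0"
  have m: "m > 0" using G2(2) by (simp add: m_def)
  define X where "X n \<omega> = sqrt (real n) * F1 n \<omega> R0" for n \<omega>
  define Z where "Z n \<omega> = min 1 \<bar>sqrt (real n) * (Rt n \<omega> - R0) + X n \<omega> / m\<bar>" for n \<omega>
  have X_int': "integrable M (X n)" for n unfolding X_def using X_int by simp
  have [measurable]: "X n \<in> borel_measurable M" "Rt n \<in> borel_measurable M" for n
    using X_int' Rt_meas by auto
  have Z_int: "integrable M (Z n)" for n
    unfolding Z_def by (intro integrable_const_bound[where B=1]) auto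
  have Z0: "0 \<le> Z n \<omega>" for n \<omega> by (simp add: Z_def)
  have K0: "0 \<le> K"
    using X_bound[of 1] Bochner_Integration.integral_nonneg[of M "\<lambda>\<omega>. \<bar>sqrt (real 1) * F1 1 \<omega> R0\<bar>"] by linarith
  have key: "\<exists>c>0. \<forall>n\<ge>1. \<forall>\<omega>\<in>space M. Z n \<omega> \<le> 2 * \<eta> / m\<^sup>2 * \<bar>X n \<omega>\<bar> + \<kappa> n \<omega> / c"
    if \<eta>: "0 < \<eta>" "\<eta> \<le> m / 2" for \<eta>
  proof -
    have "\<exists>\<zeta>>0. \<forall>R. \<bar>R - R0\<bar> < \<zeta> \<longrightarrow> \<bar>G2 R - m\<bar> < \<eta> / 2"
      using G2(1) \<eta>(1) unfolding continuous_at_eps_delta dist_real_def m_def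
      by (metis half_gt_zero)
    then obtain \<zeta>0 where \<zeta>0: "\<zeta>0 > 0" "\<And>R. \<bar>R - R0\<bar> < \<zeta>0 \<Longrightarrow> \<bar>G2 R - m\<bar> < \<eta> / 2" by blast
    \<comment> \<open>At most the distance of \<open>R0\<close> to each endpoint as well, so that a
      minimiser within \<open>\<zeta>\<close> of \<open>R0\<close> is interior.\<close>
    define \<zeta> where "\<zeta> = min \<zeta>0 (min (R0 - Rmin) (Rmax - R0))"
    have \<zeta>: "\<zeta> > 0" using \<zeta>0 R0 by (simp add: \<zeta>_def)
    define A where "A = {R \<in> {Rmin..Rmax}. \<zeta> \<le> \<bar>R - R0\<bar>}"
    have A: "compact A"
    proof -
      have "A = {Rmin..Rmax} \<inter> {R. \<zeta> \<le> \<bar>R - R0\<bar>}" by (auto simp: A_def)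
      moreover have "closed {R. \<zeta> \<le> \<bar>R - R0\<bar>}" by (intro closed_Collect_le continuous_intros)
      ultimately show ?thesis by (simp add: compact_Int_closed)
    qed
    have "\<exists>c0>0. \<forall>R\<in>A. c0 \<le> G R"
    proof (cases "A = {}")
      case True
      then show ?thesis by (intro exI[of _ 1]) auto
    next
      case False
      have "continuous_on A G" using G_cont by (rule continuous_on_subset) (auto simp: A_def)
      from continuous_attains_inf[OF A False this] obtain R1 where "R1 \<in> A" "\<forall>R\<in>A. G R1 \<le> G R" by blast
      moreover have "G R1 > 0" using \<open>R1 \<in> A\<close> \<zeta> by (intro G_pos) (auto simp: A_def)
      ultimately show ?thesis by blast
    qed
    then obtain c0 where c0: "c0 > 0" "\<And>R. R \<in> A \<Longrightarrow> c0 \<le> G R" by blast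
    \<comment> \<open>\<open>c0 / 2\<close> keeps the minimiser out of \<open>A\<close>: there
      \<open>G\<close> is at least \<open>c0\<close>, while at the minimiser it is at most
      \<open>2 * \<kappa>\<close>. \<open>\<eta> / 2\<close> is the share of the error of
      \<open>F2\<close> in the tolerance \<open>\<eta>\<close>.\<close>
    define c where "c = min (c0 / 2) (\<eta> / 2)"
    have c: "c > 0" using c0 \<eta> by (simp add: c_def)
    have "Z n \<omega> \<le> 2 * \<eta> / m\<^sup>2 * \<bar>X n \<omega>\<bar> + \<kappa> n \<omega> / c" if n: "n \<ge> 1" and \<omega>: "\<omega> \<in> space M" for n \<omega>
    proof (cases "\<kappa> n \<omega> < c")
      case False
      \<comment> \<open>For large \<open>\<kappa>\<close> the truncation of \<open>Z\<close> at 1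
        already gives the bound.\<close>
      then have "1 \<le> \<kappa> n \<omega> / c" using c by simp
      moreover have "0 \<le> 2 * \<eta> / m\<^sup>2 * \<bar>X n \<omega>\<bar>" using \<eta> by simp
      moreover have "Z n \<omega> \<le> 1" by (simp add: Z_def)
      ultimately show ?thesis by linarith
    next
      case True
      have \<kappa>0: "0 \<le> \<kappa> n \<omega>" using F_close[OF n, of \<omega> R0] by linarith
      let ?R = "Rt n \<omega>"
      have mem: "?R \<in> {Rmin..Rmax}" and le: "F n \<omega> ?R \<le> F n \<omega> R0"
        using Rt_min[OF \<omega>, of n] R0 by auto
      have "G ?R \<le> 2 * \<kappa> n \<omega>"
        using F_close[OF n, of \<omega> ?R] F_close[OF n, of \<omega> R0] le G_min by linarith
      also have "\<dots> < c0" using True by (simp add: c_def)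
      finally have "?R \<notin> A" using c0(2) by force
      then have near: "\<bar>?R - R0\<bar> < \<zeta>" using mem by (auto simp: A_def)
      \<comment> \<open>An interior minimiser is a critical point; the mean value theorem between it
        and \<open>R0\<close> then brings in \<open>F2\<close> at an intermediate point.\<close>
      have "F1 n \<omega> ?R = 0"
      proof (rule DERIV_local_min[OF F_deriv])
        show "0 < min (?R - Rmin) (Rmax - ?R)" using near by (auto simp: \<zeta>_def)
        show "\<forall>y. \<bar>?R - y\<bar> < min (?R - Rmin) (Rmax - ?R) \<longrightarrow> F n \<omega> ?R \<le> F n \<omega> y"
        proof (intro allI impI)
          fix y assume "\<bar>?R - y\<bar> < min (?R - Rmin) (Rmax - ?R)"
          then have "y \<in> {Rmin..Rmax}" unfolding atLeastAtMost_iff by linarith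
          then show "F n \<omega> ?R \<le> F n \<omega> y" using Rt_min[OF \<omega>, of n] by blast
        qed
      qed
      moreover have "\<exists>\<xi>. \<bar>\<xi> - R0\<bar> \<le> \<bar>?R - R0\<bar> \<and> F1 n \<omega> ?R - F1 n \<omega> R0 = (?R - R0) * F2 n \<omega> \<xi>"
      proof -
        consider "?R = R0" | "?R < R0" | "R0 < ?R" by linarith
        then show ?thesis
        proof cases
          case 1
          then show ?thesis by auto
        next
          case 2
          from MVT2[OF 2, of "F1 n \<omega>" "F2 n \<omega>"] F1_deriv obtain z where
            "?R < z" "z < R0" "F1 n \<omega> R0 - F1 n \<omega> ?R = (R0 - ?R) * F2 n \<omega> z" by blast
          then show ?thesis by (intro exI[of _ z]) (auto simp: algebra_simps)
        next
          case 3
          from MVT2[OF 3, of "F1 n \<omega>" "F2 n \<omega>"] F1_deriv obtain z where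
            "R0 < z" "z < ?R" "F1 n \<omega> ?R - F1 n \<omega> R0 = (?R - R0) * F2 n \<omega> z" by blast
          then show ?thesis by (intro exI[of _ z]) auto
        qed
      qed
      ultimately obtain \<xi> where \<xi>: "\<bar>\<xi> - R0\<bar> \<le> \<bar>?R - R0\<bar>" "- F1 n \<omega> R0 = (?R - R0) * F2 n \<omega> \<xi>" by auto
      define w where "w = F2 n \<omega> \<xi>"
      have "\<bar>\<xi> - R0\<bar> < \<zeta>0" using \<xi>(1) near by (simp add: \<zeta>_def)
      from \<zeta>0(2)[OF this] F2_close[OF n, of \<omega> \<xi>] True have w_close: "\<bar>w - m\<bar> \<le> \<eta>"
        unfolding w_def c_def min_less_iff_conj by linarith
      then have w: "w \<ge> m / 2" using \<eta>(2) by linarith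
      then have "w > 0" using m by linarith
      have "?R - R0 = - F1 n \<omega> R0 / w" using \<xi>(2) \<open>w > 0\<close> by (simp add: w_def field_simps)
      then have "sqrt (real n) * (?R - R0) + X n \<omega> / m = sqrt (real n) * (- F1 n \<omega> R0 / w) + X n \<omega> / m"
        by (simp only:)
      \<comment> \<open>The error is the score times the difference of \<open>1 / m\<close> and
        \<open>1 / w\<close>.\<close>
      also have "\<dots> = X n \<omega> * ((w - m) / (m * w))"
        using m \<open>w > 0\<close> by (simp add: X_def field_simps)
      finally have "sqrt (real n) * (?R - R0) + X n \<omega> / m = X n \<omega> * ((w - m) / (m * w))" .
      moreover have "\<bar>(w - m) / (m * w)\<bar> \<le> 2 * \<eta> / m\<^sup>2"
      proof -
        have "\<bar>(w - m) / (m * w)\<bar> = \<bar>w - m\<bar> / (m * w)" using m \<open>w > 0\<close> by (simp add: abs_mult)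
        also have "\<dots> \<le> \<eta> / (m * (m / 2))"
          using w_close w m \<open>w > 0\<close> \<eta> by (intro frac_le mult_left_mono) auto
        finally show ?thesis by (simp add: power2_eq_square mult.commute)
      qed
      ultimately have "Z n \<omega> \<le> \<bar>X n \<omega>\<bar> * (2 * \<eta> / m\<^sup>2)"
        unfolding Z_def by (intro min.coboundedI2) (simp only: abs_mult, intro mult_left_mono, auto)
      moreover have "0 \<le> \<kappa> n \<omega> / c" using \<kappa>0 c by simp
      ultimately show ?thesis by (simp add: mult.commute)
    qed
    then show ?thesis using c by blast
  qed
  have "(\<lambda>n. \<integral>\<omega>. Z n \<omega> \<partial>M) \<longlonglongrightarrow> 0"
  proof (rule LIMSEQ_I)
    fix e :: real assume e: "e > 0"
    \<comment> \<open>Used as a divisor, hence kept positive even if \<open>K\<close> is 0.\<close>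
    define k where "k = K + 1"
    have k: "k > 0" "K \<le> k" using K0 by (auto simp: k_def)
    \<comment> \<open>The first bound keeps \<open>w\<close> at least \<open>m / 2\<close>; the
      second makes the contribution of the score at most \<open>e / 2\<close>.\<close>
    define \<eta> where "\<eta> = min (m / 2) (e * m\<^sup>2 / (4 * k))"
    have \<eta>: "0 < \<eta>" "\<eta> \<le> m / 2"
      using m e k unfolding \<eta>_def by (simp, intro min.cobounded1)
    have \<eta>_e: "2 * \<eta> / m\<^sup>2 * K \<le> e / 2"
    proof -
      have "2 * \<eta> / m\<^sup>2 * K \<le> 2 * (e * m\<^sup>2 / (4 * k)) / m\<^sup>2 * k"
        using K0 k m e by (intro mult_mono divide_right_mono mult_left_mono) (auto simp: \<eta>_def)
      also have "\<dots> = e / 2" using m k by (simp add: field_simps)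
      finally show ?thesis .
    qed
    obtain c where c: "c > 0" "\<And>n \<omega>. n \<ge> 1 \<Longrightarrow> \<omega> \<in> space M \<Longrightarrow> Z n \<omega> \<le> 2 * \<eta> / m\<^sup>2 * \<bar>X n \<omega>\<bar> + \<kappa> n \<omega> / c"
      using key[OF \<eta>] by blast
    have "\<forall>\<^sub>F n in sequentially. (\<integral>\<omega>. \<kappa> n \<omega> \<partial>M) < e / 2 * c"
      using \<kappa>_lim e c by (intro order_tendstoD(2)) auto
    then have "\<forall>\<^sub>F n in sequentially. norm ((\<integral>\<omega>. Z n \<omega> \<partial>M) - 0) < e"
      using eventually_ge_at_top[of 1]
    proof eventually_elim
      case (elim n)
      have "(\<integral>\<omega>. Z n \<omega> \<partial>M) \<le> (\<integral>\<omega>. 2 * \<eta> / m\<^sup>2 * \<bar>X n \<omega>\<bar> + \<kappa> n \<omega> / c \<partial>M)"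
        using Z_int X_int' \<kappa>_int c(2)[OF elim(2)]
        by (intro integral_mono Bochner_Integration.integrable_add integrable_mult_right integrable_divide integrable_abs) auto
      also have "\<dots> = 2 * \<eta> / m\<^sup>2 * (\<integral>\<omega>. \<bar>X n \<omega>\<bar> \<partial>M) + (\<integral>\<omega>. \<kappa> n \<omega> \<partial>M) / c"
        using X_int' \<kappa>_int by (subst Bochner_Integration.integral_add) auto
      also have "\<dots> \<le> 2 * \<eta> / m\<^sup>2 * K + (\<integral>\<omega>. \<kappa> n \<omega> \<partial>M) / c"
        using X_bound[OF elim(2)] \<eta>(1) unfolding X_def by (intro add_mono mult_left_mono) auto
      also have "(\<integral>\<omega>. \<kappa> n \<omega> \<partial>M) / c < e / 2" using elim(1) c(1) by (simp add: divide_less_eq)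
      finally have "(\<integral>\<omega>. Z n \<omega> \<partial>M) < e" using \<eta>_e by linarith
      moreover have "0 \<le> (\<integral>\<omega>. Z n \<omega> \<partial>M)" using Z0 by simp
      ultimately show ?case by simp
    qed
    then show "\<exists>no. \<forall>n\<ge>no. norm ((\<integral>\<omega>. Z n \<omega> \<partial>M) - 0) < e"
      by (auto simp: eventually_sequentially)
  qed
  then show ?thesis by (simp add: Z_def X_def m_def)
qed

section \<open>Expansion of the contrast derivative around the true characteristic functions\<close>

lemma norm_cnj_mult_add_le: "cmod (cnj z * w + cnj v * u) \<le> cmod z * cmod w + cmod v * cmod u"
  by (rule order.trans[OF norm_triangle_ineq]) (simp add: norm_mult)

context least_squares_contrast
begin

lemma admissible_mult: "admissible q \<Longrightarrow> admissible p \<Longrightarrow> admissible (\<lambda>t. q t * p t)"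
  unfolding admissible_def by (auto simp: norm_mult intro!: mult_le_one)

lemma sum3_power2_le: "(x + y + z)\<^sup>2 \<le> 3 * (x\<^sup>2 + y\<^sup>2 + z\<^sup>2)" for x y z :: real
proof -
  have "0 \<le> (x - y)\<^sup>2 + (y - z)\<^sup>2 + (x - z)\<^sup>2" by simp
  then show ?thesis by (simp add: power2_eq_square algebra_simps)
qed

text \<open>A squared distance is used because its mean under sampling is an integrated
  variance.\<close>

definition sqdist :: "('t \<Rightarrow> complex) \<Rightarrow> ('t \<Rightarrow> complex) \<Rightarrow> real" where
  "sqdist p p' = (\<integral>t. (cmod (p t - p' t))\<^sup>2 \<partial>\<tau>)"

lemma sqdist_nonneg: "0 \<le> sqdist p p'"
  by (simp add: sqdist_def)

lemma sqdist_integrable: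
  assumes "admissible p" "admissible p'"
  shows "integrable \<tau> (\<lambda>t. (cmod (p t - p' t))\<^sup>2)"
proof (rule integrable_const_bound[where B=4])
  show "AE t in \<tau>. norm ((cmod (p t - p' t))\<^sup>2) \<le> 4"
  proof (intro AE_I2)
    fix t assume "t \<in> space \<tau>"
    then have "cmod (p t - p' t) \<le> 2"
      using assms norm_triangle_ineq4[of "p t" "p' t"] unfolding admissible_def by force
    then have "(cmod (p t - p' t))\<^sup>2 \<le> 2\<^sup>2" by (intro power_mono) auto
    then show "norm ((cmod (p t - p' t))\<^sup>2) \<le> 4" by simp
  qed
  show "(\<lambda>t. (cmod (p t - p' t))\<^sup>2) \<in> borel_measurable \<tau>"
    using assms unfolding admissible_def
    by (intro borel_measurable_power borel_measurable_norm[THEN measurable_compose[rotated]] borel_measurable_diff) auto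
qed

lemma product_diff_le:
  assumes "cmod u' \<le> 1" "cmod v \<le> (1::real)"
  shows "cmod (u * v - u' * v') \<le> cmod (u - u') + cmod (v - v')"
proof -
  have "u * v - u' * v' = (u - u') * v + u' * (v - v')" by (simp add: algebra_simps)
  then have "cmod (u * v - u' * v') \<le> cmod (u - u') * cmod v + cmod u' * cmod (v - v')"
    by (metis norm_mult norm_triangle_ineq)
  also have "\<dots> \<le> cmod (u - u') * 1 + 1 * cmod (v - v')"
    using assms by (intro add_mono mult_left_mono mult_right_mono) auto
  finally show ?thesis by simp
qed

text \<open>The inequality \<open>x \<le> s * x\<^sup>2 + 1 / s\<close> trades first powers for
  squared distances and keeps the bound linear in quantities whose means are known. The parameter is
  later taken to be \<open>sqrt n\<close>.\<close>

lemma product_contrast_diff: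
  assumes p: "admissible p0" "admissible p1" "admissible p2" and r: "admissible r0" "admissible r1" "admissible r2"
    and s: "s > 0"
  shows "(\<integral>t. cmod (r1 t * r2 t - p1 t * p2 t) + cmod (r0 t - p0 t) \<partial>\<tau>) \<le>
     s * (sqdist r0 p0 + sqdist r1 p1 + sqdist r2 p2) + 3 * measure \<tau> (space \<tau>) / s"
proof -
  let ?V = "\<lambda>t. (cmod (r0 t - p0 t))\<^sup>2 + (cmod (r1 t - p1 t))\<^sup>2 + (cmod (r2 t - p2 t))\<^sup>2"
  have le: "x \<le> s * x\<^sup>2 + 1 / s" if "0 \<le> x" for x
  proof -
    have "0 \<le> (s * x - 1)\<^sup>2 + s * x" using that s by simp
    then have "s * x \<le> s * (s * x\<^sup>2 + 1 / s)" using s by (simp add: power2_eq_square algebra_simps)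
    then show ?thesis using s by simp
  qed
  have int: "integrable \<tau> ?V"
    using p r by (intro Bochner_Integration.integrable_add sqdist_integrable) auto
  have "(\<integral>t. cmod (r1 t * r2 t - p1 t * p2 t) + cmod (r0 t - p0 t) \<partial>\<tau>) \<le> (\<integral>t. s * ?V t + 3 / s \<partial>\<tau>)"
  proof (intro integral_mono Bochner_Integration.integrable_add admissible_diff_integrable admissible_mult p r integrable_mult_right)
    fix t assume t: "t \<in> space \<tau>"
    then have "cmod (r1 t * r2 t - p1 t * p2 t) \<le> cmod (r1 t - p1 t) + cmod (r2 t - p2 t)"
      using p r unfolding admissible_def by (intro product_diff_le) auto
    then show "cmod (r1 t * r2 t - p1 t * p2 t) + cmod (r0 t - p0 t) \<le> s * ?V t + 3 / s"
      using le[of "cmod (r0 t - p0 t)"] le[of "cmod (r1 t - p1 t)"] le[of "cmod (r2 t - p2 t)"]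
      by (simp add: distrib_left)
  qed (use int p r in \<open>auto intro!: sqdist_integrable\<close>)
  also have "\<dots> = s * (\<integral>t. ?V t \<partial>\<tau>) + 3 * measure \<tau> (space \<tau>) / s"
    using int by (subst Bochner_Integration.integral_add) auto
  also have "(\<integral>t. ?V t \<partial>\<tau>) = sqdist r0 p0 + sqdist r1 p1 + sqdist r2 p2"
    unfolding sqdist_def using p r by (simp add: sqdist_integrable)
  finally show ?thesis .
qed

text \<open>The derivative of the residual with respect to the joint and the two marginal
  characteristic functions, at the reference triple, in the direction \<open>x0\<close>,
  \<open>x1\<close>, \<open>x2\<close>.\<close>

definition lin :: "('t \<Rightarrow> complex) \<Rightarrow> ('t \<Rightarrow> complex) \<Rightarrow> real \<Rightarrow> complex \<Rightarrow> complex \<Rightarrow> complex \<Rightarrow> 't \<Rightarrow> complex" where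
  "lin p1 p2 R x0 x1 x2 t = a 0 R t * (p2 t * x1 + p1 t * x2) - b 0 R t * x0"

lemma lin_bound:
  assumes "admissible p1" "admissible p2" "t \<in> space \<tau>"
  shows "cmod (lin p1 p2 R x0 x1 x2 t) \<le> B * (cmod x0 + cmod x1 + cmod x2)"
proof -
  have "cmod (lin p1 p2 R x0 x1 x2 t) \<le> cmod (a 0 R t) * (cmod (p2 t) * cmod x1 + cmod (p1 t) * cmod x2) + cmod (b 0 R t) * cmod x0"
    unfolding lin_def
    by (intro order.trans[OF norm_triangle_ineq4] add_mono)
       (simp_all add: norm_mult, intro mult_left_mono order.trans[OF norm_triangle_ineq], simp_all add: norm_mult)
  also have "\<dots> \<le> B * (1 * cmod x1 + 1 * cmod x2) + B * cmod x0"
    using assms a_bound[of t 0 R] b_bound[of t 0 R] B_nonneg[of t] unfolding admissible_def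
    by (intro add_mono mult_mono mult_right_mono) auto
  finally show ?thesis by (simp add: algebra_simps)
qed

text \<open>The integrand of \<open>J1\<close> is a product whose first factor vanishes at the
  reference triple. To first order the second factor can be frozen and the first replaced by
  \<open>lin\<close>; both errors are products of two deviations.\<close>

lemma J1_linearization:
  assumes p: "admissible p0" "admissible p1" "admissible p2" and r: "admissible r0" "admissible r1" "admissible r2"
    and T0: "\<And>t. t \<in> space \<tau> \<Longrightarrow> T 0 (\<lambda>t. p1 t * p2 t) p0 R t = 0"
  shows "\<bar>J1 (\<lambda>t. r1 t * r2 t) r0 R -
     (\<integral>t. 2 * Re (cnj (lin p1 p2 R (r0 t - p0 t) (r1 t - p1 t) (r2 t - p2 t) t) * T 1 (\<lambda>t. p1 t * p2 t) p0 R t) \<partial>\<tau>)\<bar>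
     \<le> 12 * B\<^sup>2 * (sqdist r0 p0 + sqdist r1 p1 + sqdist r2 p2)"
proof -
  let ?q = "\<lambda>t. p1 t * p2 t" and ?qr = "\<lambda>t. r1 t * r2 t"
  let ?L = "\<lambda>t. lin p1 p2 R (r0 t - p0 t) (r1 t - p1 t) (r2 t - p2 t) t"
  let ?V = "\<lambda>t. (cmod (r0 t - p0 t))\<^sup>2 + (cmod (r1 t - p1 t))\<^sup>2 + (cmod (r2 t - p2 t))\<^sup>2"
  have q: "admissible ?q" "admissible ?qr" using p r by (auto intro: admissible_mult)
  have intV: "integrable \<tau> ?V"
    using p r by (intro Bochner_Integration.integrable_add sqdist_integrable) auto
  note [measurable] = T_meas[OF q(1) p(1)] T_meas[OF q(2) r(1)]
  have L_meas [measurable]: "?L \<in> borel_measurable \<tau>"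
    using p r unfolding lin_def admissible_def
    by (intro borel_measurable_diff borel_measurable_times borel_measurable_add a_meas b_meas) auto
  have diff2: "cmod (x - y) \<le> 2" if "cmod x \<le> 1" "cmod y \<le> 1" for x y
    using norm_triangle_ineq4[of x y] that by linarith
  have intL: "integrable \<tau> (\<lambda>t. Re (cnj (?L t) * T 1 ?q p0 R t))"
  proof (rule integrable_const_bound[where B="6 * B * (6 * B)"])
    show "AE t in \<tau>. norm (Re (cnj (?L t) * T 1 ?q p0 R t)) \<le> 6 * B * (6 * B)"
      unfolding real_norm_def
    proof (intro AE_I2 Re_cnj_mult_le)
      fix t assume t: "t \<in> space \<tau>"
      have "cmod (?L t) \<le> B * (cmod (r0 t - p0 t) + cmod (r1 t - p1 t) + cmod (r2 t - p2 t))"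
        using p t by (intro lin_bound)
      also have "\<dots> \<le> B * (2 + 2 + 2)"
        using p r t B_nonneg[OF t] unfolding admissible_def by (intro mult_left_mono add_mono diff2) auto
      finally show "cmod (?L t) \<le> 6 * B" by simp
      show "cmod (T 1 ?q p0 R t) \<le> 6 * B"
        using T_bound[OF q(1) p(1) t, of 1 R] B_nonneg[OF t] by simp
    qed
  qed measurable
  have pointwise: "\<bar>2 * Re (cnj (T 0 ?qr r0 R t) * T 1 ?qr r0 R t) - 2 * Re (cnj (?L t) * T 1 ?q p0 R t)\<bar> \<le> 12 * B\<^sup>2 * ?V t"
    if t: "t \<in> space \<tau>" for t
  proof -
    let ?x0 = "r0 t - p0 t" and ?x1 = "r1 t - p1 t" and ?x2 = "r2 t - p2 t"
    define \<sigma> where "\<sigma> = cmod ?x0 + cmod ?x1 + cmod ?x2"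
    have \<sigma>0: "0 \<le> \<sigma>" by (simp add: \<sigma>_def)
    have B0: "0 \<le> B" by (rule B_nonneg[OF t])
    have dq: "cmod (?qr t - ?q t) + cmod (r0 t - p0 t) \<le> \<sigma>"
      using product_diff_le[of "p1 t" "r2 t" "r1 t" "p2 t"] p r t unfolding admissible_def \<sigma>_def by force
    have T1: "cmod (T 1 ?qr r0 R t - T 1 ?q p0 R t) \<le> B * \<sigma>"
      using T_diff[OF t, of 1 ?qr r0 R ?q p0] mult_left_mono[OF dq B0] by simp
    have T0': "cmod (T 0 ?qr r0 R t) \<le> B * \<sigma>"
      using T_diff[OF t, of 0 ?qr r0 R ?q p0] mult_left_mono[OF dq B0] T0[OF t] by simp
    \<comment> \<open>The residual is bilinear in the marginals, so the only term beyond
      \<open>lin\<close> is the product of their deviations.\<close>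
    have "T 0 ?qr r0 R t - ?L t = T 0 ?q p0 R t + a 0 R t * (?x1 * ?x2)"
      by (simp add: T_def lin_def algebra_simps)
    then have "T 0 ?qr r0 R t - ?L t = a 0 R t * (?x1 * ?x2)" using T0[OF t] by simp
    then have L': "cmod (T 0 ?qr r0 R t - ?L t) \<le> B * (cmod ?x1 * cmod ?x2)"
      using a_bound[OF t, of 0 R] by (simp add: norm_mult mult_right_mono)
    have x12: "2 * (cmod ?x1 * cmod ?x2) \<le> \<sigma>\<^sup>2"
    proof -
      have "2 * (cmod ?x1 * cmod ?x2) \<le> (cmod ?x1 + cmod ?x2)\<^sup>2" by (simp add: power2_sum)
      also have "\<dots> \<le> \<sigma>\<^sup>2" by (intro power_mono) (auto simp: \<sigma>_def)
      finally show ?thesis .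
    qed
    have "cnj (T 0 ?qr r0 R t) * T 1 ?qr r0 R t - cnj (?L t) * T 1 ?q p0 R t =
      cnj (T 0 ?qr r0 R t) * (T 1 ?qr r0 R t - T 1 ?q p0 R t) + cnj (T 0 ?qr r0 R t - ?L t) * T 1 ?q p0 R t"
      by (simp add: algebra_simps)
    with norm_cnj_mult_add_le have "cmod (cnj (T 0 ?qr r0 R t) * T 1 ?qr r0 R t - cnj (?L t) * T 1 ?q p0 R t) \<le>
       cmod (T 0 ?qr r0 R t) * cmod (T 1 ?qr r0 R t - T 1 ?q p0 R t) + cmod (T 0 ?qr r0 R t - ?L t) * cmod (T 1 ?q p0 R t)"
      by (simp only:)
    also have "\<dots> \<le> B * \<sigma> * (B * \<sigma>) + B * (cmod ?x1 * cmod ?x2) * (2 * B)"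
      using T0' T1 L' T_bound[OF q(1) p(1) t, of 1 R] B0 \<sigma>0 by (intro add_mono mult_mono) auto
    also have "\<dots> = B\<^sup>2 * (\<sigma>\<^sup>2 + 2 * (cmod ?x1 * cmod ?x2))"
      by (simp add: power2_eq_square algebra_simps)
    also have "\<dots> \<le> B\<^sup>2 * (\<sigma>\<^sup>2 + \<sigma>\<^sup>2)" using x12 by (intro mult_left_mono) auto
    also have "\<dots> \<le> B\<^sup>2 * (2 * (3 * ?V t))"
      using sum3_power2_le[of "cmod ?x0" "cmod ?x1" "cmod ?x2"] unfolding \<sigma>_def[symmetric]
      by (intro mult_left_mono) auto
    \<comment> \<open>This 6 and the weight 2 in \<open>J1\<close> make up the constant 12.\<close>
    also have "\<dots> = 6 * (B\<^sup>2 * ?V t)" by (simp add: algebra_simps)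
    finally have "cmod (cnj (T 0 ?qr r0 R t) * T 1 ?qr r0 R t - cnj (?L t) * T 1 ?q p0 R t) \<le> 6 * (B\<^sup>2 * ?V t)" .
    moreover have "\<bar>Re (cnj (T 0 ?qr r0 R t) * T 1 ?qr r0 R t) - Re (cnj (?L t) * T 1 ?q p0 R t)\<bar>
        \<le> cmod (cnj (T 0 ?qr r0 R t) * T 1 ?qr r0 R t - cnj (?L t) * T 1 ?q p0 R t)"
      using abs_Re_le_cmod[of "cnj (T 0 ?qr r0 R t) * T 1 ?qr r0 R t - cnj (?L t) * T 1 ?q p0 R t"]
      by (simp only: minus_complex.sel)
    ultimately show ?thesis by (simp only: mult.assoc)
  qed
  have intT: "integrable \<tau> (\<lambda>t. 2 * Re (cnj (T 0 ?qr r0 R t) * T 1 ?qr r0 R t))"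
    by (intro integrable_mult_right Re_T_integrable q r) auto
  have intL2: "integrable \<tau> (\<lambda>t. 2 * Re (cnj (?L t) * T 1 ?q p0 R t))"
    by (intro integrable_mult_right intL)
  have "\<bar>\<integral>t. 2 * Re (cnj (T 0 ?qr r0 R t) * T 1 ?qr r0 R t) - 2 * Re (cnj (?L t) * T 1 ?q p0 R t) \<partial>\<tau>\<bar> \<le> (\<integral>t. 12 * B\<^sup>2 * ?V t \<partial>\<tau>)"
    using intT intL2 pointwise integrable_mult_right[OF intV, of "12 * B\<^sup>2"]
    by (intro order.trans[OF integral_abs_bound] integral_mono integrable_abs Bochner_Integration.integrable_diff)
  also have "\<dots> = 12 * B\<^sup>2 * (sqdist r0 p0 + sqdist r1 p1 + sqdist r2 p2)"
    unfolding sqdist_def using p r by (simp add: sqdist_integrable)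
  finally show ?thesis
    unfolding J1_def by (simp only: Bochner_Integration.integral_diff[OF intT intL2])
qed

end

section \<open>Empirical characteristic functions\<close>

lemma finite_Fubini:
  fixes f :: "'x \<Rightarrow> 'y \<Rightarrow> real"
  assumes A: "finite_measure A" and C: "finite_measure C"
    and f: "(\<lambda>(x, y). f x y) \<in> borel_measurable (A \<Otimes>\<^sub>M C)"
    and bnd: "\<And>x y. x \<in> space A \<Longrightarrow> y \<in> space C \<Longrightarrow> \<bar>f x y\<bar> \<le> K"
  shows "integrable A (\<lambda>x. \<integral>y. f x y \<partial>C)"
    and "(\<integral>x. (\<integral>y. f x y \<partial>C) \<partial>A) = (\<integral>y. (\<integral>x. f x y \<partial>A) \<partial>C)"
proof -
  interpret A: finite_measure A by fact
  interpret C: finite_measure C by fact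
  interpret AC: pair_sigma_finite A C ..
  interpret P: finite_measure "A \<Otimes>\<^sub>M C" by (intro finite_measure_pair_measure A C)
  have int: "integrable (A \<Otimes>\<^sub>M C) (\<lambda>(x, y). f x y)"
    using bnd f by (intro P.integrable_const_bound[where B=K]) (auto simp: space_pair_measure)
  show "integrable A (\<lambda>x. \<integral>y. f x y \<partial>C)"
    using AC.integrable_fst[OF int] .
  show "(\<integral>x. (\<integral>y. f x y \<partial>C) \<partial>A) = (\<integral>y. (\<integral>x. f x y \<partial>A) \<partial>C)"
    using AC.Fubini_integral[OF int] by simp
qed

lemma cmod_charf_le:
  assumes "prob_space D" "sets D = sets (lebK d)"
  shows "cmod (charf d D t) \<le> 1"
proof -
  interpret prob_space D by fact
  have [measurable]: "ip d t \<in> borel_measurable D"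
    using measurable_ip[of d t] measurable_cong_sets[OF assms(2) refl] by blast
  have "cmod (charf d D t) \<le> (\<integral>y. 1 \<partial>D)"
    unfolding charf_def
    by (intro order.trans[OF integral_norm_bound] integral_mono integrable_norm integrable_const_bound[where B=1]) auto
  then show ?thesis by (simp add: prob_space)
qed

lemma measurable_ip_pair:
  assumes "\<And>j. j < d \<Longrightarrow> (\<lambda>t. e t j) \<in> borel_measurable N" "\<And>j. j < d \<Longrightarrow> (\<lambda>x. w x j) \<in> borel_measurable A"
  shows "(\<lambda>z. ip d (e (snd z)) (w (fst z))) \<in> borel_measurable (A \<Otimes>\<^sub>M N)"
  unfolding ip_def
  by (intro borel_measurable_sum borel_measurable_times measurable_compose[OF measurable_snd assms(1)]
      measurable_compose[OF measurable_fst assms(2)]) auto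

lemma measurable_charf:
  assumes "prob_space D" "sets D = sets (lebK d)"
    and "\<And>j. j < d \<Longrightarrow> (\<lambda>t. e t j) \<in> borel_measurable N"
  shows "(\<lambda>t. charf d D (e t)) \<in> borel_measurable N"
proof -
  interpret prob_space D by fact
  have "(\<lambda>z. ip d (e (fst z)) (snd z)) \<in> borel_measurable (N \<Otimes>\<^sub>M D)"
    unfolding ip_def
    using measurable_lebK_component measurable_cong_sets[OF assms(2) refl]
    by (intro borel_measurable_sum borel_measurable_times measurable_compose[OF measurable_fst assms(3)]
        measurable_compose[OF measurable_snd]) blast+
  then have "(\<lambda>(t, y). cis (ip d (e t) y)) \<in> borel_measurable (N \<Otimes>\<^sub>M D)"
    unfolding split_beta by measurable
  then show ?thesis unfolding charf_def by (rule borel_measurable_lebesgue_integral)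
qed

text \<open>\<open>\<phi>\<close> stands for the characteristic function of the centre plus the
  noise; the independence of the noise coordinates enters as \<open>\<phi>_mult\<close>.\<close>

locale deconvolution_sample = sphere_law \<mu> d S for \<mu> :: "'u measure" and d S +
  fixes M :: "'a measure" and W :: "nat \<Rightarrow> 'a \<Rightarrow> nat \<Rightarrow> real" and D :: "(nat \<Rightarrow> real) measure"
    and \<phi> :: "(nat \<Rightarrow> real) \<Rightarrow> complex" and \<nu> R0 :: real
  assumes M: "prob_space M"
    and W_indep: "prob_space.indep_vars M (\<lambda>_. lebK d) W UNIV"
    and W_distr: "\<And>l. distr M (lebK d) (W l) = D"
    and \<nu>: "\<nu> > 0" and R0: "R0 > 0"
    and charf_D: "\<And>t. charf d D t = P 0 R0 t * \<phi> t"
    and \<phi>_mult: "\<And>t. \<phi> (e1 t) * \<phi> (e2 t) = \<phi> t"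
    and \<phi>_cont: "continuous_on UNIV \<phi>" and \<phi>_meas: "\<phi> \<in> borel_measurable (lebK d)"
    and \<phi>_le: "\<And>t. cmod (\<phi> t) \<le> 1" and \<phi>_0: "\<phi> (restrict (\<lambda>_. 0) {..<d}) \<noteq> 0"
begin

sublocale M: prob_space M by (rule M)

lemma W_meas [measurable]: "W l \<in> M \<rightarrow>\<^sub>M lebK d"
  using W_indep unfolding M.indep_vars_def2 by simp

lemma sets_D: "sets D = sets (lebK d)" using W_distr[of 0] by auto

sublocale D: prob_space D
  using M.prob_space_distr[OF W_meas[of 0]] W_distr[of 0] by simp

abbreviation \<tau> where "\<tau> \<equiv> boxm d \<nu>"

text \<open>Dominates \<open>(2 * l1 t) ^ m\<close> on the box for every \<open>m\<close> up to 2: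
  the added 1 makes the base at least 1, so the second power is the largest.\<close>

definition bd :: real where "bd = (1 + 2 * (real d * \<nu>))\<^sup>2"

sublocale least_squares_contrast \<tau> P Q bd
proof (rule least_squares_contrast.intro[OF finite_measure_boxm], unfold_locales)
  have l: "l1 t \<le> real d * \<nu>" if "t \<in> space \<tau>" for t
    using that by (intro l1_less) (auto simp: space_boxm box_nu_def)
  have b: "(2 * l1 t) ^ m \<le> bd" if "t \<in> space \<tau>" "m \<le> 2" for t m
  proof -
    have "(2 * l1 t) ^ m \<le> (1 + 2 * (real d * \<nu>)) ^ m"
      using l[OF that(1)] by (intro power_mono) auto
    also have "\<dots> \<le> (1 + 2 * (real d * \<nu>)) ^ 2"
      using that(2) \<nu> by (intro power_increasing) auto
    finally show ?thesis by (simp add: bd_def)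
  qed
  show "P m R \<in> borel_measurable \<tau>" "Q m R \<in> borel_measurable \<tau>" for m R
    by (auto intro: measurable_boxm)
  show "((\<lambda>R. P m R t) has_vector_derivative P (Suc m) R t) (at R)" for m R t by (rule P_deriv)
  show "m \<le> 2 \<Longrightarrow> ((\<lambda>R. Q m R t) has_vector_derivative Q (Suc m) R t) (at R)" for m R t by (rule Q_deriv)
  show "cmod (P m R t) \<le> bd" if "t \<in> space \<tau>" "m \<le> 2" for m R t
  proof -
    have "l1 t ^ m \<le> (2 * l1 t) ^ m" by (intro power_mono) auto
    then show ?thesis using P_bound[of m R t] b[OF that] by linarith
  qed
  show "cmod (Q m R t) \<le> bd" if "t \<in> space \<tau>" "m \<le> 2" for m R t
    using Q_bound[of m R t] b[OF that] by linarith
qed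

definition p :: "(nat \<Rightarrow> real) \<Rightarrow> complex" where "p t = charf d D t"

definition emp :: "nat \<Rightarrow> 'a \<Rightarrow> (nat \<Rightarrow> real) \<Rightarrow> complex" where "emp n \<omega> = psin d W n \<omega>"

text \<open>Lets the joint frequency and its two blocks be handled by the same lemmas.\<close>

definition meas_map :: "((nat \<Rightarrow> real) \<Rightarrow> nat \<Rightarrow> real) \<Rightarrow> bool" where
  "meas_map e \<longleftrightarrow> (\<forall>j<d. (\<lambda>t. e t j) \<in> borel_measurable \<tau>)"

lemma meas_map: "meas_map (\<lambda>t. t)" "meas_map e1" "meas_map e2"
proof -
  show *: "meas_map (\<lambda>t. t)"
    using measurable_boxm[OF measurable_lebK_component] by (simp add: meas_map_def)
  have "(\<lambda>t. e1 t j) \<in> borel_measurable \<tau>" "(\<lambda>t. e2 t j) \<in> borel_measurable \<tau>" if "j < d" for j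
    using * that by (cases "j = 0"; simp add: meas_map_def e1_def e2_def)+
  then show "meas_map e1" "meas_map e2" by (simp_all add: meas_map_def)
qed

lemma W_coord [measurable (raw)]: "j < d \<Longrightarrow> (\<lambda>\<omega>. W l \<omega> j) \<in> borel_measurable M"
  using measurable_compose[OF W_meas measurable_lebK_component] .

lemma D_coord [measurable (raw)]: "j < d \<Longrightarrow> (\<lambda>y. y j) \<in> borel_measurable D"
  using measurable_lebK_component measurable_cong_sets[OF sets_D refl] by blast

lemma ip_D [measurable]: "ip d t \<in> borel_measurable D"
  using measurable_ip[of d t] measurable_cong_sets[OF sets_D refl] by blast

lemma psin_norm_le: "cmod (psin d X n \<omega> t) \<le> 1"
proof -
  have "cmod (\<Sum>l<n. cis (ip d t (X l \<omega>))) \<le> real n"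
    using sum_norm_le[of "{..<n}" "\<lambda>l. cis (ip d t (X l \<omega>))" "\<lambda>_. 1"] by simp
  then show ?thesis
    by (cases "n = 0") (auto simp: psin_def norm_mult norm_divide divide_le_eq)
qed

lemma emp_admissible:
  assumes "meas_map e"
  shows "admissible (\<lambda>t. emp n \<omega> (e t))"
proof -
  have [measurable]: "(\<lambda>t. ip d (e t) x) \<in> borel_measurable \<tau>" for x
    unfolding ip_def using assms by (intro borel_measurable_sum borel_measurable_times) (auto simp: meas_map_def)
  show ?thesis
    unfolding admissible_def emp_def using psin_norm_le by (auto simp: psin_def)
qed

lemma p_admissible:
  assumes "meas_map e"
  shows "admissible (\<lambda>t. p (e t))"
  unfolding admissible_def p_def
  using measurable_charf[OF D.prob_space_axioms sets_D, of e \<tau>] assms[unfolded meas_map_def] cmod_charf_le[OF D.prob_space_axioms sets_D] by auto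

lemmas adm = emp_admissible[OF meas_map(1)] emp_admissible[OF meas_map(2)] emp_admissible[OF meas_map(3)]
  p_admissible[OF meas_map(1)] p_admissible[OF meas_map(2)] p_admissible[OF meas_map(3)]

lemma emp_meas_pair:
  assumes "meas_map e"
  shows "(\<lambda>z. emp n (fst z) (e (snd z))) \<in> borel_measurable (M \<Otimes>\<^sub>M \<tau>)"
proof -
  have [measurable]: "(\<lambda>z. ip d (e (snd z)) (W l (fst z))) \<in> borel_measurable (M \<Otimes>\<^sub>M \<tau>)" for l
    using assms W_coord unfolding meas_map_def by (intro measurable_ip_pair) auto
  show ?thesis unfolding emp_def psin_def by measurable
qed

text \<open>Real and imaginary parts are centred averages, so the mean square is a variance divided
  by \<open>n\<close>. The 4 appears because two points of the unit disc are at most 2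
  apart.\<close>

lemma emp_mean_square:
  assumes "n \<ge> 1"
  shows "(\<integral>\<omega>. (cmod (emp n \<omega> t - p t))\<^sup>2 \<partial>M) \<le> 4 / real n"
proof -
  define g1 where "g1 y = cos (ip d t y) - Re (p t)" for y
  define g2 where "g2 y = sin (ip d t y) - Im (p t)" for y
  have gm: "g1 \<in> borel_measurable (lebK d)" "g2 \<in> borel_measurable (lebK d)"
    unfolding g1_def g2_def by measurable
  have ci: "integrable D (\<lambda>y. cis (ip d t y))" by (rule D.integrable_const_bound[where B=1]) auto
  have pt: "(\<integral>y. cis (ip d t y) \<partial>D) = p t" by (simp add: p_def charf_def)
  have "(\<integral>y. cos (ip d t y) \<partial>D) = Re (p t)" "(\<integral>y. sin (ip d t y) \<partial>D) = Im (p t)"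
    using integral_Re[OF ci] integral_Im[OF ci] unfolding pt by simp_all
  moreover have i1: "integrable D (\<lambda>y. cos (ip d t y))" "integrable D (\<lambda>y. sin (ip d t y))"
    using integrable_Re[OF ci] integrable_Im[OF ci] by simp_all
  ultimately have mean: "(\<integral>y. g1 y \<partial>D) = 0" "(\<integral>y. g2 y \<partial>D) = 0"
    unfolding g1_def g2_def by (simp_all add: D.prob_space)
  have "cmod (p t) \<le> 1" unfolding p_def by (rule cmod_charf_le[OF D.prob_space_axioms sets_D])
  have g4: "(g1 y)\<^sup>2 + (g2 y)\<^sup>2 \<le> 4" for y
  proof -
    have "(g1 y)\<^sup>2 + (g2 y)\<^sup>2 = (cmod (cis (ip d t y) - p t))\<^sup>2"
      by (simp add: cmod_power2 g1_def g2_def)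
    also have "\<dots> \<le> 2\<^sup>2"
      using norm_triangle_ineq4[of "cis (ip d t y)" "p t"] \<open>cmod (p t) \<le> 1\<close> by (intro power_mono) auto
    finally show ?thesis by simp
  qed
  have gD [measurable]: "g1 \<in> borel_measurable D" "g2 \<in> borel_measurable D"
    unfolding g1_def g2_def by measurable
  have gle: "(g1 y)\<^sup>2 \<le> 4" "(g2 y)\<^sup>2 \<le> 4" for y
    using g4[of y] by (smt (verit) zero_le_power2)+
  have gi: "integrable D (\<lambda>y. (g1 y)\<^sup>2)" "integrable D (\<lambda>y. (g2 y)\<^sup>2)"
    using gle by (auto intro!: D.integrable_const_bound[where B=4])
  note s1 = iid_sum_second_moment[OF M W_indep W_distr gm(1) gi(1) mean(1)]
  note s2 = iid_sum_second_moment[OF M W_indep W_distr gm(2) gi(2) mean(2)]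
  have n0: "real n > 0" using assms by simp
  have "(cmod (emp n \<omega> t - p t))\<^sup>2 = ((\<Sum>l<n. g1 (W l \<omega>))\<^sup>2 + (\<Sum>l<n. g2 (W l \<omega>))\<^sup>2) / (real n)\<^sup>2" for \<omega>
  proof -
    have "Re (emp n \<omega> t - p t) = (\<Sum>l<n. g1 (W l \<omega>)) / real n"
      using n0 by (simp add: emp_def psin_def g1_def sum_subtractf diff_divide_distrib Re_divide_of_real)
    moreover have "Im (emp n \<omega> t - p t) = (\<Sum>l<n. g2 (W l \<omega>)) / real n"
      using n0 by (simp add: emp_def psin_def g2_def sum_subtractf diff_divide_distrib Im_divide_of_real)
    ultimately show ?thesis by (simp only: cmod_power2 power_divide add_divide_distrib)
  qed
  then have "(\<integral>\<omega>. (cmod (emp n \<omega> t - p t))\<^sup>2 \<partial>M) =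
     (real n * (\<integral>y. (g1 y)\<^sup>2 \<partial>D) + real n * (\<integral>y. (g2 y)\<^sup>2 \<partial>D)) / (real n)\<^sup>2"
    using s1 s2 by simp
  also have "\<dots> = (\<integral>y. (g1 y)\<^sup>2 + (g2 y)\<^sup>2 \<partial>D) / real n"
    using gi n0 by (simp add: power2_eq_square field_simps)
  also have "(\<integral>y. (g1 y)\<^sup>2 + (g2 y)\<^sup>2 \<partial>D) \<le> (\<integral>y. 4 \<partial>D)"
    using gi g4 by (intro integral_mono) auto
  finally show ?thesis using n0 by (simp add: D.prob_space divide_right_mono)
qed

text \<open>Fubini's theorem exchanges sampling and frequency, and the rate at a fixed frequency is
  integrated over the box.\<close>

lemma sqdist_emp:
  assumes e: "meas_map e"
  shows "integrable M (\<lambda>\<omega>. sqdist (\<lambda>t. emp n \<omega> (e t)) (\<lambda>t. p (e t)))"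
    and "n \<ge> 1 \<Longrightarrow> (\<integral>\<omega>. sqdist (\<lambda>t. emp n \<omega> (e t)) (\<lambda>t. p (e t)) \<partial>M) \<le> 4 * measure \<tau> (space \<tau>) / real n"
proof -
  have pm: "(\<lambda>t. p (e t)) \<in> borel_measurable \<tau>"
    using p_admissible[OF e] by (simp add: admissible_def)
  note [measurable] = emp_meas_pair[OF e, of n] measurable_compose[OF measurable_snd pm]
  have jm: "(\<lambda>(\<omega>, t). (cmod (emp n \<omega> (e t) - p (e t)))\<^sup>2) \<in> borel_measurable (M \<Otimes>\<^sub>M \<tau>)"
    unfolding split_beta by measurable
  have le: "\<bar>(cmod (emp n \<omega> (e t) - p (e t)))\<^sup>2\<bar> \<le> 4" for \<omega> t
  proof -
    have "cmod (emp n \<omega> (e t) - p (e t)) \<le> 2"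
      using norm_triangle_ineq4[of "emp n \<omega> (e t)" "p (e t)"] psin_norm_le[of W n \<omega> "e t"]
        cmod_charf_le[OF D.prob_space_axioms sets_D, of "e t"] by (simp add: emp_def p_def)
    then have "(cmod (emp n \<omega> (e t) - p (e t)))\<^sup>2 \<le> 2\<^sup>2" by (intro power_mono) auto
    then show ?thesis by simp
  qed
  note F = finite_Fubini[OF M.finite_measure_axioms finite_measure_boxm jm, of 4, OF le]
  show "integrable M (\<lambda>\<omega>. sqdist (\<lambda>t. emp n \<omega> (e t)) (\<lambda>t. p (e t)))"
    unfolding sqdist_def by (rule F(1))
  assume n: "n \<ge> 1"
  have "(\<integral>\<omega>. sqdist (\<lambda>t. emp n \<omega> (e t)) (\<lambda>t. p (e t)) \<partial>M) = (\<integral>t. (\<integral>\<omega>. (cmod (emp n \<omega> (e t) - p (e t)))\<^sup>2 \<partial>M) \<partial>\<tau>)"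
    unfolding sqdist_def by (rule F(2))
  also have "\<dots> \<le> (\<integral>t. 4 / real n \<partial>\<tau>)"
  proof (rule integral_mono)
    have jm': "(\<lambda>(t, \<omega>). (cmod (emp n \<omega> (e t) - p (e t)))\<^sup>2) \<in> borel_measurable (\<tau> \<Otimes>\<^sub>M M)"
      using measurable_compose[OF measurable_pair_swap' jm] by (simp add: split_beta)
    show "integrable \<tau> (\<lambda>t. \<integral>\<omega>. (cmod (emp n \<omega> (e t) - p (e t)))\<^sup>2 \<partial>M)"
      using finite_Fubini(1)[OF finite_measure_boxm M.finite_measure_axioms jm', of 4, OF le] .
    show "(\<integral>\<omega>. (cmod (emp n \<omega> (e t) - p (e t)))\<^sup>2 \<partial>M) \<le> 4 / real n" for t
      by (rule emp_mean_square[OF n])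
  qed simp
  finally show "(\<integral>\<omega>. sqdist (\<lambda>t. emp n \<omega> (e t)) (\<lambda>t. p (e t)) \<partial>M) \<le> 4 * measure \<tau> (space \<tau>) / real n"
    by (simp add: mult.commute)
qed

text \<open>The error bounds are all expressed through this one random variable, whose mean is of
  order 1/n.\<close>

definition Vn :: "nat \<Rightarrow> 'a \<Rightarrow> real" where
  "Vn n \<omega> = sqdist (emp n \<omega>) p + sqdist (\<lambda>t. emp n \<omega> (e1 t)) (\<lambda>t. p (e1 t)) + sqdist (\<lambda>t. emp n \<omega> (e2 t)) (\<lambda>t. p (e2 t))"

lemma Vn: "integrable M (Vn n)" "n \<ge> 1 \<Longrightarrow> (\<integral>\<omega>. Vn n \<omega> \<partial>M) \<le> 12 * measure \<tau> (space \<tau>) / real n" "0 \<le> Vn n \<omega>"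
proof -
  note s = sqdist_emp[OF meas_map(1)] sqdist_emp[OF meas_map(2)] sqdist_emp[OF meas_map(3)]
  show "integrable M (Vn n)" unfolding Vn_def using s(1,3,5) by auto
  show "0 \<le> Vn n \<omega>" unfolding Vn_def by (simp add: sqdist_nonneg)
  assume n: "n \<ge> 1"
  have "(\<integral>\<omega>. Vn n \<omega> \<partial>M) = (\<integral>\<omega>. sqdist (emp n \<omega>) p \<partial>M) + (\<integral>\<omega>. sqdist (\<lambda>t. emp n \<omega> (e1 t)) (\<lambda>t. p (e1 t)) \<partial>M)
     + (\<integral>\<omega>. sqdist (\<lambda>t. emp n \<omega> (e2 t)) (\<lambda>t. p (e2 t)) \<partial>M)"
    unfolding Vn_def using s(1,3,5) by simp
  then show "(\<integral>\<omega>. Vn n \<omega> \<partial>M) \<le> 12 * measure \<tau> (space \<tau>) / real n"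
    using s(2)[OF n] s(4)[OF n] s(6)[OF n] by simp
qed

definition q :: "(nat \<Rightarrow> real) \<Rightarrow> complex" where "q t = p (e1 t) * p (e2 t)"

definition qn :: "nat \<Rightarrow> 'a \<Rightarrow> (nat \<Rightarrow> real) \<Rightarrow> complex" where "qn n \<omega> t = emp n \<omega> (e1 t) * emp n \<omega> (e2 t)"

lemma p_eq: "p t = P 0 R0 t * \<phi> t" by (simp add: p_def charf_D)

lemma q_eq: "q t = Q 0 R0 t * \<phi> t"
  by (simp add: q_def p_eq Q_0 algebra_simps flip: \<phi>_mult[of t])

lemma q_adm: "admissible q" "admissible (qn n \<omega>)"
  using admissible_mult[OF adm(5,6)] admissible_mult[OF adm(2,3)] by (simp_all add: q_def[abs_def] qn_def[abs_def])

lemma emp_adm: "admissible p" "admissible (emp n \<omega>)"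
  using adm(1,4) by simp_all

text \<open>The true joint characteristic function and the product of its marginals share the factor
  \<open>\<phi>\<close>, which therefore comes out of the residual.\<close>

lemma T_eq: "T m q p R t = (P m R t * Q 0 R0 t - Q m R t * P 0 R0 t) * \<phi> t"
  by (simp add: T_def p_eq q_eq algebra_simps)

lemma T_0_R0: "T 0 q p R0 t = 0"
  by (simp add: T_eq)

lemma J_pos: "R > 0 \<Longrightarrow> R \<noteq> R0 \<Longrightarrow> J q p R > 0"
proof -
  assume "R > 0" "R \<noteq> R0"
  then have "J q p R \<noteq> 0"
    unfolding J_def T_eq by (intro contrast_identifies R0 \<phi>_cont \<phi>_meas \<phi>_le \<phi>_0 \<nu>)
  moreover have "0 \<le> J q p R" by (simp add: J_def)
  ultimately show ?thesis by simp
qed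

lemma J_R0: "J q p R0 = 0" by (rule J_zero(1)) (rule T_0_R0)

lemma J2_pos: "J2 q p R0 > 0"
proof -
  have "(\<integral>t. (cmod (T 1 q p R0 t))\<^sup>2 \<partial>\<tau>) \<noteq> 0"
    unfolding T_eq by (intro contrast_nondegenerate R0 \<phi>_cont \<phi>_meas \<phi>_le \<phi>_0 \<nu>)
  moreover have "0 \<le> (\<integral>t. (cmod (T 1 q p R0 t))\<^sup>2 \<partial>\<tau>)" by simp
  ultimately show ?thesis using J_zero(2)[of q p R0, OF T_0_R0] by linarith
qed

text \<open>The bound of \<open>product_contrast_diff\<close> at \<open>s = sqrt n\<close>, where
  both summands are of order \<open>1 / sqrt n\<close> in mean.\<close>

definition \<kappa> :: "nat \<Rightarrow> 'a \<Rightarrow> real" where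
  "\<kappa> n \<omega> = 16 * bd\<^sup>2 * (sqrt (real n) * Vn n \<omega> + 3 * measure \<tau> (space \<tau>) / sqrt (real n))"

lemma contrast_close:
  assumes "n \<ge> 1"
  shows "\<bar>J (qn n \<omega>) (emp n \<omega>) R - J q p R\<bar> \<le> \<kappa> n \<omega>" "\<bar>J2 (qn n \<omega>) (emp n \<omega>) R - J2 q p R\<bar> \<le> \<kappa> n \<omega>"
proof -
  have "(\<integral>t. cmod (qn n \<omega> t - q t) + cmod (emp n \<omega> t - p t) \<partial>\<tau>) \<le>
      sqrt (real n) * Vn n \<omega> + 3 * measure \<tau> (space \<tau>) / sqrt (real n)"
    using product_contrast_diff[OF adm(4,5,6) adm(1,2,3), of "sqrt (real n)"] assms
    by (simp add: qn_def q_def Vn_def)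
  then have "16 * bd\<^sup>2 * (\<integral>t. cmod (qn n \<omega> t - q t) + cmod (emp n \<omega> t - p t) \<partial>\<tau>) \<le> \<kappa> n \<omega>"
    unfolding \<kappa>_def by (intro mult_left_mono) auto
  then show "\<bar>J (qn n \<omega>) (emp n \<omega>) R - J q p R\<bar> \<le> \<kappa> n \<omega>" "\<bar>J2 (qn n \<omega>) (emp n \<omega>) R - J2 q p R\<bar> \<le> \<kappa> n \<omega>"
    using J_diff[OF q_adm(2) emp_adm(2) q_adm(1) emp_adm(1), of n \<omega> n \<omega> R] by (auto intro: order.trans)
qed

lemma \<kappa>_integrable: "integrable M (\<kappa> n)"
  unfolding \<kappa>_def using Vn(1)[of n] by auto

lemma sqrt_Vn_tendsto: "(\<lambda>n. \<integral>\<omega>. sqrt (real n) * Vn n \<omega> \<partial>M) \<longlonglongrightarrow> 0"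
proof (rule Lim_null_comparison)
  have "(\<lambda>n. 12 * measure \<tau> (space \<tau>) / sqrt (real n)) \<longlonglongrightarrow> 0"
    by (intro tendsto_divide_0[OF tendsto_const] filterlim_at_top_imp_at_infinity
        filterlim_compose[OF sqrt_at_top filterlim_real_sequentially])
  then show "(\<lambda>n. 12 * measure \<tau> (space \<tau>) / sqrt (real n)) \<longlonglongrightarrow> 0" .
  show "\<forall>\<^sub>F n in sequentially. norm (\<integral>\<omega>. sqrt (real n) * Vn n \<omega> \<partial>M) \<le> 12 * measure \<tau> (space \<tau>) / sqrt (real n)"
    using eventually_ge_at_top[of 1]
  proof eventually_elim
    case (elim n)
    have "sqrt (real n) * (\<integral>\<omega>. Vn n \<omega> \<partial>M) \<le> sqrt (real n) * (12 * measure \<tau> (space \<tau>) / real n)"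
      using Vn(2)[OF elim] by (intro mult_left_mono) auto
    also have "\<dots> = 12 * measure \<tau> (space \<tau>) / sqrt (real n)"
      using elim by (simp add: field_simps flip: real_sqrt_mult)
    finally show ?case using Vn(3) by (simp add: abs_mult)
  qed
qed

lemma \<kappa>_tendsto: "(\<lambda>n. \<integral>\<omega>. \<kappa> n \<omega> \<partial>M) \<longlonglongrightarrow> 0"
proof -
  have "(\<lambda>n. 3 * measure \<tau> (space \<tau>) / sqrt (real n)) \<longlonglongrightarrow> 0"
    by (intro tendsto_divide_0[OF tendsto_const] filterlim_at_top_imp_at_infinity
        filterlim_compose[OF sqrt_at_top filterlim_real_sequentially])
  from tendsto_mult_left[OF tendsto_add[OF sqrt_Vn_tendsto this], of "16 * bd\<^sup>2"]
  show ?thesis unfolding \<kappa>_def using Vn(1) by (simp add: M.prob_space)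
qed

text \<open>The integrand over frequencies of the influence function \<open>infl\<close>, that is,
  of the contribution of a single observation \<open>y\<close> to the linearized derivative of the
  criterion at \<open>R0\<close>.\<close>

definition kern :: "(nat \<Rightarrow> real) \<Rightarrow> (nat \<Rightarrow> real) \<Rightarrow> real" where
  "kern y t = 2 * Re (cnj (lin (\<lambda>t. p (e1 t)) (\<lambda>t. p (e2 t)) R0
      (cis (ip d t y) - p t) (cis (ip d (e1 t) y) - p (e1 t)) (cis (ip d (e2 t) y) - p (e2 t)) t) * T 1 q p R0 t)"

definition infl :: "(nat \<Rightarrow> real) \<Rightarrow> real" where "infl y = (\<integral>t. kern y t \<partial>\<tau>)"

lemma kern_meas: "(\<lambda>(y, t). kern y t) \<in> borel_measurable (lebK d \<Otimes>\<^sub>M \<tau>)"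
proof -
  have [measurable]: "(\<lambda>z. ip d (snd z) (fst z)) \<in> borel_measurable (lebK d \<Otimes>\<^sub>M \<tau>)"
    "(\<lambda>z. ip d (e1 (snd z)) (fst z)) \<in> borel_measurable (lebK d \<Otimes>\<^sub>M \<tau>)"
    "(\<lambda>z. ip d (e2 (snd z)) (fst z)) \<in> borel_measurable (lebK d \<Otimes>\<^sub>M \<tau>)"
    using measurable_ip_pair[of d "\<lambda>t. t" \<tau> "\<lambda>y. y" "lebK d"] measurable_ip_pair[of d e1 \<tau> "\<lambda>y. y" "lebK d"]
      measurable_ip_pair[of d e2 \<tau> "\<lambda>y. y" "lebK d"] meas_map[unfolded meas_map_def] measurable_lebK_component by blast+
  have [measurable]: "p \<in> borel_measurable \<tau>" "(\<lambda>t. p (e1 t)) \<in> borel_measurable \<tau>" "(\<lambda>t. p (e2 t)) \<in> borel_measurable \<tau>"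
    "T 1 q p R0 \<in> borel_measurable \<tau>"
    using adm(4-6) T_meas[OF q_adm(1) emp_adm(1)] by (auto simp: admissible_def)
  show ?thesis unfolding kern_def lin_def split_beta by measurable
qed

lemma kern_bound:
  assumes "t \<in> space \<tau>"
  shows "\<bar>kern y t\<bar> \<le> 2 * (6 * bd * (6 * bd))"
proof -
  have p1: "cmod (p t) \<le> 1" for t
    unfolding p_def by (rule cmod_charf_le[OF D.prob_space_axioms sets_D])
  have x: "cmod (cis s - p t) \<le> 2" for s t
    using norm_triangle_ineq4[of "cis s" "p t"] p1[of t] by simp
  have b0: "0 \<le> bd" by (simp add: bd_def)
  have "cmod (lin (\<lambda>t. p (e1 t)) (\<lambda>t. p (e2 t)) R0
      (cis (ip d t y) - p t) (cis (ip d (e1 t) y) - p (e1 t)) (cis (ip d (e2 t) y) - p (e2 t)) t) \<le> 6 * bd"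
    using lin_bound[OF adm(5,6) assms, of R0 "cis (ip d t y) - p t" "cis (ip d (e1 t) y) - p (e1 t)" "cis (ip d (e2 t) y) - p (e2 t)"]
      mult_left_mono[OF add_mono[OF add_mono[OF x x] x] b0, of "ip d t y" t "ip d (e1 t) y" "e1 t" "ip d (e2 t) y" "e2 t"]
    by simp
  moreover have "cmod (T 1 q p R0 t) \<le> 6 * bd"
    using T_bound[OF q_adm(1) emp_adm(1) assms, of 1 R0] b0 by simp
  ultimately have "\<bar>Re (cnj (lin (\<lambda>t. p (e1 t)) (\<lambda>t. p (e2 t)) R0
      (cis (ip d t y) - p t) (cis (ip d (e1 t) y) - p (e1 t)) (cis (ip d (e2 t) y) - p (e2 t)) t) * T 1 q p R0 t)\<bar> \<le> 6 * bd * (6 * bd)"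
    by (rule Re_cnj_mult_le)
  then show ?thesis unfolding kern_def abs_mult by (simp del: times_complex.sel)
qed

lemma kern_meas_t: "y \<in> space (lebK d) \<Longrightarrow> kern y \<in> borel_measurable \<tau>"
  using measurable_Pair2[OF kern_meas] by simp

lemma kern_cong: "kern (restrict y {..<d}) t = kern y t"
  by (simp add: kern_def)

lemma kern_integrable: "integrable \<tau> (kern y)"
proof -
  have "kern (restrict y {..<d}) \<in> borel_measurable \<tau>"
    by (rule kern_meas_t) (simp add: lebK_def space_PiM)
  then have "kern y \<in> borel_measurable \<tau>" unfolding kern_cong .
  then show ?thesis using kern_bound by (intro integrable_const_bound[where B="2 * (6 * bd * (6 * bd))"]) auto
qed

lemma infl_meas [measurable]: "infl \<in> borel_measurable (lebK d)"
proof -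
  have "(\<lambda>y. \<integral>t. kern y t \<partial>\<tau>) \<in> borel_measurable (lebK d)"
    using kern_meas by (rule borel_measurable_lebesgue_integral)
  then show ?thesis by (simp add: infl_def[abs_def])
qed

lemma infl_bound: "\<bar>infl y\<bar> \<le> 2 * (6 * bd * (6 * bd)) * measure \<tau> (space \<tau>)"
proof -
  have "\<bar>infl y\<bar> \<le> (\<integral>t. 2 * (6 * bd * (6 * bd)) \<partial>\<tau>)"
    unfolding infl_def using kern_integrable[of y] kern_bound
    by (intro order.trans[OF integral_abs_bound] integral_mono) auto
  moreover have "(\<integral>t. c \<partial>\<tau>) = c * measure \<tau> (space \<tau>)" for c :: real
    by (simp add: mult.commute)
  ultimately show ?thesis by (simp only:)
qed

text \<open>Fubini's theorem reduces this to a fixed frequency, where \<open>lin\<close> is linear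
  in deviations that are centred under \<open>D\<close>.\<close>

lemma infl_mean: "(\<integral>y. infl y \<partial>D) = 0"
proof -
  have jm: "(\<lambda>(y, t). kern y t) \<in> borel_measurable (D \<Otimes>\<^sub>M \<tau>)"
    using kern_meas measurable_cong_sets[OF sets_pair_measure_cong[OF sets_D refl] refl] by blast
  have "(\<integral>y. infl y \<partial>D) = (\<integral>t. (\<integral>y. kern y t \<partial>D) \<partial>\<tau>)"
    unfolding infl_def
    by (rule finite_Fubini(2)[OF D.finite_measure_axioms finite_measure_boxm jm kern_bound])
  also have "\<dots> = (\<integral>t. 0 \<partial>\<tau>)"
  proof (rule Bochner_Integration.integral_cong)
    fix t
    have x: "integrable D (\<lambda>y. cis (ip d t y) - p t)" "(\<integral>y. cis (ip d t y) - p t \<partial>D) = 0" for t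
    proof -
      have ci: "integrable D (\<lambda>y. cis (ip d t y))" by (rule D.integrable_const_bound[where B=1]) auto
      then show "integrable D (\<lambda>y. cis (ip d t y) - p t)" by simp
      show "(\<integral>y. cis (ip d t y) - p t \<partial>D) = 0"
        using ci by (simp add: p_def charf_def D.prob_space)
    qed
    let ?L = "\<lambda>y. lin (\<lambda>t. p (e1 t)) (\<lambda>t. p (e2 t)) R0
      (cis (ip d t y) - p t) (cis (ip d (e1 t) y) - p (e1 t)) (cis (ip d (e2 t) y) - p (e2 t)) t"
    have L: "integrable D ?L"
      unfolding lin_def
      by (intro Bochner_Integration.integrable_diff Bochner_Integration.integrable_add integrable_mult_right x)
    have "(\<integral>y. ?L y \<partial>D) = P 0 R0 t * (p (e2 t) * (\<integral>y. cis (ip d (e1 t) y) - p (e1 t) \<partial>D)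
       + p (e1 t) * (\<integral>y. cis (ip d (e2 t) y) - p (e2 t) \<partial>D)) - Q 0 R0 t * (\<integral>y. cis (ip d t y) - p t \<partial>D)"
      unfolding lin_def
      by (simp only: Bochner_Integration.integral_diff Bochner_Integration.integral_add integral_mult_right_zero
          Bochner_Integration.integrable_diff Bochner_Integration.integrable_add integrable_mult_right x)
    then have L0: "(\<integral>y. ?L y \<partial>D) = 0" by (simp only: x) simp
    have "(\<integral>y. kern y t \<partial>D) = 2 * Re (\<integral>y. cnj (?L y) * T 1 q p R0 t \<partial>D)"
      unfolding kern_def using L by (subst integral_Re[symmetric]) (auto simp del: times_complex.sel)
    also have "(\<integral>y. cnj (?L y) * T 1 q p R0 t \<partial>D) = 0"
      using L0 by simp
    finally show "(\<integral>y. kern y t \<partial>D) = 0" by simp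
  qed simp
  finally show ?thesis by simp
qed

lemma lin_average:
  fixes n :: nat
  shows "lin p1 p2 R ((\<Sum>l<n. x0 l) / of_nat n) ((\<Sum>l<n. x1 l) / of_nat n) ((\<Sum>l<n. x2 l) / of_nat n) t =
    (\<Sum>l<n. lin p1 p2 R (x0 l) (x1 l) (x2 l) t) / of_nat n"
  unfolding lin_def
  by (simp add: sum_subtractf sum.distrib sum_distrib_left diff_divide_distrib add_divide_distrib distrib_left)

text \<open>\<open>J1_linearization\<close> applied to the empirical triple: averages over
  observations pass through \<open>lin\<close>, so the linear term is an average of
  \<open>infl\<close>.\<close>

lemma J1_expansion:
  assumes n: "n \<ge> 1"
  shows "\<bar>sqrt (real n) * J1 (qn n \<omega>) (emp n \<omega>) R0 - (\<Sum>l<n. infl (W l \<omega>)) / sqrt (real n)\<bar> \<le> 12 * bd\<^sup>2 * (sqrt (real n) * Vn n \<omega>)"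
proof -
  have n0: "real n > 0" using n by simp
  have emp: "emp n \<omega> t - p t = (\<Sum>l<n. (cis (ip d t (W l \<omega>)) - p t)) / of_nat n" for t
    using n0 by (simp add: emp_def psin_def sum_subtractf diff_divide_distrib)
  have lin: "2 * Re (cnj (lin (\<lambda>t. p (e1 t)) (\<lambda>t. p (e2 t)) R0 (emp n \<omega> t - p t) (emp n \<omega> (e1 t) - p (e1 t)) (emp n \<omega> (e2 t) - p (e2 t)) t)
     * T 1 q p R0 t) = (\<Sum>l<n. kern (W l \<omega>) t) / real n" for t
  proof -
    let ?l = "\<lambda>l. lin (\<lambda>t. p (e1 t)) (\<lambda>t. p (e2 t)) R0 (cis (ip d t (W l \<omega>)) - p t)
       (cis (ip d (e1 t) (W l \<omega>)) - p (e1 t)) (cis (ip d (e2 t) (W l \<omega>)) - p (e2 t)) t"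
    have "lin (\<lambda>t. p (e1 t)) (\<lambda>t. p (e2 t)) R0 (emp n \<omega> t - p t) (emp n \<omega> (e1 t) - p (e1 t)) (emp n \<omega> (e2 t) - p (e2 t)) t
       = (\<Sum>l<n. ?l l) / of_nat n"
      unfolding emp by (rule lin_average)
    then have "2 * Re (cnj (lin (\<lambda>t. p (e1 t)) (\<lambda>t. p (e2 t)) R0 (emp n \<omega> t - p t) (emp n \<omega> (e1 t) - p (e1 t)) (emp n \<omega> (e2 t) - p (e2 t)) t)
     * T 1 q p R0 t) = 2 * Re ((\<Sum>l<n. cnj (?l l) * T 1 q p R0 t) / of_nat n)"
      by (simp add: sum_distrib_right del: times_complex.sel)
    also have "\<dots> = (\<Sum>l<n. 2 * Re (cnj (?l l) * T 1 q p R0 t)) / real n"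
      by (simp add: sum_distrib_left Re_divide_of_nat del: times_complex.sel)
    finally show ?thesis unfolding kern_def .
  qed
  have "(\<integral>t. 2 * Re (cnj (lin (\<lambda>t. p (e1 t)) (\<lambda>t. p (e2 t)) R0 (emp n \<omega> t - p t) (emp n \<omega> (e1 t) - p (e1 t)) (emp n \<omega> (e2 t) - p (e2 t)) t)
     * T 1 q p R0 t) \<partial>\<tau>) = (\<Sum>l<n. infl (W l \<omega>)) / real n"
    unfolding lin infl_def using kern_integrable by (simp add: Bochner_Integration.integral_sum)
  moreover have "T 0 (\<lambda>t. p (e1 t) * p (e2 t)) p R0 t = 0" for t
    using T_0_R0[of t] by (simp add: q_def[abs_def])
  ultimately have "\<bar>J1 (qn n \<omega>) (emp n \<omega>) R0 - (\<Sum>l<n. infl (W l \<omega>)) / real n\<bar> \<le> 12 * bd\<^sup>2 * Vn n \<omega>"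
    using J1_linearization[OF adm(4,5,6) adm(1,2,3), of R0 n \<omega> n \<omega> n \<omega>]
    by (simp add: q_def[abs_def] qn_def[abs_def] Vn_def del: times_complex.sel)
  from mult_left_mono[OF this, of "sqrt (real n)"]
  have "\<bar>sqrt (real n) * (J1 (qn n \<omega>) (emp n \<omega>) R0 - (\<Sum>l<n. infl (W l \<omega>)) / real n)\<bar> \<le> sqrt (real n) * (12 * bd\<^sup>2 * Vn n \<omega>)"
    by (simp add: abs_mult)
  moreover have "sqrt (real n) * (J1 (qn n \<omega>) (emp n \<omega>) R0 - (\<Sum>l<n. infl (W l \<omega>)) / real n) =
     sqrt (real n) * J1 (qn n \<omega>) (emp n \<omega>) R0 - (\<Sum>l<n. infl (W l \<omega>)) / sqrt (real n)"
    using n0 by (simp add: right_diff_distrib real_div_sqrt field_simps flip: real_sqrt_mult)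
  ultimately show ?thesis by (simp add: algebra_simps)
qed

end

section \<open>Joint limit laws\<close>

text \<open>Carries a Gaussian limit through the linear map \<open>A\<close>: the left side is the
  form of \<open>V\<close> at the transposed image of \<open>t\<close>. It also gives the positive
  semidefiniteness of the sandwich.\<close>

lemma quad_sandwich:
  "(\<Sum>a<k. \<Sum>b<k. (\<Sum>i<k. t i * A i a) * V a b * (\<Sum>j<k. t j * A j b)) =
   (\<Sum>i<k. \<Sum>j<k. t i * sandwich k A V i j * t j)"
proof -
  define f where "f i j a b = t i * (A i a * V a b * A j b) * t j" for i j a b
  have "(\<Sum>a<k. \<Sum>b<k. (\<Sum>i<k. t i * A i a) * V a b * (\<Sum>j<k. t j * A j b)) =
     (\<Sum>a<k. \<Sum>b<k. \<Sum>i<k. \<Sum>j<k. f i j a b)"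
    by (simp add: f_def sum_distrib_left sum_distrib_right algebra_simps)
  also have "\<dots> = (\<Sum>a<k. \<Sum>i<k. \<Sum>b<k. \<Sum>j<k. f i j a b)"
    by (intro sum.cong refl sum.swap)
  also have "\<dots> = (\<Sum>i<k. \<Sum>a<k. \<Sum>b<k. \<Sum>j<k. f i j a b)" by (rule sum.swap)
  also have "\<dots> = (\<Sum>i<k. \<Sum>a<k. \<Sum>j<k. \<Sum>b<k. f i j a b)"
    by (intro sum.cong refl sum.swap)
  also have "\<dots> = (\<Sum>i<k. \<Sum>j<k. \<Sum>a<k. \<Sum>b<k. f i j a b)"
    by (intro sum.cong refl sum.swap)
  also have "\<dots> = (\<Sum>i<k. \<Sum>j<k. t i * sandwich k A V i j * t j)"
    by (simp add: f_def sandwich_def sum_distrib_left sum_distrib_right)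
  finally show ?thesis .
qed

lemma sandwich_sym:
  assumes "\<And>a b. a < k \<Longrightarrow> b < k \<Longrightarrow> V a b = V b a"
  shows "sandwich k A V i j = sandwich k A V j i"
proof -
  have "sandwich k A V i j = (\<Sum>b<k. \<Sum>a<k. A i a * V a b * A j b)"
    unfolding sandwich_def by (rule sum.swap)
  also have "\<dots> = sandwich k A V j i"
    unfolding sandwich_def by (intro sum.cong refl) (simp add: assms mult.commute mult.left_commute)
  finally show ?thesis .
qed

lemma ip_linear: "ip k t (\<lambda>j. \<Sum>a<k. A j a * x a) = ip k (\<lambda>a. \<Sum>j<k. t j * A j a) x"
proof -
  have "ip k t (\<lambda>j. \<Sum>a<k. A j a * x a) = (\<Sum>j<k. \<Sum>a<k. t j * A j a * x a)"
    by (simp add: ip_def sum_distrib_left mult.assoc)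
  also have "\<dots> = (\<Sum>a<k. \<Sum>j<k. t j * A j a * x a)" by (rule sum.swap)
  finally show ?thesis by (simp add: ip_def sum_distrib_right)
qed

lemma Amat_apply:
  assumes "i < d + 1"
  shows "(\<Sum>a<d + 1. Amat d ES m i a * x a) =
    (if i = 0 then - x d / m else x (i - 1) + ES (i - 1) / m * x d)"
proof (cases "i = 0")
  case True
  have "Amat d ES m i a * x a = 0" if "a < d" for a using that True by (simp add: Amat_def)
  then show ?thesis using True by (simp add: Amat_def)
next
  case False
  have "Amat d ES m i a * x a = (if a = i - 1 then x a else 0)" if "a < d" for a
    using that False by (simp add: Amat_def)
  then have "(\<Sum>a<d. Amat d ES m i a * x a) = x (i - 1)"
    using assms False by simp
  then show ?thesis using False by (simp add: Amat_def)
qed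

lemma min_1_abs_add: "min 1 \<bar>x + y\<bar> \<le> min 1 \<bar>x\<bar> + min 1 \<bar>y\<bar>" for x y :: real
  using abs_triangle_ineq[of x y] by (auto simp: min_def)

lemma conv_distr_cong:
  assumes "conv_distr M k Z N" "\<And>n \<omega> j. \<omega> \<in> space M \<Longrightarrow> j < k \<Longrightarrow> Z n \<omega> j = Z' n \<omega> j"
  shows "conv_distr M k Z' N"
  unfolding conv_distr_def
proof (intro conjI allI impI)
  fix n
  have "restrict (Z' n \<omega>) {..<k} = restrict (Z n \<omega>) {..<k}" if "\<omega> \<in> space M" for \<omega>
    using assms(2)[OF that] by (auto simp: fun_eq_iff)
  then show "(\<lambda>\<omega>. restrict (Z' n \<omega>) {..<k}) \<in> M \<rightarrow>\<^sub>M lebK k"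
    using assms(1) unfolding conv_distr_def by (simp cong: measurable_cong)
next
  fix g assume g: "bdd_cont_test k g"
  have "(\<integral>\<omega>. g (Z' n \<omega>) \<partial>M) = (\<integral>\<omega>. g (Z n \<omega>) \<partial>M)" for n
  proof (rule Bochner_Integration.integral_cong)
    fix \<omega> assume "\<omega> \<in> space M"
    then show "g (Z' n \<omega>) = g (Z n \<omega>)"
      using g assms(2) unfolding bdd_cont_test_def by metis
  qed simp
  then show "(\<lambda>n. \<integral>\<omega>. g (Z' n \<omega>) \<partial>M) \<longlonglongrightarrow> (\<integral>x. g x \<partial>N)"
    using assms(1) g unfolding conv_distr_def by simp
qed

lemma conv_distr_gaussian:
  assumes "prob_space M" "\<And>n. (\<lambda>\<omega>. restrict (Z n \<omega>) {..<k}) \<in> M \<rightarrow>\<^sub>M lebK k" "centered_gaussian k V N"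
    and "\<And>t. (\<lambda>n. \<integral>\<omega>. cis (ip k t (Z n \<omega>)) \<partial>M) \<longlonglongrightarrow>
           of_real (exp (- (\<Sum>i<k. \<Sum>j<k. t i * V i j * t j) / 2))"
  shows "conv_distr M k Z N"
  using assms unfolding centered_gaussian_def
  by (intro conv_distr_of_char_tendsto) auto

section \<open>Joint limits of the sample mean with the score and with the estimated radius\<close>

context deconvolution_sample
begin

definition crit1 :: "nat \<Rightarrow> 'a \<Rightarrow> real" where "crit1 n \<omega> = J1 (qn n \<omega>) (emp n \<omega>) R0"

lemma crit1_integrable: "integrable M (crit1 n)"
proof -
  note em [measurable] = emp_meas_pair[OF meas_map(1), of n] emp_meas_pair[OF meas_map(2), of n] emp_meas_pair[OF meas_map(3), of n]
  have [measurable]: "(\<lambda>z. T m (qn n (fst z)) (emp n (fst z)) R0 (snd z)) \<in> borel_measurable (M \<Otimes>\<^sub>M \<tau>)" for m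
    unfolding T_def qn_def using measurable_compose[OF measurable_snd a_meas] measurable_compose[OF measurable_snd b_meas]
    by measurable
  have jm: "(\<lambda>(\<omega>, t). 2 * Re (cnj (T 0 (qn n \<omega>) (emp n \<omega>) R0 t) * T 1 (qn n \<omega>) (emp n \<omega>) R0 t)) \<in> borel_measurable (M \<Otimes>\<^sub>M \<tau>)"
    unfolding split_beta by measurable
  have le: "\<bar>2 * Re (cnj (T 0 (qn n \<omega>) (emp n \<omega>) R0 t) * T 1 (qn n \<omega>) (emp n \<omega>) R0 t)\<bar> \<le> 2 * (2 * bd * (2 * bd))"
    if "t \<in> space \<tau>" for \<omega> t
    using Re_cnj_mult_le[OF T_bound[OF q_adm(2) emp_adm(2) that, of 0 n \<omega> n \<omega> R0] T_bound[OF q_adm(2) emp_adm(2) that, of 1 n \<omega> n \<omega> R0]]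
    by (simp add: abs_mult del: times_complex.sel)
  from finite_Fubini(1)[OF M.finite_measure_axioms finite_measure_boxm jm le]
  show ?thesis by (simp add: crit1_def[abs_def] J1_def del: times_complex.sel)
qed

lemma infl_D [measurable]: "infl \<in> borel_measurable D"
  using infl_meas measurable_cong_sets[OF sets_D refl] by blast

lemma infl_square_integrable: "integrable D (\<lambda>y. (infl y)\<^sup>2)"
proof (rule D.integrable_const_bound)
  show "AE y in D. norm ((infl y)\<^sup>2) \<le> (2 * (6 * bd * (6 * bd)) * measure \<tau> (space \<tau>))\<^sup>2"
    using infl_bound by (auto intro!: AE_I2 simp: abs_le_square_iff[symmetric] intro: order.trans[OF _ abs_ge_self])
qed measurable

lemma infl_sum_meas [measurable]: "(\<lambda>\<omega>. (\<Sum>l<n. infl (W l \<omega>)) / sqrt (real n)) \<in> borel_measurable M"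
  by measurable

lemma crit1_infl:
  "(\<lambda>n. \<integral>\<omega>. min 1 \<bar>sqrt (real n) * crit1 n \<omega> - (\<Sum>l<n. infl (W l \<omega>)) / sqrt (real n)\<bar> \<partial>M) \<longlonglongrightarrow> 0"
proof (rule Lim_null_comparison)
  have [measurable]: "crit1 n \<in> borel_measurable M" for n using crit1_integrable by auto
  show "(\<lambda>n. 12 * bd\<^sup>2 * (\<integral>\<omega>. sqrt (real n) * Vn n \<omega> \<partial>M)) \<longlonglongrightarrow> 0"
    using tendsto_mult_left[OF sqrt_Vn_tendsto, of "12 * bd\<^sup>2"] by simp
  show "\<forall>\<^sub>F n in sequentially. norm (\<integral>\<omega>. min 1 \<bar>sqrt (real n) * crit1 n \<omega> - (\<Sum>l<n. infl (W l \<omega>)) / sqrt (real n)\<bar> \<partial>M)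
     \<le> 12 * bd\<^sup>2 * (\<integral>\<omega>. sqrt (real n) * Vn n \<omega> \<partial>M)"
    using eventually_ge_at_top[of 1]
  proof eventually_elim
    case (elim n)
    have "(\<integral>\<omega>. min 1 \<bar>sqrt (real n) * crit1 n \<omega> - (\<Sum>l<n. infl (W l \<omega>)) / sqrt (real n)\<bar> \<partial>M)
      \<le> (\<integral>\<omega>. 12 * bd\<^sup>2 * (sqrt (real n) * Vn n \<omega>) \<partial>M)"
    proof (rule integral_mono)
      show "integrable M (\<lambda>\<omega>. min 1 \<bar>sqrt (real n) * crit1 n \<omega> - (\<Sum>l<n. infl (W l \<omega>)) / sqrt (real n)\<bar>)"
        by (intro M.integrable_const_bound[where B=1]) auto
      show "integrable M (\<lambda>\<omega>. 12 * bd\<^sup>2 * (sqrt (real n) * Vn n \<omega>))"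
        by (intro integrable_mult_right Vn)
      show "min 1 \<bar>sqrt (real n) * crit1 n \<omega> - (\<Sum>l<n. infl (W l \<omega>)) / sqrt (real n)\<bar> \<le> 12 * bd\<^sup>2 * (sqrt (real n) * Vn n \<omega>)" for \<omega>
        using J1_expansion[OF elim, of \<omega>] unfolding crit1_def by (rule min.coboundedI2)
    qed
    moreover have "0 \<le> (\<integral>\<omega>. min 1 \<bar>sqrt (real n) * crit1 n \<omega> - (\<Sum>l<n. infl (W l \<omega>)) / sqrt (real n)\<bar> \<partial>M)" by simp
    ultimately show ?case by simp
  qed
qed

text \<open>Supplies the bounded mean of the score that \<open>M_estimator_linearization\<close>
  asks for; \<open>\<bar>x\<bar> \<le> 1 + x\<^sup>2\<close> brings in the second moment of the
  i.i.d. sum.\<close>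

lemma crit1_bound:
  assumes n: "n \<ge> 1"
  shows "(\<integral>\<omega>. \<bar>sqrt (real n) * crit1 n \<omega>\<bar> \<partial>M) \<le> 1 + (\<integral>y. (infl y)\<^sup>2 \<partial>D) + 12 * bd\<^sup>2 * (12 * measure \<tau> (space \<tau>))"
proof -
  note sm = iid_sum_second_moment[OF M W_indep W_distr infl_meas infl_square_integrable infl_mean, of n]
  have n0: "real n > 0" using n by simp
  have "(\<integral>\<omega>. \<bar>sqrt (real n) * crit1 n \<omega>\<bar> \<partial>M) \<le>
    (\<integral>\<omega>. 1 + (\<Sum>l<n. infl (W l \<omega>))\<^sup>2 / real n + 12 * bd\<^sup>2 * (sqrt (real n) * Vn n \<omega>) \<partial>M)"
  proof (rule integral_mono)
    show "integrable M (\<lambda>\<omega>. \<bar>sqrt (real n) * crit1 n \<omega>\<bar>)"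
      by (intro integrable_abs integrable_mult_right crit1_integrable)
    show "integrable M (\<lambda>\<omega>. 1 + (\<Sum>l<n. infl (W l \<omega>))\<^sup>2 / real n + 12 * bd\<^sup>2 * (sqrt (real n) * Vn n \<omega>))"
      using sm(1) Vn(1)[of n] by (intro Bochner_Integration.integrable_add integrable_mult_right integrable_divide) auto
    fix \<omega>
    have "\<bar>x\<bar> \<le> 1 + x\<^sup>2" for x :: real
    proof -
      have "0 \<le> (\<bar>x\<bar> - 1)\<^sup>2 + \<bar>x\<bar>" by simp
      then show ?thesis by (simp add: power2_diff)
    qed
    from this[of "(\<Sum>l<n. infl (W l \<omega>)) / sqrt (real n)"]
    have "\<bar>(\<Sum>l<n. infl (W l \<omega>)) / sqrt (real n)\<bar> \<le> 1 + (\<Sum>l<n. infl (W l \<omega>))\<^sup>2 / real n"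
      by (simp add: power_divide)
    then show "\<bar>sqrt (real n) * crit1 n \<omega>\<bar> \<le> 1 + (\<Sum>l<n. infl (W l \<omega>))\<^sup>2 / real n + 12 * bd\<^sup>2 * (sqrt (real n) * Vn n \<omega>)"
      using J1_expansion[OF n, of \<omega>] unfolding crit1_def by linarith
  qed
  also have "\<dots> = 1 + (\<integral>y. (infl y)\<^sup>2 \<partial>D) + 12 * bd\<^sup>2 * (sqrt (real n) * (\<integral>\<omega>. Vn n \<omega> \<partial>M))"
    using sm Vn(1)[of n] n0
    by (subst Bochner_Integration.integral_add, (intro Bochner_Integration.integrable_add integrable_divide integrable_mult_right; simp)+)
       (simp add: M.prob_space)
  also have "sqrt (real n) * (\<integral>\<omega>. Vn n \<omega> \<partial>M) \<le> 12 * measure \<tau> (space \<tau>)"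
  proof -
    have "1 \<le> sqrt (real n)" using n by simp
    then have "sqrt (real n) \<le> real n"
      using mult_left_mono[of 1 "sqrt (real n)" "sqrt (real n)"] by simp
    then have "sqrt (real n) * (\<integral>\<omega>. Vn n \<omega> \<partial>M) \<le> real n * (12 * measure \<tau> (space \<tau>) / real n)"
      using Vn(2)[OF n] Vn(3) by (intro mult_mono) auto
    then show ?thesis using n0 by simp
  qed
  finally show ?thesis by (simp add: mult_left_mono)
qed

text \<open>\<open>M_estimator_linearization\<close> expresses the error of the radius through the
  score, and \<open>crit1_infl\<close> replaces the score by the i.i.d. sum of
  \<open>infl\<close>.\<close>

lemma estimator_expansion:
  assumes Rb: "0 < Rmin" "Rmin < R0" "R0 < Rmax"
    and Rt_meas: "\<And>n. Rt n \<in> borel_measurable M"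
    and Rt_min: "\<And>n \<omega>. \<omega> \<in> space M \<Longrightarrow> Rt n \<omega> \<in> {Rmin..Rmax} \<and>
       (\<forall>R\<in>{Rmin..Rmax}. J (qn n \<omega>) (emp n \<omega>) (Rt n \<omega>) \<le> J (qn n \<omega>) (emp n \<omega>) R)"
  shows "(\<lambda>n. \<integral>\<omega>. min 1 \<bar>sqrt (real n) * (Rt n \<omega> - R0) + (\<Sum>l<n. infl (W l \<omega>)) / sqrt (real n) / J2 q p R0\<bar> \<partial>M) \<longlonglongrightarrow> 0"
proof -
  define m where "m = J2 q p R0"
  have m: "m > 0" using J2_pos by (simp add: m_def)
  have [measurable]: "crit1 n \<in> borel_measurable M" "Rt n \<in> borel_measurable M" for n
    using crit1_integrable Rt_meas by auto
  have lim1: "(\<lambda>n. \<integral>\<omega>. min 1 \<bar>sqrt (real n) * (Rt n \<omega> - R0) + sqrt (real n) * crit1 n \<omega> / m\<bar> \<partial>M) \<longlonglongrightarrow> 0"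
    unfolding m_def crit1_def
  proof (rule M_estimator_linearization[OF M J_deriv[OF q_adm(2) emp_adm(2)] J1_deriv[OF q_adm(2) emp_adm(2)]
        contrast_close(1) contrast_close(2) \<kappa>_integrable \<kappa>_tendsto _ J_R0 _ J2_isCont[OF q_adm(1) emp_adm(1)] J2_pos
        Rb(2,3) Rt_meas Rt_min])
    show "continuous_on {Rmin..Rmax} (J q p)"
      using DERIV_isCont[OF J_deriv[OF q_adm(1) emp_adm(1)]] by (simp add: continuous_at_imp_continuous_on)
    show "J q p R > 0" if "R \<in> {Rmin..Rmax}" "R \<noteq> R0" for R
      using that Rb by (intro J_pos) auto
    show "integrable M (\<lambda>\<omega>. J1 (qn n \<omega>) (emp n \<omega>) R0)" for n
      using crit1_integrable[of n] by (simp add: crit1_def[abs_def])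
    show "(\<integral>\<omega>. \<bar>sqrt (real n) * J1 (qn n \<omega>) (emp n \<omega>) R0\<bar> \<partial>M)
       \<le> 1 + (\<integral>y. (infl y)\<^sup>2 \<partial>D) + 12 * bd\<^sup>2 * (12 * measure \<tau> (space \<tau>))" if "n \<ge> 1" for n
      using crit1_bound[OF that] by (simp add: crit1_def)
  qed
  let ?x = "\<lambda>n \<omega>. sqrt (real n) * (Rt n \<omega> - R0) + sqrt (real n) * crit1 n \<omega> / m"
  let ?y = "\<lambda>n \<omega>. sqrt (real n) * crit1 n \<omega> - (\<Sum>l<n. infl (W l \<omega>)) / sqrt (real n)"
  let ?z = "\<lambda>n \<omega>. sqrt (real n) * (Rt n \<omega> - R0) + (\<Sum>l<n. infl (W l \<omega>)) / sqrt (real n) / m"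
  have le: "min 1 \<bar>?z n \<omega>\<bar> \<le> min 1 \<bar>?x n \<omega>\<bar> + (1 + 1 / m) * min 1 \<bar>?y n \<omega>\<bar>" for n \<omega>
  proof -
    have "?z n \<omega> = ?x n \<omega> + - (1 / m * ?y n \<omega>)" using m by (simp add: field_simps)
    then have "min 1 \<bar>?z n \<omega>\<bar> \<le> min 1 \<bar>?x n \<omega>\<bar> + min 1 \<bar>- (1 / m * ?y n \<omega>)\<bar>"
      using min_1_abs_add[of "?x n \<omega>" "- (1 / m * ?y n \<omega>)"] by (simp only:)
    also have "\<bar>- (1 / m * ?y n \<omega>)\<bar> = 1 / m * \<bar>?y n \<omega>\<bar>" using m by (simp add: abs_mult)
    also have "min 1 (1 / m * \<bar>?y n \<omega>\<bar>) \<le> (1 + 1 / m) * min 1 \<bar>?y n \<omega>\<bar>"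
      using m by (intro min_1_mult_le) auto
    finally show ?thesis by simp
  qed
  have int: "integrable M (\<lambda>\<omega>. min 1 \<bar>?x n \<omega>\<bar>)" "integrable M (\<lambda>\<omega>. min 1 \<bar>?y n \<omega>\<bar>)" "integrable M (\<lambda>\<omega>. min 1 \<bar>?z n \<omega>\<bar>)" for n
    by (auto intro!: M.integrable_const_bound[where B=1])
  have "(\<lambda>n. \<integral>\<omega>. min 1 \<bar>?z n \<omega>\<bar> \<partial>M) \<longlonglongrightarrow> 0"
  proof (rule Lim_null_comparison)
    show "(\<lambda>n. (\<integral>\<omega>. min 1 \<bar>?x n \<omega>\<bar> \<partial>M) + (1 + 1 / m) * (\<integral>\<omega>. min 1 \<bar>?y n \<omega>\<bar> \<partial>M)) \<longlonglongrightarrow> 0"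
      using tendsto_add[OF lim1 tendsto_mult_left[OF crit1_infl, of "1 + 1 / m"]] by simp
    show "\<forall>\<^sub>F n in sequentially. norm (\<integral>\<omega>. min 1 \<bar>?z n \<omega>\<bar> \<partial>M)
       \<le> (\<integral>\<omega>. min 1 \<bar>?x n \<omega>\<bar> \<partial>M) + (1 + 1 / m) * (\<integral>\<omega>. min 1 \<bar>?y n \<omega>\<bar> \<partial>M)"
    proof (intro always_eventually allI)
      fix n
      have "(\<integral>\<omega>. min 1 \<bar>?z n \<omega>\<bar> \<partial>M) \<le> (\<integral>\<omega>. min 1 \<bar>?x n \<omega>\<bar> + (1 + 1 / m) * min 1 \<bar>?y n \<omega>\<bar> \<partial>M)"
        using int le by (intro integral_mono Bochner_Integration.integrable_add integrable_mult_right)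
      also have "\<dots> = (\<integral>\<omega>. min 1 \<bar>?x n \<omega>\<bar> \<partial>M) + (1 + 1 / m) * (\<integral>\<omega>. min 1 \<bar>?y n \<omega>\<bar> \<partial>M)"
        by (simp only: Bochner_Integration.integral_add[OF int(1) integrable_mult_right[OF int(2)]] integral_mult_right_zero)
      finally show "norm (\<integral>\<omega>. min 1 \<bar>?z n \<omega>\<bar> \<partial>M)
       \<le> (\<integral>\<omega>. min 1 \<bar>?x n \<omega>\<bar> \<partial>M) + (1 + 1 / m) * (\<integral>\<omega>. min 1 \<bar>?y n \<omega>\<bar> \<partial>M)" by simp
    qed
  qed
  then show ?thesis by (simp add: m_def)
qed

text \<open>Both vectors are compared with one normalized i.i.d. sum \<open>\<zeta>\<close>, built
  from the centred coordinates and \<open>infl\<close>: the first with \<open>\<zeta>\<close>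
  itself, the second with \<open>A\<close> applied to \<open>\<zeta>\<close>. Hence \<open>V\<close>
  is the covariance of one summand, and the second limit has the sandwich covariance.\<close>

lemma joint_limits:
  assumes moments: "\<And>j. j < d \<Longrightarrow> integrable D (\<lambda>y. (y j)\<^sup>2)"
    and Rb: "0 < Rmin" "Rmin < R0" "R0 < Rmax"
    and Rt_meas: "\<And>n. Rt n \<in> borel_measurable M"
    and Rt_min: "\<And>n \<omega>. \<omega> \<in> space M \<Longrightarrow> Rt n \<omega> \<in> {Rmin..Rmax} \<and>
       (\<forall>R\<in>{Rmin..Rmax}. J (qn n \<omega>) (emp n \<omega>) (Rt n \<omega>) \<le> J (qn n \<omega>) (emp n \<omega>) R)"
  shows "\<exists>V. (\<exists>N. centered_gaussian (d + 1) V N \<and>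
      conv_distr M (d + 1) (\<lambda>n \<omega> j. sqrt (real n) *
         (if j < d then (1 / real n) * (\<Sum>i<n. W i \<omega> j) - (\<integral>y. y j \<partial>D) else J1 (qn n \<omega>) (emp n \<omega>) R0)) N) \<and>
    (\<exists>N. centered_gaussian (d + 1) (sandwich (d + 1) (Amat d ES (J2 q p R0)) V) N \<and>
      conv_distr M (d + 1) (\<lambda>n \<omega> j. sqrt (real n) *
         (if j = 0 then Rt n \<omega> - R0
          else (1 / real n) * (\<Sum>i<n. W i \<omega> (j - 1)) - (\<integral>y. y (j - 1) \<partial>D) - (Rt n \<omega> - R0) * ES (j - 1))) N)"
proof -
  let ?k = "d + 1"
  define m where "m = J2 q p R0"
  have m: "m > 0" using J2_pos by (simp add: m_def)
  have [measurable]: "crit1 n \<in> borel_measurable M" "Rt n \<in> borel_measurable M" for n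
    using crit1_integrable Rt_meas by auto
  define \<xi> where "\<xi> j y = (if j < d then y j - (\<integral>y. y j \<partial>D) else infl y)" for j and y :: "nat \<Rightarrow> real"
  define \<zeta> where "\<zeta> n \<omega> j = (\<Sum>l<n. \<xi> j (W l \<omega>)) / sqrt (real n)" for n \<omega> j
  define Z1 where "Z1 n \<omega> j = sqrt (real n) *
         (if j < d then (1 / real n) * (\<Sum>i<n. W i \<omega> j) - (\<integral>y. y j \<partial>D) else crit1 n \<omega>)" for n \<omega> j
  define Z2 where "Z2 n \<omega> j = sqrt (real n) *
         (if j = 0 then Rt n \<omega> - R0
          else (1 / real n) * (\<Sum>i<n. W i \<omega> (j - 1)) - (\<integral>y. y (j - 1) \<partial>D) - (Rt n \<omega> - R0) * ES (j - 1))" for n \<omega> j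
  define V where "V i j = (\<integral>y. \<xi> i y * \<xi> j y \<partial>D)" for i j
  define A where "A = Amat d ES m"
  have int1: "integrable D (\<lambda>y. y j)" if "j < d" for j
    by (rule D.square_integrable_imp_integrable[OF D_coord[OF that] moments[OF that]])
  have \<xi>_meas: "\<xi> j \<in> borel_measurable (lebK d)" for j
    by (cases "j < d") (auto simp: \<xi>_def[abs_def])
  have \<xi>_sq: "integrable D (\<lambda>y. (\<xi> j y)\<^sup>2)" for j
  proof (cases "j < d")
    case True
    have "integrable D (\<lambda>y. (y j)\<^sup>2 - 2 * (\<integral>y. y j \<partial>D) * y j + (\<integral>y. y j \<partial>D)\<^sup>2)"
      using moments[OF True] int1[OF True]
      by (intro Bochner_Integration.integrable_add Bochner_Integration.integrable_diff integrable_mult_right) auto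
    also have "(\<lambda>y. (y j)\<^sup>2 - 2 * (\<integral>y. y j \<partial>D) * y j + (\<integral>y. y j \<partial>D)\<^sup>2) = (\<lambda>y. (\<xi> j y)\<^sup>2)"
      using True by (simp add: \<xi>_def power2_diff fun_eq_iff algebra_simps)
    finally show ?thesis .
  next
    case False
    then show ?thesis using infl_square_integrable by (simp add: \<xi>_def)
  qed
  have \<xi>_mean: "(\<integral>y. \<xi> j y \<partial>D) = 0" for j
    using int1[of j] infl_mean by (cases "j < d") (simp_all add: \<xi>_def D.prob_space)
  have clt: "(\<lambda>n. \<integral>\<omega>. cis (ip ?k t (\<zeta> n \<omega>)) \<partial>M) \<longlonglongrightarrow>
       of_real (exp (- (\<Sum>i<?k. \<Sum>j<?k. t i * V i j * t j) / 2))" for t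
    unfolding \<zeta>_def V_def
    by (rule clt_cis_vector[OF M W_indep W_distr \<xi>_meas \<xi>_sq \<xi>_mean])
  have \<zeta>_meas [measurable]: "(\<lambda>\<omega>. \<zeta> n \<omega> j) \<in> borel_measurable M" for n j
    unfolding \<zeta>_def using measurable_compose[OF W_meas \<xi>_meas[of j]] by measurable
  have V_sym: "V i j = V j i" for i j by (simp add: V_def mult.commute)
  \<comment> \<open>Characteristic functions are at most 1 in modulus, and their limit is
    \<open>exp\<close> of minus half the form, so the form cannot be negative.\<close>
  have V_psd: "0 \<le> (\<Sum>i<?k. \<Sum>j<?k. x i * V i j * x j)" for x
  proof -
    have "norm (\<integral>\<omega>. cis (ip ?k x (\<zeta> n \<omega>)) \<partial>M) \<le> 1" for n
    proof -
      have [measurable]: "(\<lambda>\<omega>. ip ?k x (\<zeta> n \<omega>)) \<in> borel_measurable M" unfolding ip_def by measurable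
      have "norm (\<integral>\<omega>. cis (ip ?k x (\<zeta> n \<omega>)) \<partial>M) \<le> (\<integral>\<omega>. 1 \<partial>M)"
        by (intro order.trans[OF integral_norm_bound] integral_mono integrable_norm M.integrable_const_bound[where B=1]) auto
      then show ?thesis by (simp add: M.prob_space)
    qed
    then have "norm (complex_of_real (exp (- (\<Sum>i<?k. \<Sum>j<?k. x i * V i j * x j) / 2))) \<le> 1"
      using LIMSEQ_le_const2[OF tendsto_norm[OF clt[of x]], of 1] by blast
    then show ?thesis by (simp del: of_real_exp)
  qed
  obtain N where N: "centered_gaussian ?k V N"
    using centered_gaussian_exists[of ?k V] V_sym V_psd by blast
  have S_psd: "0 \<le> (\<Sum>i<?k. \<Sum>j<?k. x i * sandwich ?k A V i j * x j)" for x
    unfolding quad_sandwich[symmetric] by (rule V_psd)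
  obtain N' where N': "centered_gaussian ?k (sandwich ?k A V) N'"
    using centered_gaussian_exists[of ?k "sandwich ?k A V", OF sandwich_sym[OF V_sym] S_psd] by blast
  have \<zeta>_mean: "sqrt (real n) * ((1 / real n) * (\<Sum>i<n. W i \<omega> j) - (\<integral>y. y j \<partial>D)) = \<zeta> n \<omega> j" if "j < d" for n \<omega> j
  \<comment> \<open>For \<open>n = 0\<close> the factor \<open>sqrt 0\<close> and the empty sum make
    both sides 0.\<close>
  proof (cases "n = 0")
    case False
    then have "sqrt (real n) * ((1 / real n) * x - c) = (x - real n * c) / sqrt (real n)" for x c
      by (simp add: field_simps flip: real_sqrt_mult)
    then show ?thesis using that by (simp add: \<zeta>_def \<xi>_def sum_subtractf)
  qed (simp add: \<zeta>_def)
  have \<zeta>_d: "\<zeta> n \<omega> d = (\<Sum>l<n. infl (W l \<omega>)) / sqrt (real n)" for n \<omega>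
    by (simp add: \<zeta>_def \<xi>_def)
  have Z1_meas: "(\<lambda>\<omega>. Z1 n \<omega> j) \<in> borel_measurable M" for n j
    unfolding Z1_def by (cases "j < d") auto
  have Z2_meas: "(\<lambda>\<omega>. Z2 n \<omega> j) \<in> borel_measurable M" if "j < ?k" for n j
  proof (cases "j = 0")
    case False
    then have "j - 1 < d" using that by simp
    then show ?thesis unfolding Z2_def using False by simp
  qed (simp add: Z2_def)
  have "conv_distr M ?k Z1 N"
  proof (rule conv_distr_gaussian[OF M measurable_lebK_restrict[OF Z1_meas] N])
    fix t
    show "(\<lambda>n. \<integral>\<omega>. cis (ip ?k t (Z1 n \<omega>)) \<partial>M) \<longlonglongrightarrow>
       of_real (exp (- (\<Sum>i<?k. \<Sum>j<?k. t i * V i j * t j) / 2))"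
    proof (rule slutsky_cis[OF M \<zeta>_meas Z1_meas clt])
      fix j assume "j < ?k"
      show "(\<lambda>n. \<integral>\<omega>. min 1 \<bar>Z1 n \<omega> j - \<zeta> n \<omega> j\<bar> \<partial>M) \<longlonglongrightarrow> 0"
      proof (cases "j < d")
        case True
        then have "Z1 n \<omega> j = \<zeta> n \<omega> j" for n \<omega> by (simp only: Z1_def if_True \<zeta>_mean)
        then show ?thesis by simp
      next
        case False
        with \<open>j < ?k\<close> have "j = d" by simp
        then show ?thesis using crit1_infl by (simp add: Z1_def \<zeta>_d)
      qed
    qed
  qed
  moreover have "conv_distr M ?k Z2 N'"
  proof (rule conv_distr_gaussian[OF M measurable_lebK_restrict[OF Z2_meas] N'])
    fix t
    \<comment> \<open>The linear image with which the second vector is compared; \<open>clt\<close>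
      at the transposed image of \<open>t\<close> gives its limit.\<close>
    define AZ where "AZ n \<omega> j = (\<Sum>a<?k. A j a * \<zeta> n \<omega> a)" for n \<omega> j
    have AZ_lim: "(\<lambda>n. \<integral>\<omega>. cis (ip ?k t (AZ n \<omega>)) \<partial>M) \<longlonglongrightarrow>
       of_real (exp (- (\<Sum>i<?k. \<Sum>j<?k. t i * sandwich ?k A V i j * t j) / 2))"
      using clt[of "\<lambda>a. \<Sum>j<?k. t j * A j a"] unfolding quad_sandwich AZ_def ip_linear .
    \<comment> \<open>The linearization error of the radius. Every coordinate of the second vector
      differs from its linear image by a multiple of it.\<close>
    define \<delta> where "\<delta> n \<omega> = sqrt (real n) * (Rt n \<omega> - R0) + \<zeta> n \<omega> d / m" for n \<omega>
    have \<delta>_lim: "(\<lambda>n. \<integral>\<omega>. min 1 \<bar>\<delta> n \<omega>\<bar> \<partial>M) \<longlonglongrightarrow> 0"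
      using estimator_expansion[OF Rb Rt_meas Rt_min] by (simp add: \<delta>_def \<zeta>_d m_def)
    have \<delta>_meas [measurable]: "\<delta> n \<in> borel_measurable M" for n unfolding \<delta>_def by measurable
    show "(\<lambda>n. \<integral>\<omega>. cis (ip ?k t (Z2 n \<omega>)) \<partial>M) \<longlonglongrightarrow>
       of_real (exp (- (\<Sum>i<?k. \<Sum>j<?k. t i * sandwich ?k A V i j * t j) / 2))"
    proof (rule slutsky_cis[OF M _ Z2_meas AZ_lim])
      show "(\<lambda>\<omega>. AZ n \<omega> j) \<in> borel_measurable M" for n j unfolding AZ_def by measurable
      fix j assume j: "j < ?k"
      have AZ_eq: "AZ n \<omega> j = (if j = 0 then - \<zeta> n \<omega> d / m else \<zeta> n \<omega> (j - 1) + ES (j - 1) / m * \<zeta> n \<omega> d)" for n \<omega>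
        unfolding AZ_def A_def by (rule Amat_apply[OF j])
      show "(\<lambda>n. \<integral>\<omega>. min 1 \<bar>Z2 n \<omega> j - AZ n \<omega> j\<bar> \<partial>M) \<longlonglongrightarrow> 0"
      proof (cases "j = 0")
        case True
        then have "Z2 n \<omega> j - AZ n \<omega> j = \<delta> n \<omega>" for n \<omega>
          unfolding AZ_eq by (simp add: Z2_def \<delta>_def)
        then show ?thesis using \<delta>_lim by simp
      next
        case False
        then have j': "j - 1 < d" using j by simp
        have eq: "Z2 n \<omega> j - AZ n \<omega> j = - ES (j - 1) * \<delta> n \<omega>" for n \<omega>
        proof -
          have "Z2 n \<omega> j = \<zeta> n \<omega> (j - 1) - ES (j - 1) * (sqrt (real n) * (Rt n \<omega> - R0))"
            unfolding \<zeta>_mean[OF j', symmetric] using False by (simp add: Z2_def algebra_simps)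
          then show ?thesis
            unfolding AZ_eq using False m by (simp add: \<delta>_def algebra_simps)
        qed
        let ?b = "\<bar>ES (j - 1)\<bar>"
        show ?thesis
        proof (rule Lim_null_comparison)
          show "(\<lambda>n. (1 + ?b) * (\<integral>\<omega>. min 1 \<bar>\<delta> n \<omega>\<bar> \<partial>M)) \<longlonglongrightarrow> 0"
            using tendsto_mult_left[OF \<delta>_lim, of "1 + ?b"] by simp
          show "\<forall>\<^sub>F n in sequentially. norm (\<integral>\<omega>. min 1 \<bar>Z2 n \<omega> j - AZ n \<omega> j\<bar> \<partial>M) \<le> (1 + ?b) * (\<integral>\<omega>. min 1 \<bar>\<delta> n \<omega>\<bar> \<partial>M)"
          proof (intro always_eventually allI)
            fix n
            have "(\<integral>\<omega>. min 1 \<bar>Z2 n \<omega> j - AZ n \<omega> j\<bar> \<partial>M) \<le> (\<integral>\<omega>. (1 + ?b) * min 1 \<bar>\<delta> n \<omega>\<bar> \<partial>M)"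
            proof (rule integral_mono)
              show "integrable M (\<lambda>\<omega>. min 1 \<bar>Z2 n \<omega> j - AZ n \<omega> j\<bar>)"
                unfolding eq by (intro M.integrable_const_bound[where B=1]) auto
              show "integrable M (\<lambda>\<omega>. (1 + ?b) * min 1 \<bar>\<delta> n \<omega>\<bar>)"
                by (intro integrable_mult_right M.integrable_const_bound[where B=1]) auto
              show "min 1 \<bar>Z2 n \<omega> j - AZ n \<omega> j\<bar> \<le> (1 + ?b) * min 1 \<bar>\<delta> n \<omega>\<bar>" for \<omega>
                unfolding eq abs_mult abs_minus_cancel by (rule min_1_mult_le) auto
            qed
            then show "norm (\<integral>\<omega>. min 1 \<bar>Z2 n \<omega> j - AZ n \<omega> j\<bar> \<partial>M) \<le> (1 + ?b) * (\<integral>\<omega>. min 1 \<bar>\<delta> n \<omega>\<bar> \<partial>M)"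
              by simp
          qed
        qed
      qed
    qed
  qed
  ultimately show ?thesis
    using N N' unfolding A_def m_def Z1_def[abs_def] Z2_def[abs_def] crit1_def by blast
qed

end

section \<open>The spherical deconvolution model\<close>

lemma Sph_cong:
  assumes "d \<ge> 2" "\<And>l. l < d - 1 \<Longrightarrow> u l = v l"
  shows "Sph d u j = Sph d v j"
proof -
  have "(\<Prod>l\<in>{1..<k}. sin (pi * u l)) = (\<Prod>l\<in>{1..<k}. sin (pi * v l))" if "k \<le> d - 1" for k
    using that assms(2) by (intro prod.cong) auto
  then show ?thesis using assms by (auto simp: Sph_def)
qed

lemma Sph_restrict: "d \<ge> 2 \<Longrightarrow> Sph d (restrict u {..<d - 1}) = Sph d u"
  by (intro ext Sph_cong) auto

lemma Sph_measurable:
  assumes "d \<ge> 2"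
  shows "(\<lambda>u. Sph d u j) \<in> borel_measurable (lebK (d - 1))"
proof -
  have c: "l < d - 1 \<Longrightarrow> (\<lambda>u. f (u l)) \<in> borel_measurable (lebK (d - 1))"
    if "f \<in> borel_measurable borel" for l and f :: "real \<Rightarrow> real"
    using measurable_compose[OF measurable_lebK_component that] .
  have p: "(\<lambda>u. \<Prod>l\<in>{1..<k}. sin (pi * u l)) \<in> borel_measurable (lebK (d - 1))" if "k \<le> d - 1" for k
    using that by (intro borel_measurable_prod c) auto
  have 0: "0 < d - 1" using assms by simp
  consider "j = 0" | "j \<noteq> 0" "j < d - 1" | "j \<noteq> 0" "j = d - 1" | "j > d - 1" by linarith
  then show ?thesis
  proof cases
    case 1
    then show ?thesis using 0 by (simp add: Sph_def c)
  next
    case 2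
    then have "(\<lambda>u. Sph d u j) = (\<lambda>u. sin (2 * pi * u 0) * (\<Prod>l\<in>{1..<j}. sin (pi * u l)) * cos (pi * u j))"
      by (auto simp: Sph_def)
    then show ?thesis
      using 0 2 by (simp only:)
        (intro borel_measurable_times p c[of "\<lambda>x. sin (2 * pi * x)"] c[of "\<lambda>x. cos (pi * x)"], auto)
  next
    case 3
    then have "(\<lambda>u. Sph d u j) = (\<lambda>u. sin (2 * pi * u 0) * (\<Prod>l\<in>{1..<d - 1}. sin (pi * u l)))"
      by (auto simp: Sph_def)
    then show ?thesis
      using 0 by (simp only:) (intro borel_measurable_times p c[of "\<lambda>x. sin (2 * pi * x)"], auto)
  next
    case 4
    then show ?thesis by (simp add: Sph_def)
  qed
qed

text \<open>The squared product of the first sines is what the preceding coordinates leave of the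
  unit mass; each further angle splits it by its cosine and sine.\<close>

lemma Sph_unit:
  assumes "d \<ge> 2"
  shows "(\<Sum>j<d. (Sph d u j)\<^sup>2) = 1"
proof -
  define p where "p n = (\<Prod>l\<in>{1..<n}. sin (pi * u l))" for n
  have part: "(\<Sum>j\<in>{1..<Suc n}. (p j * cos (pi * u j))\<^sup>2) + (p (Suc n))\<^sup>2 = 1" for n
  proof (induction n)
    case 0
    show ?case by (simp add: p_def)
  next
    case (Suc n)
    have "p (Suc (Suc n)) = p (Suc n) * sin (pi * u (Suc n))" by (simp add: p_def)
    then have "(p (Suc n) * cos (pi * u (Suc n)))\<^sup>2 + (p (Suc (Suc n)))\<^sup>2 = (p (Suc n))\<^sup>2"
      by (simp only: power_mult_distrib distrib_left[symmetric]) simp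
    then show ?case using Suc by simp
  qed
  obtain n where n: "d = Suc (Suc n)"
    using assms by (metis One_nat_def Suc_1 Suc_le_D le_SucE not_less_eq_eq add_2_eq_Suc le_Suc_ex)
  have "{..<d} = insert 0 (insert (Suc n) {1..<Suc n})" using n by auto
  then have "(\<Sum>j<d. (Sph d u j)\<^sup>2) = (Sph d u 0)\<^sup>2 + ((Sph d u (Suc n))\<^sup>2 + (\<Sum>j\<in>{1..<Suc n}. (Sph d u j)\<^sup>2))"
    by simp
  also have "(\<Sum>j\<in>{1..<Suc n}. (Sph d u j)\<^sup>2) = (\<Sum>j\<in>{1..<Suc n}. (sin (2 * pi * u 0))\<^sup>2 * (p j * cos (pi * u j))\<^sup>2)"
    using n by (intro sum.cong) (auto simp: Sph_def p_def power_mult_distrib)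
  also have "(Sph d u (Suc n))\<^sup>2 = (sin (2 * pi * u 0))\<^sup>2 * (p (Suc n))\<^sup>2"
    using n by (simp add: Sph_def p_def power_mult_distrib)
  also have "(sin (2 * pi * u 0))\<^sup>2 * (p (Suc n))\<^sup>2 + (\<Sum>j\<in>{1..<Suc n}. (sin (2 * pi * u 0))\<^sup>2 * (p j * cos (pi * u j))\<^sup>2)
      = (sin (2 * pi * u 0))\<^sup>2 * 1"
    unfolding part[of n, symmetric] by (simp add: sum_distrib_left distrib_left add.commute)
  also have "(Sph d u 0)\<^sup>2 = (cos (2 * pi * u 0))\<^sup>2" by (simp add: Sph_def)
  finally show ?thesis by simp
qed

text \<open>The cylinder over a null set is a product set with one factor of measure 0.\<close>

lemma AE_lebK_component:
  assumes "N \<in> null_sets lborel" "j < k"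
  shows "AE u in lebK k. u j \<notin> N"
proof -
  interpret product_sigma_finite "\<lambda>_. lborel :: real measure" by unfold_locales
  let ?E = "PiE {..<k} (\<lambda>i. if i = j then N else UNIV)"
  have "emeasure (lebK k) ?E = (\<Prod>i<k. emeasure lborel (if i = j then N else UNIV))"
    unfolding lebK_def using assms by (intro emeasure_PiM) auto
  also have "\<dots> = 0" using assms by (intro prod_zero) auto
  finally have "?E \<in> null_sets (lebK k)"
    using assms by (auto simp: null_sets_def lebK_def intro!: sets_PiM_I_finite)
  then show ?thesis
    by (rule AE_I') (auto simp: lebK_def space_PiM PiE_iff extensional_def)
qed

text \<open>Doubling the angle turns the equation into one between cosines, solved by
  \<open>a + n / 2\<close> and \<open>- a + n / 2\<close> for integers \<open>n\<close>. Level sets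
  of the squared first coordinate are therefore null for a law with a density.\<close>

lemma countable_cos_power2_eq: "countable {x. (cos (2 * pi * x))\<^sup>2 = c}"
proof (cases "{x. (cos (2 * pi * x))\<^sup>2 = c} = {}")
  case False
  then obtain a where a: "(cos (2 * pi * a))\<^sup>2 = c" by auto
  have "x \<in> (\<lambda>n. a + real_of_int n / 2) ` UNIV \<union> (\<lambda>n. - a + real_of_int n / 2) ` UNIV"
    if "(cos (2 * pi * x))\<^sup>2 = c" for x
  proof -
    have "cos (2 * (2 * pi * x)) = cos (2 * (2 * pi * a))"
      using a that by (simp only: cos_double_cos)
    then obtain n where n: "n \<in> \<int>" "2 * (2 * pi * x) = 2 * (2 * pi * a) + 2 * n * pi \<or> 2 * (2 * pi * x) = - (2 * (2 * pi * a)) + 2 * n * pi"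
      unfolding cos_eq by blast
    from n(1) obtain k where "n = real_of_int k" by (auto elim: Ints_cases)
    moreover from n(2) have "pi * (2 * x) = pi * (2 * a + n) \<or> pi * (2 * x) = pi * (- 2 * a + n)"
      by (auto simp: algebra_simps)
    then have "x = a + n / 2 \<or> x = - a + n / 2"
      by (simp add: mult_cancel_left del: distrib_left_numeral) linarith
    ultimately show ?thesis by auto
  qed
  then have "{x. (cos (2 * pi * x))\<^sup>2 = c} \<subseteq> (\<lambda>n. a + real_of_int n / 2) ` UNIV \<union> (\<lambda>n. - a + real_of_int n / 2) ` UNIV"
    by blast
  then show ?thesis by (rule countable_subset) auto
qed simp

lemma charf_continuous:
  assumes "prob_space D" "sets D = sets (lebK d)"
  shows "continuous_on UNIV (charf d D)"
  unfolding continuous_on_eq_continuous_at[OF open_UNIV] isCont_def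
proof
  interpret prob_space D by fact
  have [measurable]: "ip d t \<in> borel_measurable D" for t
    using measurable_ip[of d t] measurable_cong_sets[OF assms(2) refl] by blast
  fix t0 :: "nat \<Rightarrow> real"
  have ipc: "continuous_on UNIV (\<lambda>t. ip d t x)" for x
    unfolding ip_def by (intro continuous_intros continuous_on_product_coordinates)
  have "((\<lambda>t. charf d D t) \<longlongrightarrow> charf d D t0) (at t0 within UNIV)"
    unfolding tendsto_at_iff_sequentially comp_def charf_def
  proof (intro allI impI)
    fix X :: "nat \<Rightarrow> nat \<Rightarrow> real" assume X: "\<forall>i. X i \<in> UNIV - {t0}" "X \<longlonglongrightarrow> t0"
    have ipl: "(\<lambda>i. ip d (X i) x) \<longlonglongrightarrow> ip d t0 x" for x
      using continuous_on_tendsto_compose[OF ipc X(2)] by auto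
    show "(\<lambda>i. \<integral>x. cis (ip d (X i) x) \<partial>D) \<longlonglongrightarrow> (\<integral>x. cis (ip d t0 x) \<partial>D)"
      by (rule integral_dominated_convergence[where w="\<lambda>_. 1"]) (auto intro!: AE_I2 tendsto_intros ipl)
  qed
  then show "charf d D \<midarrow>t0\<rightarrow> charf d D t0" by simp
qed

lemma charf_indep_coordinates:
  assumes M: "prob_space M" and indep: "prob_space.indep_vars M (\<lambda>_. borel) (\<lambda>k \<omega>. X \<omega> k) {..<d}"
    and X: "(\<lambda>\<omega>. restrict (X \<omega>) {..<d}) \<in> M \<rightarrow>\<^sub>M lebK d"
  shows "charf d (distr M (lebK d) (\<lambda>\<omega>. restrict (X \<omega>) {..<d})) t = (\<Prod>j<d. \<integral>\<omega>. cis (t j * X \<omega> j) \<partial>M)"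
proof -
  interpret prob_space M by fact
  have Xj: "random_variable borel (\<lambda>\<omega>. X \<omega> j)" if "j < d" for j
    using indep that unfolding indep_vars_def2 by simp
  have "charf d (distr M (lebK d) (\<lambda>\<omega>. restrict (X \<omega>) {..<d})) t = (\<integral>\<omega>. cis (ip d t (X \<omega>)) \<partial>M)"
    unfolding charf_def by (subst integral_distr[OF X]) auto
  also have "\<dots> = (\<integral>\<omega>. (\<Prod>j<d. cis (t j * X \<omega> j)) \<partial>M)"
    by (simp add: ip_def cis_sum)
  also have "\<dots> = (\<Prod>j<d. \<integral>\<omega>. cis (t j * X \<omega> j) \<partial>M)"
  proof (rule indep_vars_lebesgue_integral)
    show "indep_vars (\<lambda>_. borel) (\<lambda>j \<omega>. cis (t j * X \<omega> j)) {..<d}"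
      by (rule indep_vars_compose2[OF indep]) measurable
    show "integrable M (\<lambda>\<omega>. cis (t j * X \<omega> j))" if "j \<in> {..<d}" for j
      using Xj[of j] that by (intro integrable_const_bound[where B=1]) auto
  qed simp
  finally show ?thesis .
qed

text \<open>A one-dimensional characteristic function is 1 at 0, so the coordinates switched off by
  \<open>e1\<close> or \<open>e2\<close> contribute trivial factors.\<close>

lemma prod_split_e12:
  fixes h :: "nat \<Rightarrow> real \<Rightarrow> complex"
  assumes "\<And>j. h j 0 = 1"
  shows "(\<Prod>j<d. h j (e1 t j)) * (\<Prod>j<d. h j (e2 t j)) = (\<Prod>j<d. h j (t j))"
  unfolding prod.distrib[symmetric] by (intro prod.cong) (auto simp: e1_def e2_def assms)

text \<open>It remains to see that the model is an instance of \<open>deconvolution_sample\<close>,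
  and that \<open>Mn\<close> and \<open>Mlim\<close> are the contrast \<open>J\<close> at the
  empirical and at the true pair.\<close>

theorem theorem4p2:
  fixes d :: nat and M :: "'a measure"
    and U \<epsilon> Y :: "nat \<Rightarrow> 'a \<Rightarrow> nat \<Rightarrow> real"
    and Cstar :: "nat \<Rightarrow> real" and Rstar Rmin Rmax \<nu> :: real
    and f :: "(nat \<Rightarrow> real) \<Rightarrow> real" and Q :: "(nat \<Rightarrow> real) measure"
    and Rt :: "nat \<Rightarrow> 'a \<Rightarrow> real"
  assumes prob: "prob_space M"
    and d2: "d \<ge> 2"
    \<comment> \<open>f is a Lebesgue density on [0,1]^(d-1), the law of every U_i\<close>
    and f_meas: "f \<in> borel_measurable (lebK (d - 1))"
    and f_nonneg: "\<forall>u\<in>space (lebK (d - 1)). f u \<ge> 0"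
    and f_supp: "\<forall>u\<in>space (lebK (d - 1)). u \<notin> closed_cube (d - 1) \<longrightarrow> f u = 0"
    and U_law: "\<forall>i. distr M (lebK (d - 1)) (\<lambda>\<omega>. restrict (U i \<omega>) {..<d - 1})
                     = density (lebK (d - 1)) (\<lambda>u. ennreal (f u))"
    \<comment> \<open>(H2)\<close>
    and H2: "d > 2 \<longrightarrow> (\<exists>\<gamma>>0. \<forall>u\<in>space (lebK (d - 1)).
                 (\<forall>k<d - 1. 0 < u k \<and> u k < \<gamma>) \<longrightarrow> f u > 0)"
    \<comment> \<open>the noise has law Q\<close>
    and eps_law: "\<forall>i. distr M (lebK d) (\<lambda>\<omega>. restrict (\<epsilon> i \<omega>) {..<d}) = Q"
    \<comment> \<open>(U_i)_i i.i.d., (eps_i)_i i.i.d., the two sequences independent\<close>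
    and indep: "prob_space.indep_vars M
                  (\<lambda>j. case j of Inl _ \<Rightarrow> lebK (d - 1) | Inr _ \<Rightarrow> lebK d)
                  (\<lambda>j \<omega>. case j of Inl i \<Rightarrow> restrict (U i \<omega>) {..<d - 1}
                                | Inr i \<Rightarrow> restrict (\<epsilon> i \<omega>) {..<d})
                  (UNIV :: (nat + nat) set)"
    \<comment> \<open>(H1) independent coordinates of the noise\<close>
    and H1: "prob_space.indep_vars M (\<lambda>_. borel) (\<lambda>k \<omega>. \<epsilon> 0 \<omega> k) {..<d}"
    \<comment> \<open>finite second moment, centered\<close>
    and moment2: "\<forall>k<d. integrable M (\<lambda>\<omega>. (\<epsilon> 0 \<omega> k)\<^sup>2)"
    and centered: "\<forall>k<d. (\<integral>\<omega>. \<epsilon> 0 \<omega> k \<partial>M) = 0"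
    and Y_def: "\<forall>i \<omega> j. Y i \<omega> j = Cstar j + Rstar * Sph d (U i \<omega>) j + \<epsilon> i \<omega> j"
    and nu_pos: "\<nu> > 0"
    and Rmin_pos: "0 < Rmin" and Rmin_Rmax: "Rmin < Rmax"
    and Rstar_in: "Rmin < Rstar" "Rstar < Rmax"
    \<comment> \<open>R~_n is a (measurable) minimizer of M_n over [Rmin, Rmax]\<close>
    and Rt_meas: "\<forall>n. Rt n \<in> borel_measurable M"
    and Rt_min: "\<forall>n. \<forall>\<omega>\<in>space M. Rt n \<omega> \<in> {Rmin..Rmax} \<and>
                   (\<forall>R\<in>{Rmin..Rmax}. Mn d f \<nu> Y n \<omega> (Rt n \<omega>) \<le> Mn d f \<nu> Y n \<omega> R)"
  shows
    "(\<forall>n \<omega>. (\<lambda>R. Mn d f \<nu> Y n \<omega> R) differentiable (at Rstar)) \<and>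
     (\<forall>R. Mlim d f \<nu> Q Rstar differentiable (at R)) \<and>
     deriv (Mlim d f \<nu> Q Rstar) differentiable (at Rstar) \<and>
     deriv (deriv (Mlim d f \<nu> Q Rstar)) Rstar \<noteq> 0 \<and>
     (\<exists>V. (\<exists>N. centered_gaussian (d + 1) V N \<and>
              conv_distr M (d + 1)
                (\<lambda>n \<omega> j. sqrt (real n) *
                   (if j < d then (1 / real n) * (\<Sum>i<n. Y i \<omega> j) - (\<integral>\<omega>'. Y 0 \<omega>' j \<partial>M)
                    else deriv (\<lambda>R. Mn d f \<nu> Y n \<omega> R) Rstar)) N) \<and>
          (\<exists>N. centered_gaussian (d + 1)
                 (sandwich (d + 1)
                    (Amat d (\<lambda>j. \<integral>\<omega>. Sph d (U 0 \<omega>) j \<partial>M)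
                       (deriv (deriv (Mlim d f \<nu> Q Rstar)) Rstar)) V) N \<and>
              conv_distr M (d + 1)
                (\<lambda>n \<omega> j. sqrt (real n) *
                   (if j = 0 then Rt n \<omega> - Rstar
                    else Ctilde d f Y Rt n \<omega> (j - 1) - Cstar (j - 1))) N))"
proof -
  note One_nat_def [simp del]
  interpret M: prob_space M by fact
  let ?M' = "\<lambda>j. case j of Inl _ \<Rightarrow> lebK (d - 1) | Inr _ \<Rightarrow> lebK d"
  let ?X = "\<lambda>j \<omega>. case j of Inl i \<Rightarrow> restrict (U i \<omega>) {..<d - 1} | Inr i \<Rightarrow> restrict (\<epsilon> i \<omega>) {..<d}"
  define RU where "RU i \<omega> = restrict (U i \<omega>) {..<d - 1}" for i \<omega>
  define RE where "RE i \<omega> = restrict (\<epsilon> i \<omega>) {..<d}" for i \<omega>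
  define \<mu> where "\<mu> = density (lebK (d - 1)) (\<lambda>u. ennreal (f u))"
  have X_meas: "?X j \<in> M \<rightarrow>\<^sub>M ?M' j" for j
    using indep unfolding M.indep_vars_def2 by blast
  have RU [measurable]: "RU i \<in> M \<rightarrow>\<^sub>M lebK (d - 1)" for i
    using X_meas[of "Inl i"] by (simp add: RU_def[abs_def])
  have RE [measurable]: "RE i \<in> M \<rightarrow>\<^sub>M lebK d" for i
    using X_meas[of "Inr i"] by (simp add: RE_def[abs_def])
  have RU_law: "distr M (lebK (d - 1)) (RU i) = \<mu>" for i
    using U_law by (simp add: RU_def[abs_def] \<mu>_def)
  have RE_law: "distr M (lebK d) (RE i) = Q" for i
    using eps_law by (simp add: RE_def[abs_def])
  have sets_\<mu>: "sets \<mu> = sets (lebK (d - 1))" by (simp add: \<mu>_def)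
  have sets_Q: "sets Q = sets (lebK d)" using RE_law[of 0] by auto
  interpret \<mu>: prob_space \<mu> using M.prob_space_distr[OF RU[of 0]] RU_law[of 0] by simp
  interpret Q: prob_space Q using M.prob_space_distr[OF RE[of 0]] RE_law[of 0] by simp
  have Sph_\<mu>: "(\<lambda>u. Sph d u j) \<in> borel_measurable \<mu>" for j
    using Sph_measurable[OF d2] measurable_cong_sets[OF sets_\<mu> refl] by blast

  interpret S: sphere_law \<mu> d "Sph d"
  proof
    show "\<not> (AE u in \<mu>. (Sph d u 0)\<^sup>2 = c)" for c
    proof
      \<comment> \<open>A constant square would confine the first angle to a countable level set,
        which is null for a law with a density.\<close>
      assume "AE u in \<mu>. (Sph d u 0)\<^sup>2 = c"
      moreover have "AE u in \<mu>. u 0 \<notin> {x. (cos (2 * pi * x))\<^sup>2 = c}"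
      proof -
        have "{x. (cos (2 * pi * x))\<^sup>2 = c} \<in> null_sets lborel"
          by (rule countable_imp_null_set_lborel[OF countable_cos_power2_eq])
        then have "AE u in lebK (d - 1). u 0 \<notin> {x. (cos (2 * pi * x))\<^sup>2 = c}"
          using d2 by (intro AE_lebK_component) auto
        then show ?thesis unfolding \<mu>_def using f_meas by (subst AE_density) auto
      qed
      ultimately have "AE u in \<mu>. False" by eventually_elim (simp add: Sph_def)
      then show False by simp
    qed
  qed (use d2 Sph_\<mu> Sph_unit in auto)

  have open_closed: "AE u in lebK (d - 1). indicator (open_cube (d - 1)) u * f u = f u"
  proof -
    have "AE u in lebK (d - 1). \<forall>j\<in>{..<d - 1}. u j \<notin> {0, 1}"
      by (intro AE_finite_allI AE_lebK_component) (auto intro: countable_imp_null_set_lborel)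
    with AE_space show ?thesis
    proof eventually_elim
      case (elim u)
      show ?case
      proof (cases "u \<in> open_cube (d - 1)")
        case False
        with elim have "u \<notin> closed_cube (d - 1)"
          by (force simp: open_cube_def closed_cube_def less_le)
        with f_supp elim show ?thesis by simp
      qed simp
    qed
  qed
  have [measurable]: "(indicator (open_cube (d - 1)) :: (nat \<Rightarrow> real) \<Rightarrow> real) \<in> borel_measurable (lebK (d - 1))"
  proof -
    have "{u \<in> space (lebK (d - 1)). \<forall>j\<in>{..<d - 1}. 0 < u j \<and> u j < 1} \<in> sets (lebK (d - 1))" by measurable
    from borel_measurable_indicator[OF this] show ?thesis
      by (rule measurable_cong[THEN iffD1, rotated]) (auto simp: indicator_def open_cube_def)
  qed
  have ip_\<mu> [measurable]: "(\<lambda>u. ip d t (Sph d u)) \<in> borel_measurable (lebK (d - 1))" for t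
    unfolding ip_def using Sph_measurable[OF d2] by measurable
  have cube_integral: "(\<integral>u. (indicator (open_cube (d - 1)) u * f u) *\<^sub>R g u \<partial>lebK (d - 1)) = (\<integral>u. g u \<partial>\<mu>)"
    if [measurable]: "g \<in> borel_measurable (lebK (d - 1))" for g :: "(nat \<Rightarrow> real) \<Rightarrow> 'b :: {banach, second_countable_topology}"
  proof -
    note [measurable] = f_meas
    have "(\<integral>u. g u \<partial>\<mu>) = (\<integral>u. f u *\<^sub>R g u \<partial>lebK (d - 1))"
      unfolding \<mu>_def using f_nonneg by (subst integral_density) auto
    also have "\<dots> = (\<integral>u. (indicator (open_cube (d - 1)) u * f u) *\<^sub>R g u \<partial>lebK (d - 1))"
      by (rule integral_cong_AE) (use open_closed in auto)
    finally show ?thesis by simp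
  qed
  have Psi_eq: "Psi d f R t = S.P 0 R t" for R t
  proof -
    have "(\<lambda>u. R * ip d t (Sph d u)) \<in> borel_measurable (lebK (d - 1))"
      by (intro borel_measurable_times borel_measurable_const ip_\<mu>)
    from cube_integral[OF measurable_compose[OF this measurable_cis]] show ?thesis
      by (simp add: Psi_def S.P_def scaleR_conv_of_real)
  qed
  have ES_eq: "ES_f d f j = (\<integral>u. Sph d u j \<partial>\<mu>)" for j
    using cube_integral[OF Sph_measurable[OF d2, of j]] by (simp add: ES_f_def)

  define W where "W i \<omega> = restrict (Y i \<omega>) {..<d}" for i \<omega>
  \<comment> \<open>Each observation is a fixed measurable function of its own direction and noise,
    which transports both the law and the independence.\<close>
  define G where "G z = restrict (\<lambda>j. Cstar j + Rstar * Sph d (fst z) j + snd z j) {..<d}" for z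
  have G [measurable]: "G \<in> lebK (d - 1) \<Otimes>\<^sub>M lebK d \<rightarrow>\<^sub>M lebK d"
    unfolding G_def
    by (intro measurable_lebK_restrict borel_measurable_add borel_measurable_times borel_measurable_const
        measurable_compose[OF measurable_fst Sph_measurable[OF d2]] measurable_compose[OF measurable_snd measurable_lebK_component])
  have W_eq: "W i \<omega> = G (RU i \<omega>, RE i \<omega>)" for i \<omega>
    by (auto simp: W_def G_def RU_def RE_def Y_def Sph_restrict[OF d2])
  have pair: "M.indep_var (lebK (d - 1)) (RU i) (lebK d) (RE i)" for i
  proof -
    have "M.indep_var (lebK (d - 1)) ((\<lambda>z. z (Inl i)) \<circ> (\<lambda>\<omega>. restrict (\<lambda>j. ?X j \<omega>) {Inl i}))
        (lebK d) ((\<lambda>z. z (Inr i)) \<circ> (\<lambda>\<omega>. restrict (\<lambda>j. ?X j \<omega>) {Inr i}))"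
    proof (rule M.indep_var_compose[OF M.indep_var_restrict[OF indep]])
      show "(\<lambda>z. z (Inl i)) \<in> Pi\<^sub>M {Inl i} ?M' \<rightarrow>\<^sub>M lebK (d - 1)"
        using measurable_component_singleton[of "Inl i" "{Inl i}" ?M'] by simp
      show "(\<lambda>z. z (Inr i)) \<in> Pi\<^sub>M {Inr i} ?M' \<rightarrow>\<^sub>M lebK d"
        using measurable_component_singleton[of "Inr i" "{Inr i}" ?M'] by simp
    qed auto
    then show ?thesis by (simp add: comp_def RU_def[abs_def] RE_def[abs_def])
  qed
  define D where "D = distr (\<mu> \<Otimes>\<^sub>M Q) (lebK d) G"
  have W_law: "distr M (lebK d) (W i) = D" for i
  proof -
    have "distr M (lebK (d - 1) \<Otimes>\<^sub>M lebK d) (\<lambda>\<omega>. (RU i \<omega>, RE i \<omega>)) = \<mu> \<Otimes>\<^sub>M Q"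
      using pair[of i] unfolding M.indep_var_distribution_eq by (simp add: RU_law RE_law)
    then have "D = distr (distr M (lebK (d - 1) \<Otimes>\<^sub>M lebK d) (\<lambda>\<omega>. (RU i \<omega>, RE i \<omega>))) (lebK d) G"
      by (simp add: D_def)
    also have "\<dots> = distr M (lebK d) (W i)"
      by (subst distr_distr) (auto simp: comp_def W_eq[abs_def])
    finally show ?thesis by simp
  qed
  have W_indep: "M.indep_vars (\<lambda>_. lebK d) W UNIV"
  proof -
    \<comment> \<open>The joint family of directions and noises is cut into disjoint blocks, one per
      observation; functions of disjoint blocks are independent.\<close>
    let ?K = "\<lambda>i :: nat. {Inl i, Inr i} :: (nat + nat) set"
    have "M.indep_vars (\<lambda>i. Pi\<^sub>M (?K i) ?M') (\<lambda>i \<omega>. restrict (\<lambda>j. ?X j \<omega>) (?K i)) UNIV"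
      by (rule M.indep_vars_restrict[OF indep]) (auto simp: disjoint_family_on_def)
    then have "M.indep_vars (\<lambda>_. lebK d) (\<lambda>i \<omega>. (\<lambda>z. G (z (Inl i), z (Inr i))) (restrict (\<lambda>j. ?X j \<omega>) (?K i))) UNIV"
    proof (rule M.indep_vars_compose2)
      fix i
      have "(\<lambda>z. z (Inl i)) \<in> Pi\<^sub>M (?K i) ?M' \<rightarrow>\<^sub>M lebK (d - 1)" "(\<lambda>z. z (Inr i)) \<in> Pi\<^sub>M (?K i) ?M' \<rightarrow>\<^sub>M lebK d"
        using measurable_component_singleton[of "Inl i" "?K i" ?M'] measurable_component_singleton[of "Inr i" "?K i" ?M'] by simp_all
      then show "(\<lambda>z. G (z (Inl i), z (Inr i))) \<in> Pi\<^sub>M (?K i) ?M' \<rightarrow>\<^sub>M lebK d"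
        by measurable
    qed
    then show ?thesis by (simp add: W_eq[abs_def] RU_def RE_def)
  qed
  have W_meas [measurable]: "W i \<in> M \<rightarrow>\<^sub>M lebK d" for i
    using W_indep unfolding M.indep_vars_def2 by simp
  define \<phi> where "\<phi> t = cis (ip d t Cstar) * charf d Q t" for t
  have charf_D: "charf d D t = S.P 0 Rstar t * \<phi> t" for t
  proof -
    have "charf d D t = (\<integral>\<omega>. cis (ip d t (W 0 \<omega>)) \<partial>M)"
      unfolding charf_def W_law[of 0, symmetric] by (subst integral_distr) auto
    also have "\<dots> = (\<integral>\<omega>. cis (ip d t Cstar) * (cis (Rstar * ip d t (Sph d (RU 0 \<omega>))) * cis (ip d t (RE 0 \<omega>))) \<partial>M)"
    proof (rule Bochner_Integration.integral_cong)
      fix \<omega>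
      have "ip d t (W 0 \<omega>) = ip d t Cstar + (Rstar * ip d t (Sph d (RU 0 \<omega>)) + ip d t (RE 0 \<omega>))"
        unfolding W_eq by (simp add: ip_def G_def sum.distrib sum_distrib_left algebra_simps)
      then show "cis (ip d t (W 0 \<omega>)) = cis (ip d t Cstar) * (cis (Rstar * ip d t (Sph d (RU 0 \<omega>))) * cis (ip d t (RE 0 \<omega>)))"
        by (simp add: cis_mult)
    qed simp
    also have "\<dots> = cis (ip d t Cstar) * (\<integral>\<omega>. cis (Rstar * ip d t (Sph d (RU 0 \<omega>))) * cis (ip d t (RE 0 \<omega>)) \<partial>M)"
      by simp
    also have "(\<integral>\<omega>. cis (Rstar * ip d t (Sph d (RU 0 \<omega>))) * cis (ip d t (RE 0 \<omega>)) \<partial>M) =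
      (\<integral>\<omega>. cis (Rstar * ip d t (Sph d (RU 0 \<omega>))) \<partial>M) * (\<integral>\<omega>. cis (ip d t (RE 0 \<omega>)) \<partial>M)"
    proof (rule M.indep_var_lebesgue_integral)
      have "M.indep_var borel ((\<lambda>u. cis (Rstar * ip d t (Sph d u))) \<circ> RU 0) borel ((\<lambda>x. cis (ip d t x)) \<circ> RE 0)"
        by (rule M.indep_var_compose[OF pair]) measurable
      then show "M.indep_var borel (\<lambda>\<omega>. cis (Rstar * ip d t (Sph d (RU 0 \<omega>)))) borel (\<lambda>\<omega>. cis (ip d t (RE 0 \<omega>)))"
        by (simp add: comp_def)
    qed (auto intro!: M.integrable_const_bound[where B=1])
    also have "(\<integral>\<omega>. cis (Rstar * ip d t (Sph d (RU 0 \<omega>))) \<partial>M) = S.P 0 Rstar t"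
      unfolding S.P_def unfolding RU_law[of 0, symmetric] by (subst integral_distr) auto
    also have "(\<integral>\<omega>. cis (ip d t (RE 0 \<omega>)) \<partial>M) = charf d Q t"
      unfolding charf_def RE_law[of 0, symmetric] by (subst integral_distr) auto
    finally show ?thesis by (simp add: \<phi>_def)
  qed
  have charf_Q: "charf d Q t = (\<Prod>j<d. \<integral>\<omega>. cis (t j * \<epsilon> 0 \<omega> j) \<partial>M)" for t
    using charf_indep_coordinates[OF prob H1 RE[of 0, unfolded RE_def[abs_def]]] eps_law by simp
  interpret L: deconvolution_sample \<mu> d "Sph d" M W D \<phi> \<nu> Rstar
  proof
    show "0 < Rstar" using Rmin_pos Rstar_in by simp
    \<comment> \<open>The translation factor splits because \<open>ip\<close> is additive over the
      blocks, the noise factor because the noise has independent coordinates.\<close>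
    show "\<phi> (e1 t) * \<phi> (e2 t) = \<phi> t" for t
    proof -
      have "charf d Q (e1 t) * charf d Q (e2 t) = charf d Q t"
        unfolding charf_Q by (rule prod_split_e12) (simp add: M.prob_space)
      then show ?thesis
        by (simp add: \<phi>_def ip_split[of d t] cis_mult[symmetric] mult.commute mult.left_commute)
    qed
    show "continuous_on UNIV \<phi>"
      unfolding \<phi>_def[abs_def] ip_def
      by (intro continuous_on_mult continuous_on_cis continuous_on_sum continuous_on_product_coordinates continuous_on_const
          charf_continuous[OF Q.prob_space_axioms sets_Q])
    have "(\<lambda>t. charf d Q t) \<in> borel_measurable (lebK d)"
      by (rule measurable_charf[OF Q.prob_space_axioms sets_Q]) measurable
    moreover have "(\<lambda>t. ip d t Cstar) \<in> borel_measurable (lebK d)" unfolding ip_def by measurable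
    ultimately show "\<phi> \<in> borel_measurable (lebK d)" unfolding \<phi>_def[abs_def] by measurable
    show "cmod (\<phi> t) \<le> 1" for t
      using cmod_charf_le[OF Q.prob_space_axioms sets_Q, of t] by (simp add: \<phi>_def norm_mult)
    show "\<phi> (restrict (\<lambda>_. 0) {..<d}) \<noteq> 0"
      by (simp add: \<phi>_def charf_def ip_def Q.prob_space)
  qed (use W_indep W_law nu_pos charf_D in auto)

  have emp_eq: "psin d Y n \<omega> t = L.emp n \<omega> t" for n \<omega> t
    by (simp add: L.emp_def psin_def W_def)
  have Mn_eq: "Mn d f \<nu> Y n \<omega> R = L.J (L.qn n \<omega>) (L.emp n \<omega>) R" for n \<omega> R
    unfolding Mn_def L.J_def L.T_def integral_boxm Psi_eq emp_eq S.Q_0 L.qn_def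
    by (simp add: mult.assoc mult.commute mult.left_commute)
  \<comment> \<open>The translation factor of \<open>\<phi>\<close> has modulus 1, so only the noise
    remains in the limiting contrast.\<close>
  have Mlim_eq: "Mlim d f \<nu> Q Rstar R = L.J L.q L.p R" for R
    unfolding Mlim_def L.J_def integral_boxm L.T_eq
    by (simp add: Psi_eq S.Q_0 \<phi>_def norm_mult power_mult_distrib mult.assoc mult.commute mult.left_commute)
  have Mn_deriv: "((\<lambda>R. Mn d f \<nu> Y n \<omega> R) has_real_derivative L.J1 (L.qn n \<omega>) (L.emp n \<omega>) R) (at R)" for n \<omega> R
    unfolding Mn_eq using L.J_deriv[OF L.q_adm(2) L.emp_adm(2)] by simp
  have Mlim_fun: "Mlim d f \<nu> Q Rstar = L.J L.q L.p" by (rule ext) (rule Mlim_eq)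
  have Mlim_deriv: "(Mlim d f \<nu> Q Rstar has_real_derivative L.J1 L.q L.p R) (at R)" for R
    unfolding Mlim_fun by (rule L.J_deriv[OF L.q_adm(1) L.emp_adm(1)])
  then have deriv_Mlim: "deriv (Mlim d f \<nu> Q Rstar) = L.J1 L.q L.p"
    by (intro ext DERIV_imp_deriv)
  have Mlim_deriv2: "(deriv (Mlim d f \<nu> Q Rstar) has_real_derivative L.J2 L.q L.p R) (at R)" for R
    unfolding deriv_Mlim by (rule L.J1_deriv[OF L.q_adm(1) L.emp_adm(1)])
  have deriv2_Mlim: "deriv (deriv (Mlim d f \<nu> Q Rstar)) Rstar = L.J2 L.q L.p Rstar"
    by (rule DERIV_imp_deriv[OF Mlim_deriv2])
  have deriv_Mn: "deriv (\<lambda>R. Mn d f \<nu> Y n \<omega> R) Rstar = L.J1 (L.qn n \<omega>) (L.emp n \<omega>) Rstar" for n \<omega>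
    by (rule DERIV_imp_deriv[OF Mn_deriv])

  have S_int: "integrable M (\<lambda>\<omega>. Sph d (RU 0 \<omega>) j)" and S_mean: "(\<integral>\<omega>. Sph d (RU 0 \<omega>) j \<partial>M) = ES_f d f j" if "j < d" for j
  proof -
    note [measurable] = Sph_measurable[OF d2, of j]
    show "integrable M (\<lambda>\<omega>. Sph d (RU 0 \<omega>) j)"
      using S.S_bound[OF that] by (intro M.integrable_const_bound[where B=1]) auto
    show "(\<integral>\<omega>. Sph d (RU 0 \<omega>) j \<partial>M) = ES_f d f j"
      unfolding ES_eq RU_law[of 0, symmetric] by (subst integral_distr) auto
  qed
  have eps_meas: "(\<lambda>\<omega>. \<epsilon> 0 \<omega> j) \<in> borel_measurable M" if "j < d" for j
    using measurable_compose[OF RE[of 0] measurable_lebK_component[OF that]] that by (simp add: RE_def)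
  have eps_int: "integrable M (\<lambda>\<omega>. \<epsilon> 0 \<omega> j)" if "j < d" for j
    using M.square_integrable_imp_integrable[OF eps_meas[OF that]] moment2 that by simp
  have Y_eq: "Y 0 \<omega> j = (Cstar j + Rstar * Sph d (RU 0 \<omega>) j) + \<epsilon> 0 \<omega> j" for \<omega> j
    by (simp add: Y_def RU_def Sph_restrict[OF d2])
  have Y_mean: "(\<integral>\<omega>. Y 0 \<omega> j \<partial>M) = Cstar j + Rstar * ES_f d f j" if "j < d" for j
    unfolding Y_eq using S_int[OF that] S_mean[OF that] eps_int[OF that] centered that by (simp add: M.prob_space)
  have D_mean: "(\<integral>y. y j \<partial>D) = (\<integral>\<omega>. Y 0 \<omega> j \<partial>M)" if "j < d" for j
    unfolding W_law[of 0, symmetric] using that by (subst integral_distr) (auto simp: W_def)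
  have D_moment: "integrable D (\<lambda>y. (y j)\<^sup>2)" if "j < d" for j
  proof -
    have "integrable M (\<lambda>\<omega>. (Y 0 \<omega> j)\<^sup>2)"
    proof (rule Bochner_Integration.integrable_bound)
      show "integrable M (\<lambda>\<omega>. 2 * (\<bar>Cstar j\<bar> + \<bar>Rstar\<bar>)\<^sup>2 + 2 * (\<epsilon> 0 \<omega> j)\<^sup>2)"
        using moment2 that by simp
      show "(\<lambda>\<omega>. (Y 0 \<omega> j)\<^sup>2) \<in> borel_measurable M"
        unfolding Y_eq using S_int[OF that] eps_meas[OF that] by measurable
      show "AE \<omega> in M. norm ((Y 0 \<omega> j)\<^sup>2) \<le> norm (2 * (\<bar>Cstar j\<bar> + \<bar>Rstar\<bar>)\<^sup>2 + 2 * (\<epsilon> 0 \<omega> j)\<^sup>2)"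
      proof (intro AE_I2)
        fix \<omega>
        define x where "x = Cstar j + Rstar * Sph d (RU 0 \<omega>) j"
        have "\<bar>x\<bar> \<le> \<bar>Cstar j\<bar> + \<bar>Rstar\<bar> * 1"
          unfolding x_def using mult_left_mono[OF S.S_bound[OF that, of "RU 0 \<omega>"], of "\<bar>Rstar\<bar>"]
          by (intro order.trans[OF abs_triangle_ineq] add_mono) (auto simp: abs_mult)
        then have "x\<^sup>2 \<le> (\<bar>Cstar j\<bar> + \<bar>Rstar\<bar>)\<^sup>2" by (simp add: abs_le_square_iff[symmetric])
        moreover have "(x + \<epsilon> 0 \<omega> j)\<^sup>2 \<le> 2 * x\<^sup>2 + 2 * (\<epsilon> 0 \<omega> j)\<^sup>2"
          using sum_squares_bound[of x "\<epsilon> 0 \<omega> j"] by (simp add: power2_sum)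
        ultimately show "norm ((Y 0 \<omega> j)\<^sup>2) \<le> norm (2 * (\<bar>Cstar j\<bar> + \<bar>Rstar\<bar>)\<^sup>2 + 2 * (\<epsilon> 0 \<omega> j)\<^sup>2)"
          unfolding Y_eq x_def[symmetric] by simp
      qed
    qed
    then show ?thesis
      unfolding W_law[of 0, symmetric] using that by (subst integrable_distr_eq) (auto simp: W_def)
  qed
  define ES where "ES = (\<lambda>j. \<integral>\<omega>. Sph d (U 0 \<omega>) j \<partial>M)"
  have ES: "ES j = ES_f d f j" if "j < d" for j
    using S_mean[OF that] by (simp add: ES_def RU_def Sph_restrict[OF d2])
  obtain V N N' where N: "centered_gaussian (d + 1) V N"
      "conv_distr M (d + 1) (\<lambda>n \<omega> j. sqrt (real n) *
         (if j < d then (1 / real n) * (\<Sum>i<n. W i \<omega> j) - (\<integral>y. y j \<partial>D) else L.J1 (L.qn n \<omega>) (L.emp n \<omega>) Rstar)) N"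
    and N': "centered_gaussian (d + 1) (sandwich (d + 1) (Amat d ES (L.J2 L.q L.p Rstar)) V) N'"
      "conv_distr M (d + 1) (\<lambda>n \<omega> j. sqrt (real n) *
         (if j = 0 then Rt n \<omega> - Rstar
          else (1 / real n) * (\<Sum>i<n. W i \<omega> (j - 1)) - (\<integral>y. y (j - 1) \<partial>D) - (Rt n \<omega> - Rstar) * ES (j - 1))) N'"
    using L.joint_limits[of Rmin Rmax Rt ES, OF D_moment Rmin_pos Rstar_in] Rt_meas Rt_min unfolding Mn_eq by blast
  have lim1: "conv_distr M (d + 1)
                (\<lambda>n \<omega> j. sqrt (real n) *
                   (if j < d then (1 / real n) * (\<Sum>i<n. Y i \<omega> j) - (\<integral>\<omega>'. Y 0 \<omega>' j \<partial>M)
                    else deriv (\<lambda>R. Mn d f \<nu> Y n \<omega> R) Rstar)) N"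
    using N(2) by (rule conv_distr_cong) (simp add: W_def D_mean deriv_Mn)
  have lim2: "conv_distr M (d + 1)
                (\<lambda>n \<omega> j. sqrt (real n) *
                   (if j = 0 then Rt n \<omega> - Rstar
                    else Ctilde d f Y Rt n \<omega> (j - 1) - Cstar (j - 1))) N'"
    using N'(2)
  proof (rule conv_distr_cong)
    fix n \<omega> j assume "j < d + 1"
    show "sqrt (real n) *
         (if j = 0 then Rt n \<omega> - Rstar
          else (1 / real n) * (\<Sum>i<n. W i \<omega> (j - 1)) - (\<integral>y. y (j - 1) \<partial>D) - (Rt n \<omega> - Rstar) * ES (j - 1)) =
       sqrt (real n) * (if j = 0 then Rt n \<omega> - Rstar else Ctilde d f Y Rt n \<omega> (j - 1) - Cstar (j - 1))"
    proof (cases "j = 0")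
      case False
      with \<open>j < d + 1\<close> have "j - 1 < d" by simp
      \<comment> \<open>Since \<open>Y\<close> has mean \<open>Cstar + Rstar * ES\<close>, the error
        of the centre is the error of the sample mean minus \<open>ES\<close> times the error of the
        radius.\<close>
      then show ?thesis
        by (simp add: False W_def D_mean Y_mean ES Ctilde_def algebra_simps)
    qed simp
  qed
  have "\<forall>n \<omega>. (\<lambda>R. Mn d f \<nu> Y n \<omega> R) differentiable (at Rstar)"
    using Mn_deriv real_differentiable_def by blast
  moreover have "\<forall>R. Mlim d f \<nu> Q Rstar differentiable (at R)"
    using Mlim_deriv real_differentiable_def by blast
  moreover have "deriv (Mlim d f \<nu> Q Rstar) differentiable (at Rstar)"
    using Mlim_deriv2 real_differentiable_def by blast
  moreover have "deriv (deriv (Mlim d f \<nu> Q Rstar)) Rstar \<noteq> 0"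
    unfolding deriv2_Mlim using L.J2_pos by simp
  ultimately show ?thesis
    using N(1) N'(1) lim1 lim2 unfolding deriv2_Mlim ES_def by blast
qed

end
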